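(* Let $q\ge1$ be an integer. In the local setting ($W^*_q=W^*_q(\Omega)$ with $\Omega$ a bounded domain in $\mathbb{C}^k$) as well as in the global setting ($W^*_q=W^*_q(X)$ with $(X,\omega)$ a compact Kähler manifold of dimension $k$), the function $\varphi\mapsto\|\varphi\|_{*,q}$ defines a quasinorm on $W^*_q$.
   Context: A quasinorm satisfies the axioms of a norm, except that the triangle inequality is replaced by $\|f+g\|\le C(\|f\|+\|g\|)$ for some constant $C\ge1$. $d^c$ is the usual real operator, so that $dd^c$ is a fixed positive multiple of $i\partial\bar\partial$. Inequalities between currents are in the sense of positive currents; functions are real and identified if equal a.e. Local setting. $W^*_q(\Omega)$ is defined inductively as the set of $\varphi\in W^{1,2}(\Omega)$ with $d\varphi\wedge d^c\varphi\le dd^c\psi$ for some $\psi\in W^*_{q-1}(\Omega)\cap\mathrm{PSH}(\Omega)$ (just $\psi\in\mathrm{PSH}(\Omega)$ if $q=1$) with $\|dd^c\psi\|:=\int_\Omega dd^c\psi\wedge(dd^c|z|^2)^{k-1}<\infty$. A defining sequence of $\varphi$ is a tuple $(\varphi_1,\dots,\varphi_q)$ of psh functions on $\Omega$ with $\|dd^c\varphi_j\|<\infty$ and $d\varphi_{j-1}\wedge d^c\varphi_{j-1}\le dd^c\varphi_j$ for $j=1,\dots,q$, where $\varphi_0:=\varphi$. Then $\|\varphi\|_{*,q}=\|\varphi\|_{L^2(\Omega)}+\inf\sum_{j=1}^q\|dd^c\varphi_j\|^{1/2^j}$, infimum over defining sequences. Global setting. $W^*_q(X)$ is defined inductively as the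 set of $\varphi\in W^{1,2}(X)$ with $d\varphi\wedge d^c\varphi\le c\,\omega+dd^c\psi$ for some constant $c\ge0$ and some quasi-psh $\psi\in W^*_{q-1}(X)$ (just $\psi$ quasi-psh if $q=1$). A defining sequence of $\varphi$ is a tuple $((c_1,\varphi_1),\dots,(c_q,\varphi_q))$ with $c_j\ge0$ and $\varphi_j$ quasi-psh on $X$ such that $d\varphi_{j-1}\wedge d^c\varphi_{j-1}\le c_j\omega+dd^c\varphi_j$ for $j=1,\dots,q$, where $\varphi_0:=\varphi$. Then $\|\varphi\|_{*,q}=\|\varphi\|_{L^2(X)}+\inf\sum_{j=1}^qc_j^{1/2^j}$, infimum over defining sequences. *)

theory Defs
  imports "HOL-Analysis.Analysis"
begin

section \<open>Quasinorms on spaces of functions modulo a.e. equality\<close>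

text \<open>
  \<open>W\<close> is a real vector space of functions, saturated for a.e. equality, and \<open>N\<close> is a
  quasinorm on the quotient of \<open>W\<close> by a.e. equality.
\<close>

definition quasinorm_mod_ae ::
  "'a measure \<Rightarrow> ('a \<Rightarrow> real) set \<Rightarrow> (('a \<Rightarrow> real) \<Rightarrow> real) \<Rightarrow> bool" where
  "quasinorm_mod_ae M W N \<longleftrightarrow>
     W \<subseteq> borel_measurable M \<and>
     (\<lambda>x. 0) \<in> W \<and>
     (\<forall>f\<in>W. \<forall>g\<in>W. (\<lambda>x. f x + g x) \<in> W) \<and>
     (\<forall>t. \<forall>f\<in>W. (\<lambda>x. t * f x) \<in> W) \<and>
     (\<forall>f\<in>W. \<forall>g. (AE x in M. f x = g x) \<longrightarrow> g \<in> W \<and> N g = N f) \<and>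
     (\<forall>f\<in>W. 0 \<le> N f) \<and>
     (\<forall>f\<in>W. N f = 0 \<longleftrightarrow> (AE x in M. f x = 0)) \<and>
     (\<forall>t. \<forall>f\<in>W. N (\<lambda>x. t * f x) = \<bar>t\<bar> * N f) \<and>
     (\<exists>C\<ge>1. \<forall>f\<in>W. \<forall>g\<in>W. N (\<lambda>x. f x + g x) \<le> C * (N f + N g))"

definition L2_norm :: "'a measure \<Rightarrow> ('a \<Rightarrow> real) \<Rightarrow> real" where
  "L2_norm M f = sqrt (LINT x|M. (f x)\<^sup>2)"


section \<open>Smooth functions, test functions and Wirtinger derivatives\<close>

text \<open>\<open>C_on n S f\<close>: \<open>f\<close> is of class \<open>C\<^sup>n\<close> on the open set \<open>S\<close>.\<close>

fun C_on :: "nat \<Rightarrow> 'a::euclidean_space set \<Rightarrow> ('a \<Rightarrow> 'b::real_normed_vector) \<Rightarrow> bool" where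
  "C_on 0 S f = continuous_on S f"
| "C_on (Suc n) S f =
     (f differentiable_on S \<and> (\<forall>b\<in>Basis. C_on n S (\<lambda>x. frechet_derivative f (at x) b)))"

definition smooth_on :: "'a::euclidean_space set \<Rightarrow> ('a \<Rightarrow> 'b::real_normed_vector) \<Rightarrow> bool" where
  "smooth_on S f \<longleftrightarrow> (\<forall>n. C_on n S f)"

definition test_fun :: "'a::euclidean_space set \<Rightarrow> ('a \<Rightarrow> real) \<Rightarrow> bool" where
  "test_fun S \<eta> \<longleftrightarrow>
     smooth_on UNIV \<eta> \<and> (\<exists>K. compact K \<and> K \<subseteq> S \<and> (\<forall>x. x \<notin> K \<longrightarrow> \<eta> x = 0))"

definition dz :: "'k::finite \<Rightarrow> (complex^'k \<Rightarrow> complex) \<Rightarrow> complex^'k \<Rightarrow> complex" where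
  "dz j f x = (frechet_derivative f (at x) (axis j 1)
               - \<i> * frechet_derivative f (at x) (axis j \<i>)) / 2"

definition dzbar :: "'k::finite \<Rightarrow> (complex^'k \<Rightarrow> complex) \<Rightarrow> complex^'k \<Rightarrow> complex" where
  "dzbar j f x = (frechet_derivative f (at x) (axis j 1)
               + \<i> * frechet_derivative f (at x) (axis j \<i>)) / 2"


section \<open>Sobolev functions\<close>

definition loc_integrable ::
  "'a::euclidean_space set \<Rightarrow> ('a \<Rightarrow> 'b::{banach, second_countable_topology}) \<Rightarrow> bool" where
  "loc_integrable S f \<longleftrightarrow> (\<forall>K. compact K \<and> K \<subseteq> S \<longrightarrow> integrable (lebesgue_on K) f)"

definition weak_gradient ::
  "'a::euclidean_space set \<Rightarrow> ('a \<Rightarrow> real) \<Rightarrow> ('a \<Rightarrow> 'a) \<Rightarrow> bool" where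
  "weak_gradient S f G \<longleftrightarrow> loc_integrable S f \<and> loc_integrable S G \<and>
     (\<forall>\<eta> v. test_fun S \<eta> \<longrightarrow>
        (LINT x|lebesgue_on S. f x * frechet_derivative \<eta> (at x) v)
        = - (LINT x|lebesgue_on S. \<eta> x * (G x \<bullet> v)))"

definition W12 :: "'a::euclidean_space set \<Rightarrow> ('a \<Rightarrow> real) set" where
  "W12 S = {f \<in> borel_measurable (lebesgue_on S).
     integrable (lebesgue_on S) (\<lambda>x. (f x)\<^sup>2) \<and>
     (\<exists>G. weak_gradient S f G \<and> integrable (lebesgue_on S) (\<lambda>x. (norm (G x))\<^sup>2))}"

definition W12_loc :: "'a::euclidean_space set \<Rightarrow> ('a \<Rightarrow> real) set" where
  "W12_loc S = {f. loc_integrable S (\<lambda>x. (f x)\<^sup>2) \<and>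
     (\<exists>G. weak_gradient S f G \<and> loc_integrable S (\<lambda>x. (norm (G x))\<^sup>2))}"


section \<open>Plurisubharmonic functions\<close>

text \<open>The Lebesgue integral \<open>\<integral>f\<^sup>+ - \<integral>f\<^sup>-\<close> of an extended real function (here always with
  \<open>\<integral>f\<^sup>+ < \<infinity>\<close>, so that the value may be \<open>-\<infinity>\<close>).\<close>

definition ereal_integral :: "'a measure \<Rightarrow> ('a \<Rightarrow> ereal) \<Rightarrow> ereal" where
  "ereal_integral M f =
     enn2ereal (\<integral>\<^sup>+x. e2ennreal (f x) \<partial>M) - enn2ereal (\<integral>\<^sup>+x. e2ennreal (- f x) \<partial>M)"

text \<open>\<open>U\<close> is open, not necessarily connected. The three conditions are upper semicontinuity with
  values in \<open>[-\<infinity>,\<infinity>)\<close>, not being identically \<open>-\<infinity>\<close> on any component, and the submean inequality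
  on closed discs contained in complex lines.\<close>

definition psh_on :: "(complex^'k::finite) set \<Rightarrow> (complex^'k \<Rightarrow> ereal) \<Rightarrow> bool" where
  "psh_on U u \<longleftrightarrow>
     (\<forall>r. open {x\<in>U. u x < r}) \<and> (\<forall>x\<in>U. u x < \<infinity>) \<and>
     (\<forall>C\<in>components U. \<exists>x\<in>C. u x \<noteq> - \<infinity>) \<and>
     (\<forall>p a. (\<forall>\<zeta>. norm \<zeta> \<le> 1 \<longrightarrow> p + \<zeta> *s a \<in> U) \<longrightarrow>
        u p \<le> ereal_integral (lebesgue_on {0..2*pi}) (\<lambda>\<theta>. u (p + cis \<theta> *s a)) / ereal (2*pi))"


section \<open>Currents of bidegree (1,1)\<close>

text \<open>
  A real (1,1)-current \<open>T = i \<Sum> T\<^sub>j\<^sub>l dz\<^sub>j \<and> d(cnj z\<^sub>l)\<close> is represented by its coefficients, i.e. by the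
  map sending a test function \<open>\<eta>\<close> to the matrix \<open>(T\<^sub>j\<^sub>l(\<eta>))\<close>.
\<close>

type_synonym 'k current = "(complex^'k \<Rightarrow> real) \<Rightarrow> complex^'k^'k"

definition hform :: "complex^'k^'k \<Rightarrow> complex^'k::finite \<Rightarrow> complex^'k \<Rightarrow> complex" where
  "hform A u v = (\<Sum>j\<in>UNIV. \<Sum>l\<in>UNIV. A $ j $ l * u $ j * cnj (v $ l))"

text \<open>
  \<open>S \<le> T\<close> on \<open>U\<close>. For constant (1,0)-forms \<open>\<alpha>\<^sub>1,\<dots>,\<alpha>\<^sub>k\<^sub>-\<^sub>1\<close>, the current
  \<open>T \<and> i\<alpha>\<^sub>1\<and>cnj \<alpha>\<^sub>1 \<and> \<dots> \<and> i\<alpha>\<^sub>k\<^sub>-\<^sub>1\<and>cnj \<alpha>\<^sub>k\<^sub>-\<^sub>1\<close> is \<open>2\<^sup>k \<Sum> T\<^sub>j\<^sub>l a\<^sub>j cnj a\<^sub>l\<close> times the volume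
  form, where \<open>a\<^sub>j\<close> is the coefficient of \<open>dz\<^sub>1 \<and> \<dots> \<and> dz\<^sub>k\<close> in
  \<open>dz\<^sub>j \<and> \<alpha>\<^sub>1 \<and> \<dots> \<and> \<alpha>\<^sub>k\<^sub>-\<^sub>1\<close>; the vectors \<open>a\<close> so obtained exhaust \<open>\<complex>\<^sup>k\<close>. Hence \<open>T - S\<close> is
  positive when the distributions \<open>\<Sum> (T - S)\<^sub>j\<^sub>l a\<^sub>j cnj a\<^sub>l\<close> are positive for all \<open>a\<close>.
\<close>

definition current_le :: "(complex^'k::finite) set \<Rightarrow> 'k current \<Rightarrow> 'k current \<Rightarrow> bool" where
  "current_le U S T \<longleftrightarrow>
     (\<forall>\<eta> a. test_fun U \<eta> \<and> (\<forall>x. 0 \<le> \<eta> x) \<longrightarrow> 0 \<le> Re (hform (T \<eta> - S \<eta>) a a))"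

definition form_current ::
  "(complex^'k::finite) set \<Rightarrow> (complex^'k \<Rightarrow> complex^'k^'k) \<Rightarrow> 'k current" where
  "form_current U A \<eta> = (LINT x|lebesgue_on U. \<eta> x *\<^sub>R A x)"

text \<open>
  Here and below the normalisation of \<open>d\<^sup>c\<close> is a parameter \<open>\<kappa> > 0\<close>:
  \<open>d\<^sup>c = (\<kappa>/2) i (\<partial>bar - \<partial>)\<close>, so that \<open>dd\<^sup>c = \<kappa> i\<partial>\<partial>bar\<close> and, for real \<open>\<phi>\<close>,
  \<open>d\<phi> \<and> d\<^sup>c\<phi> = \<kappa> i\<partial>\<phi> \<and> \<partial>bar \<phi>\<close>.
\<close>

definition ddc ::
  "real \<Rightarrow> (complex^'k::finite) set \<Rightarrow> (complex^'k \<Rightarrow> real) \<Rightarrow> 'k current" where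
  "ddc \<kappa> U u \<eta> = (\<chi> j l. of_real \<kappa> *
     (LINT x|lebesgue_on U. of_real (u x) * dz j (dzbar l (\<lambda>y. of_real (\<eta> y))) x))"

text \<open>
  Coefficients of \<open>d\<phi> \<and> d\<^sup>c\<phi>\<close> at a point where \<open>\<phi>\<close> has real gradient \<open>v\<close>:
  \<open>v\<^sub>j = \<partial>\<phi>/\<partial>x\<^sub>j + i \<partial>\<phi>/\<partial>y\<^sub>j\<close> is twice the derivative in \<open>cnj z\<^sub>j\<close>, and
  \<open>cnj v\<^sub>j\<close> is twice the derivative in \<open>z\<^sub>j\<close>.
\<close>

definition grad_form :: "real \<Rightarrow> complex^'k::finite \<Rightarrow> complex^'k^'k" where
  "grad_form \<kappa> v = (\<chi> j l. of_real \<kappa> * cnj (v $ j) * v $ l / 4)"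

text \<open>\<open>d\<phi> \<and> d\<^sup>c\<phi> \<le> T\<close> on \<open>U\<close>; the left-hand side is meaningful when the weak gradient of \<open>\<phi>\<close> is
  locally square integrable, which is part of the condition.\<close>

definition d_wedge_dc_le ::
  "real \<Rightarrow> (complex^'k::finite) set \<Rightarrow> (complex^'k \<Rightarrow> real) \<Rightarrow> 'k current \<Rightarrow> bool" where
  "d_wedge_dc_le \<kappa> U \<phi> T \<longleftrightarrow>
     (\<exists>G. weak_gradient U \<phi> G \<and> loc_integrable U (\<lambda>x. (norm (G x))\<^sup>2) \<and>
          current_le U (form_current U (\<lambda>x. grad_form \<kappa> (G x))) T)"


section \<open>Local setting\<close>

text \<open>
  The total mass of the positive measure \<open>dd\<^sup>cu \<and> (dd\<^sup>c|z|\<^sup>2)\<^sup>k\<^sup>-\<^sup>1\<close>. Since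
  \<open>dd\<^sup>c|z|\<^sup>2 = \<kappa> i \<Sum> dz\<^sub>j \<and> d(cnj z\<^sub>j)\<close> and \<open>i dz\<^sub>j \<and> d(cnj z\<^sub>j) = 2 dx\<^sub>j \<and> dy\<^sub>j\<close>, for a (1,1)-current \<open>T\<close> one
  has \<open>T \<and> (dd\<^sup>c|z|\<^sup>2)\<^sup>k\<^sup>-\<^sup>1 = \<kappa>\<^sup>k\<^sup>-\<^sup>1 (k-1)! 2\<^sup>k (\<Sum> T\<^sub>j\<^sub>j)\<close> times Lebesgue measure.
\<close>

definition ddc_mass ::
  "real \<Rightarrow> (complex^'k::finite) set \<Rightarrow> (complex^'k \<Rightarrow> real) \<Rightarrow> ereal" where
  "ddc_mass \<kappa> \<Omega> u =
     (SUP \<eta>\<in>{\<eta>. test_fun \<Omega> \<eta> \<and> (\<forall>x. 0 \<le> \<eta> x \<and> \<eta> x \<le> 1)}.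
        ereal (\<kappa> ^ (CARD('k) - 1) * fact (CARD('k) - 1) * 2 ^ CARD('k)
               * Re (trace (ddc \<kappa> \<Omega> u \<eta>))))"

text \<open>
  The real function \<open>real_of_ereal \<circ> u\<close> represents the a.e. class of the psh function \<open>u\<close>.
  The value at \<open>0\<close> only serves to start the recursion: for \<open>q = 1\<close> there is no condition on \<open>\<psi>\<close>
  besides being psh with finite mass.
\<close>

fun Wstar_loc ::
  "real \<Rightarrow> (complex^'k::finite) set \<Rightarrow> nat \<Rightarrow> (complex^'k \<Rightarrow> real) set" where
  "Wstar_loc \<kappa> \<Omega> 0 = UNIV"
| "Wstar_loc \<kappa> \<Omega> (Suc q) = {\<phi> \<in> W12 \<Omega>. \<exists>\<psi>. psh_on \<Omega> \<psi> \<and>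
     real_of_ereal \<circ> \<psi> \<in> Wstar_loc \<kappa> \<Omega> q \<and>
     ddc_mass \<kappa> \<Omega> (real_of_ereal \<circ> \<psi>) < \<infinity> \<and>
     d_wedge_dc_le \<kappa> \<Omega> \<phi> (ddc \<kappa> \<Omega> (real_of_ereal \<circ> \<psi>))}"

text \<open>Only the entries \<open>\<Phi> 1, \<dots>, \<Phi> q\<close> of \<open>\<Phi>\<close> matter.\<close>

definition defining_seq_loc ::
  "real \<Rightarrow> (complex^'k::finite) set \<Rightarrow> nat \<Rightarrow> (complex^'k \<Rightarrow> real) \<Rightarrow>
   (nat \<Rightarrow> complex^'k \<Rightarrow> ereal) \<Rightarrow> bool" where
  "defining_seq_loc \<kappa> \<Omega> q \<phi> \<Phi> \<longleftrightarrow> (\<forall>j\<in>{1..q}.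
     psh_on \<Omega> (\<Phi> j) \<and> ddc_mass \<kappa> \<Omega> (real_of_ereal \<circ> \<Phi> j) < \<infinity> \<and>
     d_wedge_dc_le \<kappa> \<Omega> (if j = 1 then \<phi> else real_of_ereal \<circ> \<Phi> (j - 1))
       (ddc \<kappa> \<Omega> (real_of_ereal \<circ> \<Phi> j)))"

definition Wstar_norm_loc ::
  "real \<Rightarrow> (complex^'k::finite) set \<Rightarrow> nat \<Rightarrow> (complex^'k \<Rightarrow> real) \<Rightarrow> real" where
  "Wstar_norm_loc \<kappa> \<Omega> q \<phi> = L2_norm (lebesgue_on \<Omega>) \<phi> +
     Inf {\<Sum>j=1..q. real_of_ereal (ddc_mass \<kappa> \<Omega> (real_of_ereal \<circ> \<Phi> j)) powr (1 / 2 ^ j)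
          | \<Phi>. defining_seq_loc \<kappa> \<Omega> q \<phi> \<Phi>}"


section \<open>Compact Kaehler manifolds\<close>

text \<open>A chart is a pair of a domain and a coordinate map (used on that domain only).\<close>

type_synonym ('x, 'k) chart = "'x set \<times> ('x \<Rightarrow> complex^'k)"

definition holomorphic_map_on ::
  "(complex^'k::finite) set \<Rightarrow> (complex^'k \<Rightarrow> complex^'k) \<Rightarrow> bool" where
  "holomorphic_map_on S F \<longleftrightarrow> (\<forall>p\<in>S. \<exists>D. (F has_derivative D) (at p) \<and>
     (\<forall>v. D (\<i> *s v) = \<i> *s D v))"

definition complex_atlas :: "('x::t2_space, 'k::finite) chart set \<Rightarrow> bool" where
  "complex_atlas A \<longleftrightarrow>
     (\<forall>(U, z)\<in>A. open U \<and> open (z ` U) \<and> homeomorphism U (z ` U) z (inv_into U z)) \<and>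
     (\<Union>(U, z)\<in>A. U) = UNIV \<and>
     (\<forall>(U, z)\<in>A. \<forall>(V, w)\<in>A. holomorphic_map_on (z ` (U \<inter> V)) (w \<circ> inv_into U z))"

text \<open>
  The Kaehler form is given in each chart \<open>(U, z)\<close> by \<open>\<omega> = i \<Sum> g\<^sub>j\<^sub>l dz\<^sub>j \<and> d(cnj z\<^sub>l)\<close> with
  \<open>g = \<omega> (U, z)\<close> a function on \<open>z ` U\<close>. The conditions say that \<open>g\<close> is smooth, Hermitian, positive
  definite and closed (the (2,1)-part of \<open>d\<omega>\<close> vanishes; the (1,2)-part is its conjugate), and that the
  local expressions are pulled back to each other by the coordinate changes.
\<close>

definition kaehler_form ::
  "('x::t2_space, 'k::finite) chart set \<Rightarrow>
   (('x, 'k) chart \<Rightarrow> complex^'k \<Rightarrow> complex^'k^'k) \<Rightarrow> bool" where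
  "kaehler_form A \<omega> \<longleftrightarrow>
     (\<forall>(U, z)\<in>A. let g = \<omega> (U, z) in
        smooth_on (z ` U) g \<and>
        (\<forall>p\<in>z ` U.
           (\<forall>j l. g p $ l $ j = cnj (g p $ j $ l)) \<and>
           (\<forall>a. a \<noteq> 0 \<longrightarrow> 0 < Re (hform (g p) a a)) \<and>
           (\<forall>m j l. dz m (\<lambda>y. g y $ j $ l) p = dz j (\<lambda>y. g y $ m $ l) p))) \<and>
     (\<forall>(U, z)\<in>A. \<forall>(V, w)\<in>A. \<forall>p\<in>z ` (U \<inter> V). \<forall>a b.
        let F = w \<circ> inv_into U z; D = frechet_derivative F (at p) in
        hform (\<omega> (U, z) p) a b = hform (\<omega> (V, w) (F p)) (D a) (D b))"

definition compact_kaehler ::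
  "('x::t2_space, 'k::finite) chart set \<Rightarrow>
   (('x, 'k) chart \<Rightarrow> complex^'k \<Rightarrow> complex^'k^'k) \<Rightarrow> bool" where
  "compact_kaehler A \<omega> \<longleftrightarrow> compact (UNIV :: 'x set) \<and> complex_atlas A \<and> kaehler_form A \<omega>"

text \<open>
  The measure \<open>\<omega>\<^sup>k\<close>. In a chart, \<open>\<omega>\<^sup>k = k! 2\<^sup>k det g\<close> times Lebesgue measure. \<open>chart_vol\<close> is the
  restriction of \<open>\<omega>\<^sup>k\<close> to one chart domain, extended by zero; the global measure is the least one
  dominating all these (a supremum in the lattice of measures), then completed.
\<close>

definition chart_vol ::
  "(('x::t2_space, 'k::finite) chart \<Rightarrow> complex^'k \<Rightarrow> complex^'k^'k) \<Rightarrow> ('x, 'k) chart \<Rightarrow> 'x measure"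
  where
  "chart_vol \<omega> = (\<lambda>(U, z). distr
     (density (restrict_space lborel (z ` U))
        (\<lambda>p. ennreal (fact CARD('k) * 2 ^ CARD('k) * Re (det (\<omega> (U, z) p)))))
     borel (inv_into U z))"

definition kaehler_vol ::
  "('x::t2_space, 'k::finite) chart set \<Rightarrow>
   (('x, 'k) chart \<Rightarrow> complex^'k \<Rightarrow> complex^'k^'k) \<Rightarrow> 'x measure" where
  "kaehler_vol A \<omega> = completion (SUP C\<in>A. chart_vol \<omega> C)"


section \<open>Global setting\<close>

text \<open>As \<open>X\<close> is compact, having an \<open>L\<^sup>2\<close> gradient is a local condition.\<close>

definition W12_mfd ::
  "('x::t2_space, 'k::finite) chart set \<Rightarrow>
   (('x, 'k) chart \<Rightarrow> complex^'k \<Rightarrow> complex^'k^'k) \<Rightarrow> ('x \<Rightarrow> real) set" where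
  "W12_mfd A \<omega> = {f \<in> borel_measurable (kaehler_vol A \<omega>).
     integrable (kaehler_vol A \<omega>) (\<lambda>x. (f x)\<^sup>2) \<and>
     (\<forall>(U, z)\<in>A. f \<circ> inv_into U z \<in> W12_loc (z ` U))}"

definition quasi_psh :: "('x::t2_space, 'k::finite) chart set \<Rightarrow> ('x \<Rightarrow> ereal) \<Rightarrow> bool" where
  "quasi_psh A u \<longleftrightarrow> (\<forall>(U, z)\<in>A. \<forall>p\<in>z ` U. \<exists>V v h.
     open V \<and> p \<in> V \<and> V \<subseteq> z ` U \<and> psh_on V v \<and> smooth_on V (h :: complex^'k \<Rightarrow> real) \<and>
     (\<forall>y\<in>V. u (inv_into U z y) = v y + ereal (h y)))"

text \<open>\<open>d\<phi> \<and> d\<^sup>c\<phi> \<le> c \<omega> + dd\<^sup>cu\<close> on \<open>X\<close>.\<close>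

definition d_wedge_dc_le_mfd ::
  "real \<Rightarrow> ('x::t2_space, 'k::finite) chart set \<Rightarrow>
   (('x, 'k) chart \<Rightarrow> complex^'k \<Rightarrow> complex^'k^'k) \<Rightarrow>
   ('x \<Rightarrow> real) \<Rightarrow> real \<Rightarrow> ('x \<Rightarrow> real) \<Rightarrow> bool" where
  "d_wedge_dc_le_mfd \<kappa> A \<omega> \<phi> c u \<longleftrightarrow> (\<forall>(U, z)\<in>A.
     d_wedge_dc_le \<kappa> (z ` U) (\<phi> \<circ> inv_into U z)
       (\<lambda>\<eta>. form_current (z ` U) (\<lambda>p. c *\<^sub>R \<omega> (U, z) p) \<eta> + ddc \<kappa> (z ` U) (u \<circ> inv_into U z) \<eta>))"

fun Wstar_glob ::
  "real \<Rightarrow> ('x::t2_space, 'k::finite) chart set \<Rightarrow>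
   (('x, 'k) chart \<Rightarrow> complex^'k \<Rightarrow> complex^'k^'k) \<Rightarrow> nat \<Rightarrow> ('x \<Rightarrow> real) set" where
  "Wstar_glob \<kappa> A \<omega> 0 = UNIV"
| "Wstar_glob \<kappa> A \<omega> (Suc q) = {\<phi> \<in> W12_mfd A \<omega>. \<exists>c\<ge>0. \<exists>\<psi>. quasi_psh A \<psi> \<and>
     real_of_ereal \<circ> \<psi> \<in> Wstar_glob \<kappa> A \<omega> q \<and>
     d_wedge_dc_le_mfd \<kappa> A \<omega> \<phi> c (real_of_ereal \<circ> \<psi>)}"

definition defining_seq_glob ::
  "real \<Rightarrow> ('x::t2_space, 'k::finite) chart set \<Rightarrow>
   (('x, 'k) chart \<Rightarrow> complex^'k \<Rightarrow> complex^'k^'k) \<Rightarrow> nat \<Rightarrow> ('x \<Rightarrow> real) \<Rightarrow>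
   (nat \<Rightarrow> real) \<Rightarrow> (nat \<Rightarrow> 'x \<Rightarrow> ereal) \<Rightarrow> bool" where
  "defining_seq_glob \<kappa> A \<omega> q \<phi> c \<Phi> \<longleftrightarrow> (\<forall>j\<in>{1..q}.
     0 \<le> c j \<and> quasi_psh A (\<Phi> j) \<and>
     d_wedge_dc_le_mfd \<kappa> A \<omega> (if j = 1 then \<phi> else real_of_ereal \<circ> \<Phi> (j - 1))
       (c j) (real_of_ereal \<circ> \<Phi> j))"

definition Wstar_norm_glob ::
  "real \<Rightarrow> ('x::t2_space, 'k::finite) chart set \<Rightarrow>
   (('x, 'k) chart \<Rightarrow> complex^'k \<Rightarrow> complex^'k^'k) \<Rightarrow> nat \<Rightarrow> ('x \<Rightarrow> real) \<Rightarrow> real" where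
  "Wstar_norm_glob \<kappa> A \<omega> q \<phi> = L2_norm (kaehler_vol A \<omega>) \<phi> +
     Inf {\<Sum>j=1..q. c j powr (1 / 2 ^ j) | c \<Phi>. defining_seq_glob \<kappa> A \<omega> q \<phi> c \<Phi>}"

end

theory Submission imports Defs begin

text \<open>
  Both settings describe chains \<open>\<phi> = \<phi>\<^sub>0, \<phi>\<^sub>1, \<dots>, \<phi>\<^sub>q\<close>
  in which each step is an energy inequality \<open>d\<phi>\<^sub>j\<^sub>-\<^sub>1 \<and>
  d\<^sup>c\<phi>\<^sub>j\<^sub>-\<^sub>1 \<le> T\<^sub>j\<close>. The current \<open>T\<^sub>j\<close> depends
  linearly on \<open>\<phi>\<^sub>j\<close> and, in the global setting, on the constant
  \<open>c\<^sub>j\<close>. The cost \<open>c\<^sub>j\<close> of the step, which is the mass of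
  \<open>dd\<^sup>c\<phi>\<^sub>j\<close> or that constant, is subadditive and positively homogeneous. The
  left-hand side is quadratic. Hence multiplying \<open>\<phi>\<close> by \<open>t\<close> multiplies
  \<open>\<phi>\<^sub>j\<close> and \<open>c\<^sub>j\<close> by \<open>t\<close> to the power
  \<open>2\<^sup>j\<close>, and the exponents \<open>1/2\<^sup>j\<close> in the definition make the functional
  homogeneous. For sums, the inequality \<open>d(f+g) \<and> d\<^sup>c(f+g) \<le> 2 (df \<and> d\<^sup>cf + dg
  \<and> d\<^sup>cg)\<close> shows that chains \<open>h\<close> and \<open>k\<close> of \<open>f\<close> and
  \<open>g\<close> combine to the chain \<open>a\<^sub>j (h\<^sub>j + k\<^sub>j)\<close> of \<open>f +
  g\<close>, with \<open>a\<^sub>0 = 1\<close> and \<open>a\<^sub>j\<^sub>+\<^sub>1 = 2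
  a\<^sub>j\<^sup>2\<close>. These numbers are the powers of 2 with exponents \<open>2\<^sup>j - 1\<close>, so
  their roots of order \<open>2\<^sup>j\<close> stay below 2, and the quasi-triangle inequality holds with
  constant 2 for every \<open>q\<close>. Definiteness comes from the \<open>L\<^sup>2\<close> norm. This
  argument uses only a few properties of a single step; it is carried out in the locale
  \<open>energy_relation\<close>, of which the local and the global setting are instances
  (\<open>local_energy_relation\<close>, \<open>global_energy_relation\<close>).

  The analytic work lies in verifying these properties. Plurisubharmonic functions take the value
  \<open>-\<infinity>\<close>, while currents are formed from their real representatives. Passing from extended
  real to real functions is additive only off the poles (the points with value \<open>-\<infinity>\<close>), and
  pairing with test functions is additive only for locally integrable functions. So one needs that a
  plurisubharmonic function is finite almost everywhere and locally integrable
  (\<open>psh_integrable_near\<close>). The submean inequality on circles, integrated over all complex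
  directions, gives the submean inequality on balls, because multiplication by a unit complex number preserves
  Lebesgue measure. It follows that the points near which the function is integrable and the points near which
  it is identically \<open>-\<infinity>\<close> form two open sets, and no component can lie in the second. The
  negligibility of the poles also shows that sums and restrictions of plurisubharmonic functions are not
  identically \<open>-\<infinity>\<close> on a component (\<open>psh_on_add\<close>,
  \<open>psh_on_subset\<close>).

  On a manifold, sets that are null for the volume measure must be compared with Lebesgue null sets in charts.
  The density of the volume in a chart is positive, as the determinant of a positive definite Hermitian matrix
  is (\<open>Re_det_pos\<close>); and a Borel set that is null for each chart is null for the supremum of the
  chart measures (\<open>emeasure_SUP_eq_0\<close>).
\<close>

section \<open>Quasinorms from chains of energy inequalities\<close>

text \<open>
  A ratio in the unit interval does not decrease when raised to a power at most 1; the ratios of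
  \<open>x\<close> and of \<open>y\<close> to \<open>x + y\<close> add up to 1.
\<close>

lemma powr_add_le_add_powr:
  fixes x y p :: real
  assumes "0 \<le> x" "0 \<le> y" "0 < p" "p \<le> 1"
  shows "(x + y) powr p \<le> x powr p + y powr p"
proof (cases "x + y = 0")
  case True
  then show ?thesis using assms by simp
next
  case False
  define s where "s = x + y"
  have s: "0 < s" using False assms by (simp add: s_def)
  have frac: "r / s \<le> (r / s) powr p" if "0 \<le> r" "r \<le> s" for r
  proof (cases "r = 0")
    case False
    have "(r / s) powr 1 \<le> (r / s) powr p"
      using that s assms False by (intro powr_mono') (auto simp: field_simps)
    then show ?thesis using that s by simp
  qed simp
  have "s powr p = s powr p * (x / s + y / s)"
    using s by (simp add: s_def flip: add_divide_distrib)
  also have "\<dots> \<le> s powr p * ((x / s) powr p + (y / s) powr p)"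
    using assms by (intro mult_left_mono add_mono frac) (auto simp: s_def)
  also have "\<dots> = x powr p + y powr p"
    using s assms by (simp add: distrib_left powr_divide)
  finally show ?thesis by (simp add: s_def)
qed

text \<open>
  \<open>S f c h\<close> expresses one step of a chain: \<open>df \<and> d\<^sup>cf\<close> is bounded by a current of cost \<open>c\<close> with
  potential \<open>h\<close>. In \<open>S_add\<close> and \<open>S_scale\<close> the new potential is prescribed almost everywhere
  only, since potentials are real representatives of extended real functions and these are
  additive only off their poles. The cost is only bounded from above because the mass of a
  combination of potentials is defined by a supremum.
\<close>

locale energy_relation =
  fixes M :: "'a measure" and V :: "('a \<Rightarrow> real) set"
    and S :: "('a \<Rightarrow> real) \<Rightarrow> real \<Rightarrow> ('a \<Rightarrow> real) \<Rightarrow> bool"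
  assumes V_measurable: "f \<in> V \<Longrightarrow> f \<in> borel_measurable M"
    and V_square_integrable: "f \<in> V \<Longrightarrow> integrable M (\<lambda>x. (f x)\<^sup>2)"
    and V_zero: "(\<lambda>x. 0) \<in> V"
    and V_add: "f \<in> V \<Longrightarrow> g \<in> V \<Longrightarrow> (\<lambda>x. f x + g x) \<in> V"
    and V_scale: "f \<in> V \<Longrightarrow> (\<lambda>x. t * f x) \<in> V"
    and V_AE: "f \<in> V \<Longrightarrow> AE x in M. f x = g x \<Longrightarrow> g \<in> V"
    and S_nonneg: "S f c h \<Longrightarrow> 0 \<le> c"
    and S_zero: "S (\<lambda>x. 0) 0 (\<lambda>x. 0)"
    and S_add: "S f c h \<Longrightarrow> S g d k \<Longrightarrow>
      \<exists>e l. S (\<lambda>x. f x + g x) e l \<and> e \<le> 2 * (c + d) \<and> (AE x in M. l x = 2 * (h x + k x))"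
    and S_scale: "S f c h \<Longrightarrow>
      \<exists>e l. S (\<lambda>x. t * f x) e l \<and> e \<le> t\<^sup>2 * c \<and> (AE x in M. l x = t\<^sup>2 * h x)"
    and S_AE: "S f c h \<Longrightarrow> AE x in M. f x = g x \<Longrightarrow> S g c h"
begin

primrec W :: "nat \<Rightarrow> ('a \<Rightarrow> real) set" where
  "W 0 = UNIV"
| "W (Suc q) = {f \<in> V. \<exists>c h. S f c h \<and> h \<in> W q}"

text \<open>
  Counting \<open>f\<close> as the entry of index 0 gives all steps of the chain the same form.
\<close>

definition chain :: "nat \<Rightarrow> ('a \<Rightarrow> real) \<Rightarrow> (nat \<Rightarrow> real) \<Rightarrow> (nat \<Rightarrow> 'a \<Rightarrow> real) \<Rightarrow> bool" where
  "chain q f c h \<longleftrightarrow> h 0 = f \<and> (\<forall>j<q. S (h j) (c (Suc j)) (h (Suc j)))"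

definition cost :: "nat \<Rightarrow> (nat \<Rightarrow> real) \<Rightarrow> real" where
  "cost q c = (\<Sum>j=1..q. c j powr (1 / 2 ^ j))"

definition costs :: "nat \<Rightarrow> ('a \<Rightarrow> real) \<Rightarrow> real set" where
  "costs q f = {cost q c | c h. chain q f c h}"

definition N :: "nat \<Rightarrow> ('a \<Rightarrow> real) \<Rightarrow> real" where
  "N q f = L2_norm M f + Inf (costs q f)"

lemma W_AE: "f \<in> W q \<Longrightarrow> AE x in M. f x = g x \<Longrightarrow> g \<in> W q"
  by (cases q) (auto intro: V_AE S_AE)

lemma W_zero: "(\<lambda>x. 0) \<in> W q"
  by (induction q) (auto intro: V_zero S_zero)

lemma W_scale: "f \<in> W q \<Longrightarrow> (\<lambda>x. t * f x) \<in> W q"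
proof (induction q arbitrary: f t)
  case (Suc q)
  then obtain c h where ch: "S f c h" "h \<in> W q" "f \<in> V" by auto
  obtain e l where el: "S (\<lambda>x. t * f x) e l" "AE x in M. l x = t\<^sup>2 * h x"
    using S_scale[OF ch(1)] by blast
  have "l \<in> W q"
    by (rule W_AE[OF Suc.IH[OF ch(2), of "t\<^sup>2"]]) (use el in auto)
  with el ch show ?case by (auto intro: V_scale)
qed simp

lemma W_add: "f \<in> W q \<Longrightarrow> g \<in> W q \<Longrightarrow> (\<lambda>x. f x + g x) \<in> W q"
proof (induction q arbitrary: f g)
  case (Suc q)
  then obtain c h d k where ch: "S f c h" "h \<in> W q" "f \<in> V" "S g d k" "k \<in> W q" "g \<in> V"
    by auto
  obtain e l where el: "S (\<lambda>x. f x + g x) e l" "AE x in M. l x = 2 * (h x + k x)"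
    using S_add[OF ch(1,4)] by blast
  have "l \<in> W q"
    by (rule W_AE[OF W_scale[OF Suc.IH[OF ch(2,5)], of 2]]) (use el in auto)
  with el ch show ?case by (auto intro: V_add)
qed simp

text \<open>
  A potential lying in \<open>W q\<close> is itself the start of a chain of length \<open>q\<close>, which is prolonged at its
  beginning.
\<close>

lemma chain_exists: "f \<in> W q \<Longrightarrow> \<exists>c h. chain q f c h"
proof (induction q arbitrary: f)
  case 0
  then show ?case by (auto simp: chain_def intro: exI[of _ "\<lambda>_. f"])
next
  case (Suc q)
  then obtain d k where dk: "S f d k" "k \<in> W q" by auto
  obtain c h where ch: "chain q k c h" using Suc.IH[OF dk(2)] by blast
  define c' where "c' j = (case j of 0 \<Rightarrow> 0 | Suc 0 \<Rightarrow> d | Suc i \<Rightarrow> c i)" for j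
  define h' where "h' j = (case j of 0 \<Rightarrow> f | Suc i \<Rightarrow> h i)" for j
  have "S (h' j) (c' (Suc j)) (h' (Suc j))" if "j < Suc q" for j
    using that ch dk by (cases j) (auto simp: c'_def h'_def chain_def)
  then have "chain (Suc q) f c' h'" by (simp add: chain_def h'_def)
  then show ?case by blast
qed

lemma chain_AE:
  assumes "chain q f c h" "AE x in M. f x = g x"
  shows "chain q g c (h(0 := g))"
  unfolding chain_def
proof (intro conjI allI impI)
  fix j assume "j < q"
  with assms show "S ((h(0 := g)) j) (c (Suc j)) ((h(0 := g)) (Suc j))"
    by (cases j) (auto simp: chain_def intro: S_AE)
qed simp

lemma costs_AE:
  assumes "AE x in M. f x = g x"
  shows "costs q f = costs q g"
proof -
  have "AE x in M. g x = f x" using assms by auto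
  with assms show ?thesis unfolding costs_def by (blast intro: chain_AE)
qed

text \<open>
  Each step squares the factor, because the energy is quadratic.
\<close>

lemma chain_scale:
  assumes "chain q f c h"
  shows "\<exists>e l. chain q (\<lambda>x. t * f x) e l \<and> (\<forall>j\<in>{1..q}. e j \<le> t ^ 2 ^ j * c j)"
proof -
  have "\<exists>e l. chain n (\<lambda>x. t * f x) e l \<and> (\<forall>j\<in>{1..n}. e j \<le> t ^ 2 ^ j * c j) \<and>
          (AE x in M. l n x = t ^ 2 ^ n * h n x)" if "n \<le> q" for n
    using that
  proof (induction n)
    case 0
    show ?case using assms by (auto simp: chain_def intro!: exI[of _ "\<lambda>_ x. t * f x"])
  next
    case (Suc n)
    then obtain e l where el: "chain n (\<lambda>x. t * f x) e l" "\<forall>j\<in>{1..n}. e j \<le> t ^ 2 ^ j * c j"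
      "AE x in M. l n x = t ^ 2 ^ n * h n x" by auto
    have "S (h n) (c (Suc n)) (h (Suc n))" using assms Suc.prems by (simp add: chain_def)
    from S_scale[OF this, of "t ^ 2 ^ n"] obtain e' l' where el':
      "S (\<lambda>x. t ^ 2 ^ n * h n x) e' l'" "e' \<le> (t ^ 2 ^ n)\<^sup>2 * c (Suc n)"
      "AE x in M. l' x = (t ^ 2 ^ n)\<^sup>2 * h (Suc n) x" by blast
    have sq: "(t ^ 2 ^ n)\<^sup>2 = t ^ 2 ^ Suc n" by (simp add: power_mult mult.commute flip: power_mult)
    have "S (l n) e' l'" by (rule S_AE[OF el'(1)]) (use el(3) in auto)
    then have "chain (Suc n) (\<lambda>x. t * f x) (e(Suc n := e')) (l(Suc n := l'))"
      using el(1) by (auto simp: chain_def less_Suc_eq)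
    moreover have "\<forall>j\<in>{1..Suc n}. (e(Suc n := e')) j \<le> t ^ 2 ^ j * c j"
      using el(2) el'(2) unfolding sq by (auto simp: le_Suc_eq)
    moreover have "AE x in M. (l(Suc n := l')) (Suc n) x = t ^ 2 ^ Suc n * h (Suc n) x"
      using el'(3) unfolding sq by simp
    ultimately show ?case by blast
  qed
  from this[of q] show ?thesis by blast
qed

text \<open>
  The factors \<open>a\<^sub>j\<close>, powers of 2 with exponents \<open>2\<^sup>j - 1\<close>, are determined by \<open>a\<^sub>0 = 1\<close> and
  \<open>a\<^sub>j\<^sub>+\<^sub>1 = 2 a\<^sub>j\<^sup>2\<close>: the factor 2 comes from adding two functions, the square from the factor \<open>a\<^sub>j\<close>
  that the previous entry already carries.
\<close>

lemma chain_add: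
  assumes "chain q f c h" "chain q g d k"
  shows "\<exists>e l. chain q (\<lambda>x. f x + g x) e l \<and> (\<forall>j\<in>{1..q}. e j \<le> 2 ^ (2 ^ j - 1) * (c j + d j))"
proof -
  have "\<exists>e l. chain n (\<lambda>x. f x + g x) e l \<and>
          (\<forall>j\<in>{1..n}. e j \<le> 2 ^ (2 ^ j - 1) * (c j + d j)) \<and>
          (AE x in M. l n x = 2 ^ (2 ^ n - 1) * (h n x + k n x))" if "n \<le> q" for n
    using that
  proof (induction n)
    case 0
    show ?case using assms by (auto simp: chain_def intro!: exI[of _ "\<lambda>_ x. f x + g x"])
  next
    case (Suc n)
    define a where "a = (2::real) ^ (2 ^ n - 1)"
    from Suc obtain e l where el: "chain n (\<lambda>x. f x + g x) e l"
      "\<forall>j\<in>{1..n}. e j \<le> 2 ^ (2 ^ j - 1) * (c j + d j)"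
      "AE x in M. l n x = a * (h n x + k n x)" by (auto simp: a_def)
    have "S (h n) (c (Suc n)) (h (Suc n))" "S (k n) (d (Suc n)) (k (Suc n))"
      using assms Suc.prems by (simp_all add: chain_def)
    from S_add[OF this] obtain e1 l1 where el1: "S (\<lambda>x. h n x + k n x) e1 l1"
      "e1 \<le> 2 * (c (Suc n) + d (Suc n))" "AE x in M. l1 x = 2 * (h (Suc n) x + k (Suc n) x)"
      by blast
    from S_scale[OF el1(1), of a] obtain e' l' where el':
      "S (\<lambda>x. a * (h n x + k n x)) e' l'" "e' \<le> a\<^sup>2 * e1" "AE x in M. l' x = a\<^sup>2 * l1 x" by blast
    \<comment> \<open>the recursion \<open>a\<^sub>n\<^sub>+\<^sub>1 = 2 a\<^sub>n\<^sup>2\<close>, read off from the exponents\<close>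
    have "(2::nat) ^ Suc n - 1 = 2 * (2 ^ n - 1) + 1"
      using one_le_power[of "2::nat" n] by (cases "(2::nat) ^ n") auto
    then have sq: "2 ^ (2 ^ Suc n - 1) = a\<^sup>2 * 2"
      by (simp add: a_def power_mult mult.commute flip: power_mult)
    have "S (l n) e' l'" by (rule S_AE[OF el'(1)]) (use el(3) in auto)
    then have "chain (Suc n) (\<lambda>x. f x + g x) (e(Suc n := e')) (l(Suc n := l'))"
      using el(1) by (auto simp: chain_def less_Suc_eq)
    moreover have "e' \<le> 2 ^ (2 ^ Suc n - 1) * (c (Suc n) + d (Suc n))"
      using el'(2) mult_left_mono[OF el1(2), of "a\<^sup>2"] unfolding sq by (simp add: algebra_simps)
    moreover have "AE x in M. l' x = 2 ^ (2 ^ Suc n - 1) * (h (Suc n) x + k (Suc n) x)"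
      using el'(3) el1(3) unfolding sq by eventually_elim simp
    moreover from calculation(2) el(2) have
      "\<forall>j\<in>{1..Suc n}. (e(Suc n := e')) j \<le> 2 ^ (2 ^ j - 1) * (c j + d j)"
      by (auto simp: le_Suc_eq)
    moreover from calculation(3) have
      "AE x in M. (l(Suc n := l')) (Suc n) x = 2 ^ (2 ^ Suc n - 1) * (h (Suc n) x + k (Suc n) x)"
      by simp
    ultimately show ?case by blast
  qed
  from this[of q] show ?thesis by blast
qed

lemma chain_nonneg: "chain q f c h \<Longrightarrow> j \<in> {1..q} \<Longrightarrow> 0 \<le> c j"
  using S_nonneg[of "h (j - 1)" "c j" "h j"] by (cases j) (auto simp: chain_def)

lemma cost_nonneg: "0 \<le> cost q c"
  unfolding cost_def by (intro sum_nonneg) simp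

lemma bdd_below_costs: "bdd_below (costs q f)"
  by (rule bdd_belowI[of _ 0]) (auto simp: costs_def cost_nonneg)

lemma Inf_costs_nonneg: "f \<in> W q \<Longrightarrow> 0 \<le> Inf (costs q f)"
  using chain_exists[of f q] by (intro cInf_greatest) (auto simp: costs_def cost_nonneg)

lemma L2_norm_nonneg: "0 \<le> L2_norm M f"
  by (simp add: L2_norm_def)

lemma N_nonneg: "f \<in> W q \<Longrightarrow> 0 \<le> N q f"
  using Inf_costs_nonneg L2_norm_nonneg by (simp add: N_def add_nonneg_nonneg)

lemma W_subset: "W (Suc q) \<subseteq> V" by auto

lemma N_AE:
  assumes "f \<in> V" "AE x in M. f x = g x"
  shows "N q f = N q g"
proof -
  have "(LINT x|M. (f x)\<^sup>2) = (LINT x|M. (g x)\<^sup>2)"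
  proof (rule integral_cong_AE)
    show "(\<lambda>x. (f x)\<^sup>2) \<in> borel_measurable M" "(\<lambda>x. (g x)\<^sup>2) \<in> borel_measurable M"
      using V_measurable[OF assms(1)] V_measurable[OF V_AE[OF assms]] by measurable
    show "AE x in M. (f x)\<^sup>2 = (g x)\<^sup>2" using assms(2) by auto
  qed
  then show ?thesis by (simp add: N_def costs_AE[OF assms(2)] L2_norm_def)
qed

lemma N_zero: "N q (\<lambda>x. 0) = 0"
proof -
  have "chain q (\<lambda>x. 0) (\<lambda>_. 0) (\<lambda>_ _. 0)" by (simp add: chain_def S_zero)
  then have "cost q (\<lambda>_. 0) \<in> costs q (\<lambda>x. 0)" unfolding costs_def by blast
  then have "0 \<in> costs q (\<lambda>x. 0)" by (simp add: cost_def)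
  from cInf_lower[OF this bdd_below_costs] have "Inf (costs q (\<lambda>x. 0)) \<le> 0" .
  with Inf_costs_nonneg[OF W_zero, of q] show ?thesis by (simp add: N_def L2_norm_def)
qed

lemma AE_zero_if_N_zero:
  assumes "f \<in> W (Suc q)" "N (Suc q) f = 0"
  shows "AE x in M. f x = 0"
proof -
  have f: "f \<in> V" using assms W_subset by blast
  have "L2_norm M f = 0"
    using assms(2) Inf_costs_nonneg[OF assms(1)] L2_norm_nonneg[of f] by (simp add: N_def)
  then have "AE x in M. (f x)\<^sup>2 = 0"
    using V_square_integrable[OF f] by (simp add: L2_norm_def integral_nonneg_eq_0_iff_AE)
  then show ?thesis by auto
qed

lemma N_scale_le:
  assumes "f \<in> W (Suc q)"
  shows "N (Suc q) (\<lambda>x. t * f x) \<le> \<bar>t\<bar> * N (Suc q) f"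
proof -
  have L2: "L2_norm M (\<lambda>x. t * f x) = \<bar>t\<bar> * L2_norm M f"
    by (simp add: L2_norm_def power_mult_distrib real_sqrt_mult)
  have le: "Inf (costs (Suc q) (\<lambda>x. t * f x)) \<le> \<bar>t\<bar> * s" if "s \<in> costs (Suc q) f" for s
  proof -
    from that obtain c h where ch: "s = cost (Suc q) c" "chain (Suc q) f c h"
      unfolding costs_def by blast
    from chain_scale[OF ch(2), of t] obtain e l where
      el: "chain (Suc q) (\<lambda>x. t * f x) e l" "\<forall>j\<in>{1..Suc q}. e j \<le> t ^ 2 ^ j * c j" by blast
    have "cost (Suc q) e \<le> (\<Sum>j=1..Suc q. \<bar>t\<bar> * c j powr (1 / 2 ^ j))"
      unfolding cost_def
    proof (rule sum_mono)
      fix j assume j: "j \<in> {1..Suc q}"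
      have ev: "even ((2::nat) ^ j)" using j by simp
      have "e j powr (1 / 2 ^ j) \<le> (t ^ 2 ^ j * c j) powr (1 / 2 ^ j)"
        using el(2) j chain_nonneg[OF el(1) j] by (intro powr_mono2) auto
      also have "\<dots> = (\<bar>t\<bar> ^ 2 ^ j) powr (1 / 2 ^ j) * c j powr (1 / 2 ^ j)"
        using ev chain_nonneg[OF ch(2) j] by (simp add: powr_mult power_even_abs)
      also have "(\<bar>t\<bar> ^ 2 ^ j) powr (1 / 2 ^ j) = \<bar>t\<bar>"
      proof (cases "t = 0")
        case False
        then have "(\<bar>t\<bar> ^ 2 ^ j) = \<bar>t\<bar> powr (2 ^ j)" by (simp add: powr_realpow[symmetric])
        then show ?thesis using False by (simp add: powr_powr)
      qed simp
      finally show "e j powr (1 / 2 ^ j) \<le> \<bar>t\<bar> * c j powr (1 / 2 ^ j)" .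
    qed
    also have "\<dots> = \<bar>t\<bar> * s" by (simp add: ch(1) cost_def sum_distrib_left del: sum.cl_ivl_Suc)
    finally have "cost (Suc q) e \<le> \<bar>t\<bar> * s" .
    moreover have "Inf (costs (Suc q) (\<lambda>x. t * f x)) \<le> cost (Suc q) e"
      by (rule cInf_lower[OF _ bdd_below_costs]) (use el in \<open>auto simp: costs_def\<close>)
    ultimately show ?thesis by linarith
  qed
  have ne: "costs (Suc q) f \<noteq> {}" using chain_exists[OF assms] by (auto simp: costs_def)
  have "Inf (costs (Suc q) (\<lambda>x. t * f x)) \<le> \<bar>t\<bar> * Inf (costs (Suc q) f)"
  proof (cases "t = 0")
    case True
    obtain s where "s \<in> costs (Suc q) f" using ne by blast
    from le[OF this] True show ?thesis by simp
  next
    case False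
    then have "Inf (costs (Suc q) (\<lambda>x. t * f x)) / \<bar>t\<bar> \<le> Inf (costs (Suc q) f)"
      using le ne by (intro cInf_greatest) (auto simp: field_simps)
    then show ?thesis using False by (simp add: field_simps)
  qed
  then show ?thesis by (simp add: N_def L2 distrib_left)
qed

text \<open>
  The inequality for \<open>t\<close> is an equality, since it also holds for the inverse of \<open>t\<close>.
\<close>

lemma N_scale:
  assumes "f \<in> W (Suc q)"
  shows "N (Suc q) (\<lambda>x. t * f x) = \<bar>t\<bar> * N (Suc q) f"
proof (cases "t = 0")
  case True
  then show ?thesis by (simp add: N_zero)
next
  case False
  have "N (Suc q) (\<lambda>x. inverse t * (t * f x)) \<le> \<bar>inverse t\<bar> * N (Suc q) (\<lambda>x. t * f x)"
    by (rule N_scale_le[OF W_scale[OF assms]])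
  then have "N (Suc q) f \<le> \<bar>inverse t\<bar> * N (Suc q) (\<lambda>x. t * f x)"
    using False by (simp flip: mult.assoc)
  then show ?thesis using N_scale_le[OF assms, of t] False by (simp add: field_simps)
qed

lemma L2_norm_add_le:
  assumes "f \<in> V" "g \<in> V"
  shows "L2_norm M (\<lambda>x. f x + g x) \<le> 2 * (L2_norm M f + L2_norm M g)"
proof -
  let ?I = "\<lambda>f. LINT x|M. (f x)\<^sup>2"
  note int = V_square_integrable[OF assms(1)] V_square_integrable[OF assms(2)]
    V_square_integrable[OF V_add[OF assms]]
  have "(f x + g x)\<^sup>2 \<le> 2 * (f x)\<^sup>2 + 2 * (g x)\<^sup>2" for x
    using sum_squares_bound[of "f x" "g x"] by (simp add: power2_sum)
  then have "?I (\<lambda>x. f x + g x) \<le> (LINT x|M. 2 * (f x)\<^sup>2 + 2 * (g x)\<^sup>2)"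
    using int by (intro integral_mono) auto
  also have "\<dots> = 2 * ?I f + 2 * ?I g" using int by simp
  finally have "L2_norm M (\<lambda>x. f x + g x) \<le> sqrt (2 * ?I f + 2 * ?I g)"
    by (simp add: L2_norm_def)
  also have "\<dots> \<le> sqrt (2 * ?I f) + sqrt (2 * ?I g)"
    by (rule sqrt_add_le_add_sqrt) auto
  also have "\<dots> = sqrt 2 * (L2_norm M f + L2_norm M g)"
    by (simp add: L2_norm_def real_sqrt_mult distrib_left)
  also have "\<dots> \<le> 2 * (L2_norm M f + L2_norm M g)"
    using sqrt2_less_2 by (intro mult_right_mono add_nonneg_nonneg L2_norm_nonneg) auto
  finally show ?thesis .
qed

lemma N_add_le:
  assumes "f \<in> W (Suc q)" "g \<in> W (Suc q)"
  shows "N (Suc q) (\<lambda>x. f x + g x) \<le> 2 * (N (Suc q) f + N (Suc q) g)"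
proof -
  let ?q = "Suc q"
  let ?I = "Inf (costs ?q (\<lambda>x. f x + g x))"
  have le: "?I \<le> 2 * (r + s)" if "r \<in> costs ?q f" "s \<in> costs ?q g" for r s
  proof -
    from that obtain c h d k where ch: "r = cost ?q c" "chain ?q f c h"
      "s = cost ?q d" "chain ?q g d k" unfolding costs_def by blast
    from chain_add[OF ch(2,4)] obtain e l where el: "chain ?q (\<lambda>x. f x + g x) e l"
      "\<forall>j\<in>{1..?q}. e j \<le> 2 ^ (2 ^ j - 1) * (c j + d j)" by blast
    have "cost ?q e \<le> (\<Sum>j=1..?q. 2 * (c j powr (1 / 2 ^ j) + d j powr (1 / 2 ^ j)))"
      unfolding cost_def
    proof (rule sum_mono)
      fix j assume j: "j \<in> {1..?q}"
      note nn = chain_nonneg[OF el(1) j] chain_nonneg[OF ch(2) j] chain_nonneg[OF ch(4) j]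
      \<comment> \<open>replacing the exponent \<open>2\<^sup>j - 1\<close> by \<open>2\<^sup>j\<close> makes the root exactly 2\<close>
      have "e j \<le> 2 ^ (2 ^ j - 1) * (c j + d j)" using el(2) j by blast
      also have "\<dots> \<le> 2 ^ 2 ^ j * (c j + d j)"
        using nn by (intro mult_right_mono power_increasing) auto
      finally have "e j powr (1 / 2 ^ j) \<le> (2 ^ 2 ^ j * (c j + d j)) powr (1 / 2 ^ j)"
        using nn by (intro powr_mono2) auto
      also have "\<dots> = (2 ^ 2 ^ j) powr (1 / 2 ^ j) * (c j + d j) powr (1 / 2 ^ j)"
        using nn by (simp add: powr_mult)
      also have "(2 ^ 2 ^ j) powr (1 / 2 ^ j) = (2::real)"
      proof -
        have "((2::real) ^ 2 ^ j) = 2 powr (2 ^ j)" by (simp add: powr_realpow[symmetric])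
        then show ?thesis by (simp add: powr_powr)
      qed
      also have "2 * (c j + d j) powr (1 / 2 ^ j) \<le> 2 * (c j powr (1 / 2 ^ j) + d j powr (1 / 2 ^ j))"
        using nn by (intro mult_left_mono powr_add_le_add_powr) auto
      finally show "e j powr (1 / 2 ^ j) \<le> 2 * (c j powr (1 / 2 ^ j) + d j powr (1 / 2 ^ j))" .
    qed
    also have "\<dots> = 2 * (r + s)" by (simp add: ch cost_def sum_distrib_left sum.distrib del: sum.cl_ivl_Suc)
    finally have "cost ?q e \<le> 2 * (r + s)" .
    moreover have "?I \<le> cost ?q e"
      by (rule cInf_lower[OF _ bdd_below_costs]) (use el in \<open>auto simp: costs_def\<close>)
    ultimately show ?thesis by linarith
  qed
  have ne: "costs ?q f \<noteq> {}" "costs ?q g \<noteq> {}"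
    using chain_exists[OF assms(1)] chain_exists[OF assms(2)] by (auto simp: costs_def)
  have "?I / 2 - s \<le> Inf (costs ?q f)" if "s \<in> costs ?q g" for s
    using le[OF _ that] ne by (intro cInf_greatest) (auto simp: field_simps)
  then have "?I / 2 - Inf (costs ?q f) \<le> Inf (costs ?q g)"
    using ne by (intro cInf_greatest) (auto simp: field_simps)
  then have "?I \<le> 2 * (Inf (costs ?q f) + Inf (costs ?q g))" by simp
  then show ?thesis using L2_norm_add_le[of f g] assms W_subset[of q] by (auto simp: N_def)
qed

theorem quasinorm:
  assumes "q \<ge> 1"
  shows "quasinorm_mod_ae M (W q) (N q)"
proof -
  obtain p where q: "q = Suc p" using assms by (cases q) auto
  have zero: "N q f = 0 \<longleftrightarrow> (AE x in M. f x = 0)" if f: "f \<in> W q" for f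
  proof
    assume "AE x in M. f x = 0"
    with f show "N q f = 0" using N_AE[of f "\<lambda>x. 0" q] N_zero[of q] W_subset[of p]
      by (auto simp: q)
  qed (use f AE_zero_if_N_zero in \<open>auto simp: q\<close>)
  have V: "f \<in> V" if "f \<in> W q" for f using that W_subset by (auto simp: q)
  show ?thesis
    unfolding quasinorm_mod_ae_def
  proof (intro conjI allI ballI impI)
    show "W q \<subseteq> borel_measurable M" using V V_measurable by blast
    show "\<exists>C\<ge>1. \<forall>f\<in>W q. \<forall>g\<in>W q. N q (\<lambda>x. f x + g x) \<le> C * (N q f + N q g)"
      using N_add_le unfolding q by (intro exI[of _ 2]) auto
    show "N q (\<lambda>x. t * f x) = \<bar>t\<bar> * N q f" if "f \<in> W q" for f t
      using N_scale that unfolding q by blast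
    show "N q g = N q f" if "f \<in> W q" "AE x in M. f x = g x" for f g
      using N_AE[OF V[OF that(1)] that(2)] by simp
    show "g \<in> W q" if "f \<in> W q" "AE x in M. f x = g x" for f g
      by (rule W_AE[OF that])
    show "(\<lambda>x. f x + g x) \<in> W q" if "f \<in> W q" "g \<in> W q" for f g by (rule W_add[OF that])
    show "(\<lambda>x. t * f x) \<in> W q" if "f \<in> W q" for f t by (rule W_scale[OF that])
  qed (use W_zero zero N_nonneg in auto)
qed

end

section \<open>Rotation invariance of Lebesgue measure\<close>

lemma nn_integral_lborel_translate:
  fixes w :: "'a::euclidean_space \<Rightarrow> ennreal"
  assumes [measurable]: "w \<in> borel_measurable borel"
  shows "(\<integral>\<^sup>+x. w (x + c) \<partial>lborel) = (\<integral>\<^sup>+x. w x \<partial>lborel)"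
proof -
  have "(\<integral>\<^sup>+x. w x \<partial>lborel) = (\<integral>\<^sup>+x. w x \<partial>distr lborel borel ((+) c))"
    by (simp add: lborel_distr_plus)
  also have "\<dots> = (\<integral>\<^sup>+x. w (c + x) \<partial>lborel)" by (simp add: nn_integral_distr)
  finally show ?thesis by (simp add: add.commute)
qed

lemma emeasure_lborel_ball:
  fixes z :: "'a::euclidean_space"
  shows "emeasure lborel (ball z r) = emeasure lborel (ball (0 :: 'a) r)"
proof -
  have eq: "indicator (ball z r) (x + z) = (indicator (ball 0 r) x :: ennreal)" for x
    by (simp add: indicator_def dist_norm)
  have "emeasure lborel (ball z r) = (\<integral>\<^sup>+x. indicator (ball z r) x \<partial>lborel)" by simp
  also have "\<dots> = (\<integral>\<^sup>+x. indicator (ball z r) (x + z) \<partial>lborel)"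
    by (intro nn_integral_lborel_translate[symmetric] borel_measurable_indicator) simp
  also have "\<dots> = emeasure lborel (ball (0 :: 'a) r)" by (simp add: eq)
  finally show ?thesis .
qed

text \<open>
  This is the uniqueness argument for Haar measure. Let \<open>D\<close> be the indicator of the unit ball.
  Tonelli and two translations turn the product of the integrals of \<open>w \<circ> L\<close> and of \<open>D\<close> into the product
  of the integral of \<open>w\<close> with the volume of a ball, as an isometry maps balls to balls.
\<close>

lemma nn_integral_lborel_linear_isometry:
  fixes w :: "'a::euclidean_space \<Rightarrow> ennreal" and L :: "'a \<Rightarrow> 'a"
  assumes w[measurable]: "w \<in> borel_measurable borel"
    and L: "linear L" "\<And>x. norm (L x) = norm x"
  shows "(\<integral>\<^sup>+x. w (L x) \<partial>lborel) = (\<integral>\<^sup>+x. w x \<partial>lborel)"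
proof -
  define D where "D = (indicator (ball 0 1) :: 'a \<Rightarrow> ennreal)"
  have [measurable]: "D \<in> borel_measurable borel"
    unfolding D_def by (intro borel_measurable_indicator) simp
  have [measurable]: "L \<in> borel_measurable borel"
    using L(1) by (intro borel_measurable_continuous_onI linear_continuous_on) (simp add: linear_conv_bounded_linear)
  have surj: "surj L"
    using L by (intro orthogonal_transformation_surj) (simp add: orthogonal_transformation)
  let ?d = "emeasure lborel (ball 0 1 :: 'a set)"
  have ball: "emeasure lborel (ball z 1) = ?d" for z :: 'a
    by (rule emeasure_lborel_ball)
  have D: "(\<integral>\<^sup>+x. D x \<partial>lborel) = ?d" by (simp add: D_def)
  have D': "(\<integral>\<^sup>+x. D (y - L x) \<partial>lborel) = ?d" for y
  proof -
    obtain z where z: "y = L z" using surj by (rule surjE)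
    have "norm (L z - L x) = norm (z - x)" for x
      using L(2)[of "z - x"] by (simp only: linear_diff[OF L(1)])
    moreover have "D v = of_bool (norm v < 1)" for v by (simp add: D_def indicator_def)
    ultimately have "D (y - L x) = indicator (ball z 1) x" for x
      by (simp only: z indicator_def mem_ball dist_norm)
    then show ?thesis using ball[of z] by simp
  qed
  have "(\<integral>\<^sup>+x. w (L x) \<partial>lborel) * ?d = (\<integral>\<^sup>+y. (\<integral>\<^sup>+x. w (L x) * D y \<partial>lborel) \<partial>lborel)"
    by (simp add: nn_integral_cmult nn_integral_multc D)
  also have "\<dots> = (\<integral>\<^sup>+y. (\<integral>\<^sup>+x. w (L x + y) * D y \<partial>lborel) \<partial>lborel)"
  proof (rule nn_integral_cong)
    fix y
    obtain z where "y = L z" using surj by (rule surjE)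
    then show "(\<integral>\<^sup>+x. w (L x) * D y \<partial>lborel) = (\<integral>\<^sup>+x. w (L x + y) * D y \<partial>lborel)"
      using nn_integral_lborel_translate[of "\<lambda>x. w (L x) * D y" z]
      by (simp add: linear_add[OF L(1)])
  qed
  also have "\<dots> = (\<integral>\<^sup>+x. (\<integral>\<^sup>+y. w (L x + y) * D y \<partial>lborel) \<partial>lborel)"
    by (rule lborel_pair.Fubini') measurable
  also have "\<dots> = (\<integral>\<^sup>+x. (\<integral>\<^sup>+y. w y * D (y - L x) \<partial>lborel) \<partial>lborel)"
  proof (rule nn_integral_cong)
    fix x
    show "(\<integral>\<^sup>+y. w (L x + y) * D y \<partial>lborel) = (\<integral>\<^sup>+y. w y * D (y - L x) \<partial>lborel)"
      using nn_integral_lborel_translate[of "\<lambda>y. w y * D (y - L x)" "L x"]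
      by (simp add: add.commute)
  qed
  also have "\<dots> = (\<integral>\<^sup>+y. (\<integral>\<^sup>+x. w y * D (y - L x) \<partial>lborel) \<partial>lborel)"
    by (rule lborel_pair.Fubini') measurable
  also have "\<dots> = (\<integral>\<^sup>+y. w y \<partial>lborel) * ?d"
    by (simp add: nn_integral_cmult nn_integral_multc D')
  finally have eq: "(\<integral>\<^sup>+x. w (L x) \<partial>lborel) * ?d = (\<integral>\<^sup>+y. w y \<partial>lborel) * ?d" .
  have "?d \<noteq> 0"
  proof
    assume "?d = 0"
    then have "ball 0 1 \<in> null_sets (lborel :: 'a measure)" by (simp add: null_sets_def)
    then have "negligible (ball 0 1 :: 'a set)"
      unfolding negligible_iff_null_sets by (rule null_sets_completionI)
    then show False using open_not_negligible[of "ball 0 1 :: 'a set"] by simp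
  qed
  moreover have "?d \<noteq> top"
    using emeasure_bounded_finite[of "ball 0 1 :: 'a set"] by simp
  moreover have "?d * (\<integral>\<^sup>+x. w (L x) \<partial>lborel) = ?d * (\<integral>\<^sup>+y. w y \<partial>lborel)"
    using eq by (simp only: mult.commute)
  ultimately show ?thesis by (simp only: ennreal_mult_cancel_left) simp
qed

lemma norm_vector_scalar_mult: "norm (c *s (a :: complex^'k::finite)) = norm c * norm a"
  by (simp add: norm_vec_def L2_set_right_distrib norm_mult)

lemma linear_vector_scalar_mult: "linear (\<lambda>a :: complex^'k::finite. c *s a)"
  by (intro linearI) (auto simp: vec_eq_iff algebra_simps)

section \<open>Submean inequalities and local integrability of plurisubharmonic functions\<close>

text \<open>
  The nonnegative function \<open>B - f\<close> replaces the positive and negative parts of \<open>f\<close>: its integral is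
  additive, monotone and subject to Tonelli even if it is infinite.
\<close>

lemma ereal_integral_bounded_above:
  assumes [measurable]: "f \<in> borel_measurable N" and fin: "finite_measure N" and "0 \<le> B"
    and B: "\<And>x. x \<in> space N \<Longrightarrow> f x \<le> ereal B"
  shows "ereal_integral N f =
    ereal (B * measure N (space N)) - enn2ereal (\<integral>\<^sup>+x. e2ennreal (ereal B - f x) \<partial>N)"
proof -
  interpret finite_measure N by (rule fin)
  define P where "P = (\<integral>\<^sup>+x. e2ennreal (f x) \<partial>N)"
  define Q where "Q = (\<integral>\<^sup>+x. e2ennreal (- f x) \<partial>N)"
  define J where "J = (\<integral>\<^sup>+x. e2ennreal (ereal B - f x) \<partial>N)"
  define m where "m = measure N (space N)"
  \<comment> \<open>all four terms are nonnegative, so this identity can be integrated before knowing finiteness\<close>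
  have "e2ennreal (ereal B - f x) + e2ennreal (f x) = ennreal B + e2ennreal (- f x)"
    if "x \<in> space N" for x
  proof (cases "f x")
    case (real r)
    then show ?thesis using B[OF that] \<open>0 \<le> B\<close>
      by (cases "0 \<le> r") (auto simp: ennreal_neg simp flip: ennreal_plus)
  qed (use B[OF that] in \<open>auto simp: e2ennreal_neg\<close>)
  then have "(\<integral>\<^sup>+x. e2ennreal (ereal B - f x) + e2ennreal (f x) \<partial>N) =
      (\<integral>\<^sup>+x. ennreal B + e2ennreal (- f x) \<partial>N)"
    by (intro nn_integral_cong) simp
  then have eq: "J + P = ennreal (B * m) + Q"
    using \<open>0 \<le> B\<close>
    by (simp add: nn_integral_add J_def P_def Q_def m_def emeasure_eq_measure ennreal_mult)
  have "P \<le> (\<integral>\<^sup>+x. ennreal B \<partial>N)"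
    unfolding P_def
  proof (intro nn_integral_mono)
    fix x assume "x \<in> space N"
    from e2ennreal_mono[OF B[OF this]] show "e2ennreal (f x) \<le> ennreal B" by simp
  qed
  also have "\<dots> = ennreal (B * m)"
    using \<open>0 \<le> B\<close> by (simp add: m_def emeasure_eq_measure ennreal_mult)
  finally have "P < \<infinity>" by (metis ennreal_less_top infinity_ennreal_def le_less_trans)
  then obtain p where p: "P = ennreal p" "0 \<le> p" by (cases P) auto
  have m: "0 \<le> B * m" using \<open>0 \<le> B\<close> by (simp add: m_def)
  have "enn2ereal P - enn2ereal Q = ereal (B * m) - enn2ereal J"
  proof (cases J)
    case (real j)
    from eq[symmetric] real p have "ennreal (B * m) + Q = ennreal (j + p)" by simp
    then have "Q \<noteq> top" by auto
    then obtain s where s: "Q = ennreal s" "0 \<le> s" by (cases Q) auto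
    have "B * m + s = j + p"
      using eq real p s m by (simp flip: ennreal_plus)
    then show ?thesis using real p s by (simp add: enn2ereal_ennreal)
  next
    case top
    with eq have "Q = \<infinity>" by (metis ennreal_add_eq_top ennreal_neq_top infinity_ennreal_def top_add)
    with top p show ?thesis by (simp add: enn2ereal_ennreal)
  qed
  then show ?thesis by (simp add: ereal_integral_def P_def Q_def J_def m_def)
qed

lemma ereal_mean_le_iff:
  assumes [measurable]: "f \<in> borel_measurable N" and fin: "finite_measure N" and "0 \<le> B"
    and B: "\<And>x. x \<in> space N \<Longrightarrow> f x \<le> ereal B" and y: "y \<le> ereal B"
    and m: "measure N (space N) = m" "0 < m"
  shows "y \<le> ereal_integral N f / ereal m \<longleftrightarrow>
    (\<integral>\<^sup>+x. e2ennreal (ereal B - f x) \<partial>N) \<le> ennreal m * e2ennreal (ereal B - y)"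
proof -
  define J where "J = (\<integral>\<^sup>+x. e2ennreal (ereal B - f x) \<partial>N)"
  have eq: "ereal_integral N f = ereal (B * m) - enn2ereal J"
    using ereal_integral_bounded_above[OF assms(1-4)] by (simp add: J_def m)
  have "y \<le> (ereal (B * m) - enn2ereal J) / ereal m \<longleftrightarrow> J \<le> ennreal m * e2ennreal (ereal B - y)"
  proof (cases J)
    case (real j)
    show ?thesis
    proof (cases y)
      case (real r)
      then have "r \<le> B" using y by simp
      then have "ennreal m * e2ennreal (ereal B - y) = ennreal (m * (B - r))"
        using real m by (simp add: ennreal_mult)
      moreover have "J \<le> ennreal (m * (B - r)) \<longleftrightarrow> j \<le> m * (B - r)"
        using \<open>J = ennreal j\<close> \<open>0 \<le> j\<close> \<open>r \<le> B\<close> m by (simp add: ennreal_le_iff)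
      ultimately show ?thesis
        using \<open>J = ennreal j\<close> \<open>0 \<le> j\<close> m real by (simp add: enn2ereal_ennreal field_simps)
    qed (use y m in \<open>auto simp: ennreal_mult_top\<close>)
  next
    case top
    have "(ereal (B * m) - enn2ereal J) / ereal m = - \<infinity>" using top m by simp
    then show ?thesis using top y m
      by (cases y) (auto simp: ennreal_mult_top ennreal_mult[symmetric] top_unique)
  qed
  then show ?thesis by (simp add: eq J_def)
qed

lemma psh_open_sublevel: "psh_on U u \<Longrightarrow> open {x\<in>U. u x < r}"
  and psh_less_top: "psh_on U u \<Longrightarrow> x \<in> U \<Longrightarrow> u x < \<infinity>"
  by (simp_all add: psh_on_def)

lemma psh_open: 
  assumes "psh_on U u"
  shows "open U"
proof -
  have "{x\<in>U. u x < \<infinity>} = U" using assms by (auto simp: psh_on_def)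
  then show ?thesis using psh_open_sublevel[OF assms, of \<infinity>] by simp
qed

lemma usc_measurable:
  fixes u :: "'a::euclidean_space \<Rightarrow> ereal"
  assumes "open U" "\<And>r. open {x\<in>U. u x < r}"
  shows "(\<lambda>x. if x \<in> U then u x else - \<infinity>) \<in> borel_measurable borel"
proof (rule borel_measurableI_less)
  fix r
  have "{x \<in> space borel. (if x \<in> U then u x else - \<infinity>) < r} =
    {x\<in>U. u x < r} \<union> (if - \<infinity> < r then - U else {})" by auto
  also have "\<dots> \<in> sets borel" using assms by (intro sets.Un) (auto intro: borel_open)
  finally show "{x \<in> space borel. (if x \<in> U then u x else - \<infinity>) < r} \<in> sets borel" .
qed

lemma psh_measurable:
  "psh_on U u \<Longrightarrow> (\<lambda>x. if x \<in> U then u x else - \<infinity>) \<in> borel_measurable borel"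
  by (intro usc_measurable psh_open psh_open_sublevel)

lemma usc_bounded_above_on_compact:
  fixes u :: "'a::euclidean_space \<Rightarrow> ereal"
  assumes "\<And>r. open {x\<in>U. u x < r}" "\<And>x. x \<in> U \<Longrightarrow> u x < \<infinity>" "compact K" "K \<subseteq> U"
  shows "\<exists>B\<ge>0. \<forall>x\<in>K. u x \<le> ereal B"
proof -
  have cov: "K \<subseteq> (\<Union>n::nat. {x\<in>U. u x < ereal (real n)})"
  proof
    fix x assume "x \<in> K"
    then have "x \<in> U" using assms by auto
    moreover obtain n :: nat where "u x < ereal (real n)"
      using less_PInf_Ex_of_nat assms(2)[OF \<open>x \<in> U\<close>] by auto
    ultimately show "x \<in> (\<Union>n::nat. {x\<in>U. u x < ereal (real n)})" by auto
  qed
  obtain I :: "nat set" where I: "finite I" "K \<subseteq> (\<Union>n\<in>I. {x\<in>U. u x < ereal (real n)})"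
    by (rule compactE_image[OF assms(3) _ cov]) (use assms(1) in auto)
  have "u x \<le> ereal (real (Max (insert 0 I)))" if x: "x \<in> K" for x
  proof -
    obtain n where n: "n \<in> I" "u x < ereal (real n)" using I x by blast
    then have "n \<le> Max (insert 0 I)" using I by simp
    then have "ereal (real n) \<le> ereal (real (Max (insert 0 I)))" by simp
    with n(2) show ?thesis by (meson less_le_trans less_imp_le)
  qed
  then show ?thesis by (intro exI[of _ "real (Max (insert 0 I))"]) auto
qed

lemma psh_bounded_above_on_compact:
  assumes u: "psh_on U u" and K: "compact K" "K \<subseteq> U"
  shows "\<exists>B\<ge>0. \<forall>x\<in>K. u x \<le> ereal B"
  using usc_bounded_above_on_compact[of U u K, OF psh_open_sublevel[OF u] psh_less_top[OF u] K] .

lemma compact_complex_disc: "compact {p + \<zeta> *s a | \<zeta>. norm \<zeta> \<le> 1}"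
  for p a :: "complex^'k::finite"
proof -
  have "{p + \<zeta> *s a | \<zeta>. norm \<zeta> \<le> 1} = (\<lambda>\<zeta>. p + \<zeta> *s a) ` cball 0 1"
    by (auto simp: image_def)
  moreover have "continuous_on (cball 0 1) (\<lambda>\<zeta>::complex. p + \<zeta> *s a)"
    unfolding vector_scalar_mult_def by (intro continuous_intros)
  ultimately show ?thesis by (simp add: compact_continuous_image)
qed

lemma circle_measurable:
  fixes p a :: "complex^'k::finite"
  shows "(\<lambda>\<theta>. p + cis \<theta> *s a) \<in> borel_measurable borel"
  by (intro borel_measurable_continuous_onI)
     (auto simp: vector_scalar_mult_def cis_conv_exp intro!: continuous_intros)

lemma circle_mean_iff:
  fixes p a :: "complex^'k::finite"
  assumes U: "open U" "\<And>r. open {x\<in>U. u x < r}" and disc: "\<And>\<zeta>. norm \<zeta> \<le> 1 \<Longrightarrow> p + \<zeta> *s a \<in> U"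
    and B: "0 \<le> B" "\<And>\<zeta>. norm \<zeta> \<le> 1 \<Longrightarrow> u (p + \<zeta> *s a) \<le> ereal B"
  shows "u p \<le> ereal_integral (lebesgue_on {0..2*pi}) (\<lambda>\<theta>. u (p + cis \<theta> *s a)) / ereal (2*pi) \<longleftrightarrow>
    (\<integral>\<^sup>+\<theta>. e2ennreal (ereal B - u (p + cis \<theta> *s a)) \<partial>lebesgue_on {0..2*pi})
      \<le> ennreal (2*pi) * e2ennreal (ereal B - u p)"
proof (rule ereal_mean_le_iff)
  have "(\<lambda>\<theta>. if p + cis \<theta> *s a \<in> U then u (p + cis \<theta> *s a) else - \<infinity>) \<in> borel_measurable borel"
    using measurable_compose[OF circle_measurable usc_measurable[OF U]] .
  then have m: "(\<lambda>\<theta>. u (p + cis \<theta> *s a)) \<in> borel_measurable borel"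
    using disc by (simp add: norm_cis)
  show "(\<lambda>\<theta>. u (p + cis \<theta> *s a)) \<in> borel_measurable (lebesgue_on {0..2*pi})"
    using m by (intro measurable_restrict_space1 measurable_completion) simp
  show "finite_measure (lebesgue_on {0..2*pi})"
    by (rule finite_measureI) (simp add: emeasure_restrict_space)
  show "measure (lebesgue_on {0..2*pi}) (space (lebesgue_on {0..2*pi})) = 2 * pi"
    by (simp add: measure_restrict_space)
  show "u p \<le> ereal B" using B(2)[of 0] by simp
qed (use B in \<open>auto simp: norm_cis\<close>)

text \<open>
  The submean inequality in the form in which it is used: an upper bound for the integral of the
  nonnegative function \<open>B - u\<close>.
\<close>

lemma submean_circle:
  fixes p a :: "complex^'k::finite"
  assumes "psh_on U u" "\<And>\<zeta>. norm \<zeta> \<le> 1 \<Longrightarrow> p + \<zeta> *s a \<in> U"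
    and "0 \<le> B" "\<And>\<zeta>. norm \<zeta> \<le> 1 \<Longrightarrow> u (p + \<zeta> *s a) \<le> ereal B"
  shows "(\<integral>\<^sup>+\<theta>. e2ennreal (ereal B - u (p + cis \<theta> *s a)) \<partial>lebesgue_on {0..2*pi})
      \<le> ennreal (2*pi) * e2ennreal (ereal B - u p)"
proof -
  have "u p \<le> ereal_integral (lebesgue_on {0..2*pi}) (\<lambda>\<theta>. u (p + cis \<theta> *s a)) / ereal (2*pi)"
    using assms by (auto simp: psh_on_def)
  then show ?thesis
    by (subst (asm) circle_mean_iff[OF psh_open psh_open_sublevel, where U = U and B = B]) (use assms in auto)
qed

text \<open>
  Integrate the inequality for the circle in direction \<open>a\<close> over all \<open>a\<close> in the ball. After exchanging
  the integrals, the isometry \<open>a \<mapsto> cis \<theta> *s a\<close> of the ball shows that the inner integral does not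
  depend on \<open>\<theta>\<close>.
\<close>

lemma submean_ball:
  fixes p :: "complex^'k::finite"
  assumes u: "psh_on U u" and r: "0 < r" "cball p r \<subseteq> U"
    and B: "0 \<le> B" "\<And>x. x \<in> cball p r \<Longrightarrow> u x \<le> ereal B"
  shows "(\<integral>\<^sup>+x. e2ennreal (ereal B - u x) * indicator (ball p r) x \<partial>lborel)
    \<le> e2ennreal (ereal B - u p) * emeasure lborel (ball p r)"
proof -
  \<comment> \<open>\<open>v\<close> is Borel on the whole space, and \<open>w\<close> vanishes off the ball, so that no domain has to be tracked\<close>
  define v where "v x = (if x \<in> U then u x else - \<infinity>)" for x
  define w where "w x = e2ennreal (ereal B - v x) * indicator (ball p r) x" for x
  have [measurable]: "v \<in> borel_measurable borel"
    unfolding v_def by (rule psh_measurable[OF u])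
  have [measurable]: "ball p r \<in> sets borel" by simp
  have w[measurable]: "w \<in> borel_measurable borel" unfolding w_def by measurable
  have [measurable]: "(\<lambda>(\<theta>::real, a::complex^'k). p + cis \<theta> *s a) \<in> borel_measurable (borel \<Otimes>\<^sub>M borel)"
    unfolding borel_prod
    by (intro borel_measurable_continuous_onI)
      (auto simp: vector_scalar_mult_def cis_conv_exp case_prod_beta intro!: continuous_intros)
  let ?I = "indicator {0..2*pi} :: real \<Rightarrow> ennreal"
  have circ: "(\<integral>\<^sup>+\<theta>. w (p + cis \<theta> *s a) * ?I \<theta> \<partial>lborel)
    \<le> ennreal (2*pi) * e2ennreal (ereal B - u p) * indicator (ball 0 r) a" for a
  proof (cases "a \<in> ball 0 r")
    case True
    have disc: "p + \<zeta> *s a \<in> cball p r" if "norm \<zeta> \<le> 1" for \<zeta>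
    proof -
      have "norm \<zeta> * norm a \<le> 1 * r" using that True by (intro mult_mono) auto
      then show ?thesis by (simp add: dist_norm norm_vector_scalar_mult)
    qed
    have "p + cis \<theta> *s a \<in> ball p r" for \<theta>
      using True by (simp add: dist_norm norm_vector_scalar_mult)
    moreover from this have "p + cis \<theta> *s a \<in> U" for \<theta>
      using r(2) ball_subset_cball by blast
    ultimately have "w (p + cis \<theta> *s a) = e2ennreal (ereal B - u (p + cis \<theta> *s a))" for \<theta>
      by (simp add: w_def v_def)
    then have "(\<integral>\<^sup>+\<theta>. w (p + cis \<theta> *s a) * ?I \<theta> \<partial>lborel) =
      (\<integral>\<^sup>+\<theta>. e2ennreal (ereal B - u (p + cis \<theta> *s a)) \<partial>lebesgue_on {0..2*pi})"
      by (simp add: nn_integral_restrict_space nn_integral_completion)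
    also have "\<dots> \<le> ennreal (2*pi) * e2ennreal (ereal B - u p)"
      using disc r B by (intro submean_circle[OF u]) auto
    finally show ?thesis using True by simp
  next
    case False
    then have "w (p + cis \<theta> *s a) = 0" for \<theta>
      by (simp add: w_def dist_norm norm_vector_scalar_mult)
    then show ?thesis by simp
  qed
  have sph: "(\<integral>\<^sup>+a. w (p + cis \<theta> *s a) \<partial>lborel) = (\<integral>\<^sup>+x. w x \<partial>lborel)" for \<theta>
    using nn_integral_lborel_linear_isometry[of "\<lambda>a. w (p + a)" "\<lambda>a. cis \<theta> *s a"]
      nn_integral_lborel_translate[OF w, of p]
    by (simp add: norm_vector_scalar_mult linear_vector_scalar_mult add.commute)
  have "ennreal (2*pi) * (\<integral>\<^sup>+x. w x \<partial>lborel) = (\<integral>\<^sup>+\<theta>. (\<integral>\<^sup>+a. w (p + cis \<theta> *s a) * ?I \<theta> \<partial>lborel) \<partial>lborel)"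
    by (simp add: nn_integral_multc sph nn_integral_cmult mult.commute)
  also have "\<dots> = (\<integral>\<^sup>+a. (\<integral>\<^sup>+\<theta>. w (p + cis \<theta> *s a) * ?I \<theta> \<partial>lborel) \<partial>lborel)"
    by (rule lborel_pair.Fubini'[symmetric]) measurable
  also have "\<dots> \<le> (\<integral>\<^sup>+a. ennreal (2*pi) * e2ennreal (ereal B - u p) * indicator (ball (0::complex^'k) r) a \<partial>lborel)"
    by (rule nn_integral_mono) (rule circ)
  also have "\<dots> = ennreal (2*pi) * (e2ennreal (ereal B - u p) * emeasure lborel (ball (0::complex^'k) r))"
    by (subst nn_integral_cmult_indicator) (simp_all add: mult.assoc)
  finally have "(\<integral>\<^sup>+x. w x \<partial>lborel) \<le> e2ennreal (ereal B - u p) * emeasure lborel (ball (0::complex^'k) r)"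
    by (subst (asm) ennreal_mult_le_mult_iff) auto
  moreover have "emeasure lborel (ball (0::complex^'k) r) = emeasure lborel (ball p r)"
    by (rule emeasure_lborel_ball[symmetric])
  moreover have "w x = e2ennreal (ereal B - u x) * indicator (ball p r) x" for x
    using r by (auto simp: w_def v_def indicator_def subset_eq)
  ultimately show ?thesis by simp
qed


lemma nn_integral_lebesgue_on:
  assumes "S \<in> sets lebesgue"
  shows "(\<integral>\<^sup>+x. f x \<partial>lebesgue_on S) = (\<integral>\<^sup>+x. f x * indicator S x \<partial>lborel)"
  using assms by (simp add: nn_integral_restrict_space nn_integral_completion)

lemma lebesgue_on_eq_set_integrable:
  fixes f :: "'a::euclidean_space \<Rightarrow> 'b::{banach, second_countable_topology}"
  shows "S \<in> sets lebesgue \<Longrightarrow> integrable (lebesgue_on S) f \<longleftrightarrow> set_integrable lebesgue S f"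
  by (simp add: set_integrable_def integrable_restrict_space)

lemma loc_integrable_if_locally:
  fixes f :: "'a::euclidean_space \<Rightarrow> 'b::{banach, second_countable_topology}"
  assumes "\<And>p. p \<in> S \<Longrightarrow> \<exists>T. open T \<and> p \<in> T \<and> integrable (lebesgue_on T) f"
  shows "loc_integrable S f"
  unfolding loc_integrable_def
proof (intro allI impI, elim conjE)
  fix K assume K: "compact K" "K \<subseteq> S"
  define C where "C = {T. open T \<and> integrable (lebesgue_on T) f}"
  have K': "K \<in> sets lebesgue" by (rule fmeasurableD[OF lmeasurable_compact[OF K(1)]])
  obtain D where D: "D \<subseteq> C" "finite D" "K \<subseteq> \<Union>D"
  proof (rule compactE[OF K(1), of C])
    show "K \<subseteq> \<Union>C"
    proof
      fix x assume "x \<in> K"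
      with assms[of x] K(2) show "x \<in> \<Union>C" unfolding C_def by blast
    qed
  qed (auto simp: C_def)
  have "set_integrable lebesgue (\<Union>T\<in>D. T) f"
    using D by (intro set_integrable_UN)
      (auto simp: C_def subset_eq simp flip: lebesgue_on_eq_set_integrable)
  then have "set_integrable lebesgue K f"
    by (rule set_integrable_subset) (use K' D in auto)
  then show "integrable (lebesgue_on K) f" using K' by (simp add: lebesgue_on_eq_set_integrable)
qed

lemma negligible_if_AE_lborel:
  assumes "AE x in lborel. x \<notin> E"
  shows "negligible E"
proof -
  obtain N where N: "\<And>x. x \<in> space lborel - N \<Longrightarrow> x \<notin> E" "N \<in> null_sets lborel"
    using AE_E3[OF assms] by blast
  then have "negligible N" unfolding negligible_iff_null_sets by (intro null_sets_completionI)
  then show ?thesis by (rule negligible_subset) (use N(1) in auto)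
qed

text \<open>
  A formulation of local integrability for extended real functions, by means of a nonnegative
  integrand.
\<close>

definition integrable_near :: "('a::euclidean_space \<Rightarrow> ereal) \<Rightarrow> 'a set \<Rightarrow> 'a \<Rightarrow> bool" where
  "integrable_near u U p \<longleftrightarrow> (\<exists>r>0. \<exists>B. ball p r \<subseteq> U \<and> (\<forall>x\<in>ball p r. u x \<le> ereal B) \<and>
     (\<integral>\<^sup>+x. e2ennreal (ereal B - u x) * indicator (ball p r) x \<partial>lborel) < \<infinity>)"

text \<open>
  The ball of radius \<open>2 r\<close> about \<open>x\<close> contains the ball of radius \<open>r\<close> about \<open>p\<close> and is contained in the
  ball of radius \<open>3 r\<close> about \<open>p\<close>. The submean inequality centred at \<open>x\<close> bounds the integral because
  \<open>u x\<close> is finite.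
\<close>

lemma psh_integrable_near_if_finite_nearby:
  fixes p :: "complex^'k::finite"
  assumes u: "psh_on U u" and r: "0 < r" "cball p (3 * r) \<subseteq> U" and x: "x \<in> ball p r" "u x \<noteq> - \<infinity>"
  shows "integrable_near u U p"
proof -
  have sub: "ball p r \<subseteq> ball x (2 * r)" "cball x (2 * r) \<subseteq> U"
  proof -
    show "ball p r \<subseteq> ball x (2 * r)"
    proof
      fix y assume "y \<in> ball p r"
      then show "y \<in> ball x (2 * r)" using x(1) dist_triangle[of x y p] by (simp add: dist_commute)
    qed
    have "cball x (2 * r) \<subseteq> cball p (3 * r)"
    proof
      fix y assume "y \<in> cball x (2 * r)"
      then show "y \<in> cball p (3 * r)" using x(1) dist_triangle[of p y x] by (simp add: dist_commute)
    qed
    then show "cball x (2 * r) \<subseteq> U" using r by blast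
  qed
  obtain B where B: "0 \<le> B" "\<forall>y\<in>cball x (2 * r). u y \<le> ereal B"
    using psh_bounded_above_on_compact[OF u, of "cball x (2 * r)"] sub by auto
  have "(\<integral>\<^sup>+y. e2ennreal (ereal B - u y) * indicator (ball p r) y \<partial>lborel)
      \<le> (\<integral>\<^sup>+y. e2ennreal (ereal B - u y) * indicator (ball x (2 * r)) y \<partial>lborel)"
    using sub(1) by (intro nn_integral_mono mult_left_mono) (auto simp: indicator_def)
  also have "\<dots> \<le> e2ennreal (ereal B - u x) * emeasure lborel (ball x (2 * r))"
    using r sub B by (intro submean_ball[OF u]) auto
  also have "\<dots> < \<infinity>"
  proof -
    have "emeasure lborel (ball x (2 * r)) < \<infinity>" by (rule emeasure_bounded_finite) simp
    moreover have "e2ennreal (ereal B - u x) < \<infinity>"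
      using x(2) by (cases "u x") (auto simp: e2ennreal_neg)
    ultimately show ?thesis by (simp add: ennreal_mult_less_top)
  qed
  finally show ?thesis
    unfolding integrable_near_def
    by (intro exI[of _ r] conjI r(1) exI[of _ B]) (use r sub B in \<open>auto simp: subset_eq\<close>)
qed

lemma integrable_near_not_neg_infinity:
  fixes p :: "'a::euclidean_space"
  assumes "integrable_near u U p" "0 < s"
  shows "\<exists>x\<in>ball p s. u x \<noteq> - \<infinity>"
proof (rule ccontr)
  assume *: "\<not> (\<exists>x\<in>ball p s. u x \<noteq> - \<infinity>)"
  from assms(1) obtain r B where r: "0 < r"
    "(\<integral>\<^sup>+x. e2ennreal (ereal B - u x) * indicator (ball p r) x \<partial>lborel) < \<infinity>"
    unfolding integrable_near_def by blast
  define t where "t = min r s"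
  have t: "0 < t" "ball p t \<subseteq> ball p r" "ball p t \<subseteq> ball p s" using r assms by (auto simp: t_def)
  have "(\<integral>\<^sup>+x. \<infinity> * indicator (ball p t) x \<partial>lborel)
    \<le> (\<integral>\<^sup>+x. e2ennreal (ereal B - u x) * indicator (ball p r) x \<partial>lborel)"
    using t * by (intro nn_integral_mono) (auto simp: indicator_def subset_eq)
  with r(2) have "(\<integral>\<^sup>+x. \<infinity> * indicator (ball p t) x \<partial>lborel) < \<infinity>" by (rule le_less_trans[rotated])
  then have "emeasure lborel (ball p t) = 0"
    by (subst (asm) nn_integral_cmult_indicator) (auto simp: ennreal_top_mult split: if_splits)
  then have "negligible (ball p t)"
    unfolding negligible_iff_null_sets by (intro null_sets_completionI) (simp add: null_sets_def)
  then show False using open_not_negligible[of "ball p t"] t by simp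
qed

lemma integrable_near_ball:
  assumes "integrable_near u U p"
  shows "\<exists>r>0. \<forall>x\<in>ball p r. integrable_near u U x"
proof -
  from assms obtain r B where r: "0 < r" "ball p r \<subseteq> U" "\<forall>x\<in>ball p r. u x \<le> ereal B"
    "(\<integral>\<^sup>+x. e2ennreal (ereal B - u x) * indicator (ball p r) x \<partial>lborel) < \<infinity>"
    unfolding integrable_near_def by blast
  have "integrable_near u U x" if x: "x \<in> ball p r" for x
  proof -
    obtain s where s: "0 < s" "ball x s \<subseteq> ball p r"
      by (rule openE[OF open_ball x])
    have "(\<integral>\<^sup>+y. e2ennreal (ereal B - u y) * indicator (ball x s) y \<partial>lborel)
      \<le> (\<integral>\<^sup>+y. e2ennreal (ereal B - u y) * indicator (ball p r) y \<partial>lborel)"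
      using s(2) by (intro nn_integral_mono mult_left_mono) (auto simp: indicator_def)
    then show ?thesis unfolding integrable_near_def using r s
      by (intro exI[of _ s] exI[of _ B]) (auto intro: le_less_trans)
  qed
  with r(1) show ?thesis by blast
qed

text \<open>
  Near a point where \<open>u\<close> is not integrable, \<open>u\<close> is identically \<open>-\<infinity>\<close> by
  \<open>psh_integrable_near_if_finite_nearby\<close>; near a point where it is integrable, it is finite somewhere in every ball. So \<open>U\<close> splits into two
  open sets, and a component that meets the second set lies in it, which contradicts the definition of
  plurisubharmonic functions.
\<close>

lemma psh_integrable_near:
  fixes p :: "complex^'k::finite"
  assumes u: "psh_on U u" and p: "p \<in> U"
  shows "integrable_near u U p"
proof (rule ccontr)
  assume np: "\<not> integrable_near u U p"
  define G where "G = {x\<in>U. integrable_near u U x}"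
  note U = psh_open[OF u]
  have near: "\<exists>r>0. ball q r \<subseteq> U \<and> (\<forall>x\<in>ball q r. u x = - \<infinity>)" if q: "q \<in> U - G" for q
  proof -
    obtain e where e: "0 < e" "cball q e \<subseteq> U" using U q open_contains_cball by blast
    have "u x = - \<infinity>" if "x \<in> ball q (e / 3)" for x
    proof (rule ccontr)
      assume "u x \<noteq> - \<infinity>"
      from psh_integrable_near_if_finite_nearby[OF u _ _ that this] e have "integrable_near u U q"
        by simp
      then show False using q by (simp add: G_def)
    qed
    moreover have "ball q (e / 3) \<subseteq> U" using e by (auto simp: subset_eq)
    ultimately show ?thesis using e(1) by (intro exI[of _ "e / 3"]) simp
  qed
  have inf: "u q = - \<infinity>" if "q \<in> U - G" for q
    using near[OF that] by auto
  have "open G"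
  proof (rule openI)
    fix q assume "q \<in> G"
    then obtain r where r: "0 < r" "\<forall>x\<in>ball q r. integrable_near u U x"
      using integrable_near_ball[of u U q] unfolding G_def by blast
    moreover have "x \<in> U" if "integrable_near u U x" for x
    proof -
      from that obtain s where "0 < s" "ball x s \<subseteq> U" unfolding integrable_near_def by blast
      then show ?thesis by (auto simp: subset_eq)
    qed
    ultimately show "\<exists>e>0. ball q e \<subseteq> G" unfolding G_def by blast
  qed
  moreover have "open (U - G)"
  proof (rule openI)
    fix q assume "q \<in> U - G"
    from near[OF this] obtain r where r: "0 < r" "ball q r \<subseteq> U" "\<forall>x\<in>ball q r. u x = - \<infinity>"
      by blast
    have "x \<notin> G" if x: "x \<in> ball q r" for x
    proof
      assume "x \<in> G"
      obtain s where s: "0 < s" "ball x s \<subseteq> ball q r"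
        by (rule openE[OF open_ball x])
      have "integrable_near u U x" using \<open>x \<in> G\<close> by (simp add: G_def)
      from integrable_near_not_neg_infinity[OF this s(1)] s(2) r(3) show False by blast
    qed
    with r show "\<exists>e>0. ball q e \<subseteq> U - G" by blast
  qed
  moreover define C where "C = connected_component_set U p"
  have C: "C \<in> components U" "p \<in> C" "C \<subseteq> U" "connected C"
    using p by (simp_all add: C_def components_def connected_component_subset)
  ultimately have "G \<inter> C = {} \<or> (U - G) \<inter> C = {}"
    using C(3) by (intro connectedD[OF C(4)]) blast+
  moreover have "p \<in> (U - G) \<inter> C" using p np C by (auto simp: G_def)
  ultimately have "C \<subseteq> U - G" using C by blast
  moreover obtain x where "x \<in> C" "u x \<noteq> - \<infinity>" using u C(1) by (auto simp: psh_on_def)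
  ultimately show False using inf by blast
qed

lemma psh_integrable_on_ball:
  fixes p :: "complex^'k::finite"
  assumes u: "psh_on U u" and p: "p \<in> U"
  shows "\<exists>r>0. ball p r \<subseteq> U \<and> integrable (lebesgue_on (ball p r)) (\<lambda>x. real_of_ereal (u x)) \<and>
    negligible {x\<in>ball p r. u x = - \<infinity>}"
proof -
  from psh_integrable_near[OF assms] obtain r B where r: "0 < r" "ball p r \<subseteq> U"
    "\<forall>x\<in>ball p r. u x \<le> ereal B"
    "(\<integral>\<^sup>+x. e2ennreal (ereal B - u x) * indicator (ball p r) x \<partial>lborel) < \<infinity>"
    unfolding integrable_near_def by blast
  define v where "v x = (if x \<in> U then u x else - \<infinity>)" for x
  have v[measurable]: "v \<in> borel_measurable borel"
    unfolding v_def by (rule psh_measurable[OF u])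
  have uv: "u x = v x" if "x \<in> ball p r" for x using that r by (auto simp: v_def)
  have [measurable]: "ball p r \<in> sets borel" by simp
  have eq: "(\<integral>\<^sup>+x. e2ennreal (ereal B - u x) * indicator (ball p r) x \<partial>lborel) =
    (\<integral>\<^sup>+x. e2ennreal (ereal B - v x) * indicator (ball p r) x \<partial>lborel)"
    by (intro nn_integral_cong) (auto simp: indicator_def uv)
  have meas: "(\<lambda>x. real_of_ereal (v x)) \<in> borel_measurable (lebesgue_on (ball p r))"
    by (intro measurable_restrict_space1 measurable_completion) measurable
  have int: "integrable (lebesgue_on (ball p r)) (\<lambda>x. real_of_ereal (v x))"
  proof (rule integrableI_bounded[OF meas])
    have "(\<integral>\<^sup>+x. ennreal (norm (real_of_ereal (v x))) \<partial>lebesgue_on (ball p r)) =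
      (\<integral>\<^sup>+x. ennreal (norm (real_of_ereal (v x))) * indicator (ball p r) x \<partial>lborel)"
      by (rule nn_integral_lebesgue_on) simp
    also have "\<dots> \<le> (\<integral>\<^sup>+x. ennreal \<bar>B\<bar> * indicator (ball p r) x +
        e2ennreal (ereal B - v x) * indicator (ball p r) x \<partial>lborel)"
    proof (intro nn_integral_mono)
      fix x
      have "ennreal \<bar>real_of_ereal (v x)\<bar> \<le> ennreal \<bar>B\<bar> + e2ennreal (ereal B - v x)"
        if "x \<in> ball p r"
      proof (cases "v x")
        case (real y)
        moreover have "u x \<le> ereal B" using r(3) that by blast
        ultimately have "y \<le> B" using uv[OF that] by simp
        then show ?thesis using real by (auto simp flip: ennreal_plus intro!: ennreal_leI)
      qed auto
      then show "ennreal (norm (real_of_ereal (v x))) * indicator (ball p r) x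
        \<le> ennreal \<bar>B\<bar> * indicator (ball p r) x + e2ennreal (ereal B - v x) * indicator (ball p r) x"
        by (auto simp: indicator_def)
    qed
    also have "\<dots> = ennreal \<bar>B\<bar> * emeasure lborel (ball p r) +
        (\<integral>\<^sup>+x. e2ennreal (ereal B - v x) * indicator (ball p r) x \<partial>lborel)"
      by (subst nn_integral_add) (auto simp: nn_integral_cmult)
    also have "\<dots> < \<infinity>"
      using r(4) emeasure_bounded_finite[of "ball p r"] by (simp add: eq ennreal_mult_less_top)
    finally show "(\<integral>\<^sup>+x. ennreal (norm (real_of_ereal (v x))) \<partial>lebesgue_on (ball p r)) < \<infinity>" .
  qed
  have "AE x in lborel. e2ennreal (ereal B - v x) * indicator (ball p r) x \<noteq> \<infinity>"
    using r(4) unfolding eq by (intro nn_integral_PInf_AE) auto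
  then have "AE x in lborel. x \<notin> {x\<in>ball p r. u x = - \<infinity>}"
    by eventually_elim (auto simp: uv indicator_def)
  then have "negligible {x\<in>ball p r. u x = - \<infinity>}" by (rule negligible_if_AE_lborel)
  moreover have "integrable (lebesgue_on (ball p r)) (\<lambda>x. real_of_ereal (u x))"
    using int by (rule Bochner_Integration.integrable_cong[THEN iffD1, rotated -1]) (auto simp: uv)
  ultimately show ?thesis using r by blast
qed

lemma psh_loc_integrable: "psh_on U u \<Longrightarrow> loc_integrable U (real_of_ereal \<circ> u)"
  for u :: "complex^'k::finite \<Rightarrow> ereal"
  unfolding comp_def
proof (rule loc_integrable_if_locally)
  fix p assume "psh_on U u" "p \<in> U"
  from psh_integrable_on_ball[OF this] obtain r where
    "0 < r" "integrable (lebesgue_on (ball p r)) (\<lambda>x. real_of_ereal (u x))" by blast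
  then show "\<exists>T. open T \<and> p \<in> T \<and> integrable (lebesgue_on T) (\<lambda>x. real_of_ereal (u x))"
    by (intro exI[of _ "ball p r"]) simp
qed

lemma negligible_if_locally:
  fixes U :: "'a::euclidean_space set"
  assumes "\<And>p. p \<in> U \<Longrightarrow> \<exists>T. open T \<and> p \<in> T \<and> negligible (T \<inter> E)" "E \<subseteq> U"
  shows "negligible E"
  unfolding locally_negligible_alt[of E]
proof
  fix p assume "p \<in> E"
  then obtain T where T: "open T" "p \<in> T" "negligible (T \<inter> E)" using assms by blast
  then show "\<exists>V. openin (top_of_set E) V \<and> p \<in> V \<and> negligible V"
    using \<open>p \<in> E\<close> by (intro exI[of _ "E \<inter> T"]) (auto simp: openin_open_Int Int_commute)
qed

lemma psh_polar_negligible: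
  fixes u :: "complex^'k::finite \<Rightarrow> ereal"
  assumes "psh_on U u"
  shows "negligible {x\<in>U. u x = - \<infinity>}"
proof (rule negligible_if_locally)
  fix p assume "p \<in> U"
  from psh_integrable_on_ball[OF assms this] obtain r where
    r: "0 < r" "ball p r \<subseteq> U" "negligible {x\<in>ball p r. u x = - \<infinity>}" by blast
  moreover have "ball p r \<inter> {x\<in>U. u x = - \<infinity>} = {x\<in>ball p r. u x = - \<infinity>}" using r by auto
  ultimately show "\<exists>T. open T \<and> p \<in> T \<and> negligible (T \<inter> {x\<in>U. u x = - \<infinity>})"
    by (intro exI[of _ "ball p r"]) auto
qed auto

lemma AE_lebesgue_on_if_negligible:
  assumes "negligible {x\<in>U. \<not> P x}" "U \<in> sets lebesgue"
  shows "AE x in lebesgue_on U. P x"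
proof -
  have "AE x in lebesgue. x \<notin> {x\<in>U. \<not> P x}"
    using assms(1) by (intro AE_not_in) (simp add: negligible_iff_null_sets)
  then have "AE x in lebesgue. x \<in> U \<longrightarrow> P x" by eventually_elim auto
  then show ?thesis using assms(2) by (simp add: AE_restrict_space_iff)
qed

lemma psh_AE_finite:
  fixes u :: "complex^'k::finite \<Rightarrow> ereal"
  assumes "psh_on U u"
  shows "AE x in lebesgue_on U. \<bar>u x\<bar> \<noteq> \<infinity>"
proof (rule AE_lebesgue_on_if_negligible)
  have "{x\<in>U. \<not> \<bar>u x\<bar> \<noteq> \<infinity>} = {x\<in>U. u x = - \<infinity>}"
    using psh_less_top[OF assms] by (auto simp: abs_eq_infinity_cases)
  then show "negligible {x\<in>U. \<not> \<bar>u x\<bar> \<noteq> \<infinity>}" using psh_polar_negligible[OF assms] by simp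
qed (use psh_open[OF assms] in auto)

section \<open>The cone of plurisubharmonic functions\<close>

lemma negligible_imp_point_outside:
  assumes "open V" "V \<noteq> {}" "negligible E"
  shows "\<exists>x\<in>V. x \<notin> (E :: 'a::euclidean_space set)"
  using open_not_negligible[OF assms(1,2)] negligible_subset[OF assms(3), of V] by blast

text \<open>
  The issue is the condition on components: a component of \<open>V\<close> might lie in the set where \<open>u\<close> is
  \<open>-\<infinity>\<close>. It does not, since that set is negligible and components of open sets are open.
\<close>

lemma psh_on_subset:
  fixes u :: "complex^'k::finite \<Rightarrow> ereal"
  assumes u: "psh_on U u" and V: "open V" "V \<subseteq> U"
  shows "psh_on V u"
  unfolding psh_on_def
proof (intro conjI allI ballI impI)
  fix r
  have "{x\<in>V. u x < r} = {x\<in>U. u x < r} \<inter> V" using V by auto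
  then show "open {x\<in>V. u x < r}" using psh_open_sublevel[OF u] V by auto
next
  fix C assume C: "C \<in> components V"
  have "open C" "C \<noteq> {}" "C \<subseteq> U"
    using C V open_components in_components_nonempty in_components_subset by blast+
  with negligible_imp_point_outside[OF _ _ psh_polar_negligible[OF u]]
  show "\<exists>x\<in>C. u x \<noteq> - \<infinity>" by blast
qed (use assms in \<open>auto simp: psh_on_def subset_eq\<close>)

lemma psh_on_zero: "open U \<Longrightarrow> psh_on U (\<lambda>_. 0)"
  for U :: "(complex^'k::finite) set"
proof -
  assume U: "open U"
  have "open {x\<in>U. 0 < r}" for r :: ereal using U by (cases "0 < r") auto
  then show ?thesis using in_components_nonempty[of _ U]
    by (auto simp: psh_on_def ereal_integral_def e2ennreal_neg zero_ennreal.rep_eq)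
qed

text \<open>
  It presents a sublevel set of a sum as a union of intersections of sublevel sets of the summands.
\<close>

lemma ereal_add_less_iff:
  fixes a b r :: ereal
  assumes "a < \<infinity>" "b < \<infinity>"
  shows "a + b < r \<longleftrightarrow> (\<exists>s::real. a < ereal s \<and> b < r - ereal s)"
proof
  assume l: "a + b < r"
  show "\<exists>s::real. a < ereal s \<and> b < r - ereal s"
  proof (cases a; cases b; cases r)
    fix x y z assume xyz: "a = ereal x" "b = ereal y" "r = ereal z"
    then show ?thesis using l by (intro exI[of _ "x + (z - x - y) / 2"]) (auto simp: field_simps)
  next
    fix x assume xyz: "a = ereal x" "r = \<infinity>"
    then show ?thesis using assms by (intro exI[of _ "x + 1"]) auto
  next
    fix x z assume xyz: "a = ereal x" "r = ereal z" "b = - \<infinity>"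
    then show ?thesis using assms by (intro exI[of _ "x + 1"]) auto
  next
    fix y z assume xyz: "a = - \<infinity>" "b = ereal y" "r = ereal z"
    then show ?thesis by (intro exI[of _ "z - y - 1"]) auto
  qed (use assms l in \<open>auto intro: gt_ex\<close>)
next
  assume "\<exists>s::real. a < ereal s \<and> b < r - ereal s"
  then show "a + b < r" using assms by (cases a; cases b; cases r) auto
qed

lemma psh_on_add:
  fixes u v :: "complex^'k::finite \<Rightarrow> ereal"
  assumes u: "psh_on U u" and v: "psh_on U v"
  shows "psh_on U (\<lambda>x. u x + v x)"
proof -
  note U = psh_open[OF u] and lt = psh_less_top[OF u] psh_less_top[OF v]
  have usc: "open {x\<in>U. u x + v x < r}" for r
  proof -
    have "{x\<in>U. u x + v x < r} = (\<Union>s::real. {x\<in>U. u x < ereal s} \<inter> {x\<in>U. v x < r - ereal s})"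
      using ereal_add_less_iff[OF lt] by auto
    also have "open \<dots>" by (intro open_UN ballI open_Int psh_open_sublevel u v)
    finally show ?thesis .
  qed
  show ?thesis
    unfolding psh_on_def
  proof (intro conjI allI ballI impI usc)
    fix x assume "x \<in> U"
    with lt show "u x + v x < \<infinity>" by auto
  next
    fix C assume C: "C \<in> components U"
    have "open C" "C \<noteq> {}" "C \<subseteq> U"
      using C U open_components in_components_nonempty in_components_subset by blast+
    with negligible_imp_point_outside[OF _ _ negligible_Un[OF psh_polar_negligible[OF u]
          psh_polar_negligible[OF v]], of C]
    obtain x where x: "x \<in> C" "u x \<noteq> - \<infinity>" "v x \<noteq> - \<infinity>" by blast
    then show "\<exists>x\<in>C. u x + v x \<noteq> - \<infinity>"
      using lt[of x] \<open>C \<subseteq> U\<close> by (intro bexI[of _ x]) auto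
  next
    fix p a :: "complex^'k"
    assume "\<forall>\<zeta>. norm \<zeta> \<le> 1 \<longrightarrow> p + \<zeta> *s a \<in> U"
    then have disc: "p + \<zeta> *s a \<in> U" if "norm \<zeta> \<le> 1" for \<zeta> using that by blast
    let ?K = "{p + \<zeta> *s a | \<zeta>. norm \<zeta> \<le> 1}"
    have K: "compact ?K" "?K \<subseteq> U" using compact_complex_disc disc by auto
    obtain A where A: "0 \<le> A" "\<forall>x\<in>?K. u x \<le> ereal A"
      using psh_bounded_above_on_compact[OF u K] by blast
    obtain B where B: "0 \<le> B" "\<forall>x\<in>?K. v x \<le> ereal B"
      using psh_bounded_above_on_compact[OF v K] by blast
    have split: "e2ennreal (ereal (A + B) - (u x + v x)) =
        e2ennreal (ereal A - u x) + e2ennreal (ereal B - v x)" if "x \<in> ?K" for x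
    proof -
      have "u x \<le> ereal A" "v x \<le> ereal B" using A(2) B(2) that by blast+
      then show ?thesis
        by (cases "u x"; cases "v x") (auto simp: algebra_simps simp flip: ennreal_plus)
    qed
    have mem: "p + cis \<theta> *s a \<in> ?K" for \<theta> by (auto intro!: exI[of _ "cis \<theta>"])
    have meas: "(\<lambda>\<theta>. e2ennreal (ereal c - w (p + cis \<theta> *s a))) \<in> borel_measurable (lebesgue_on {0..2*pi})"
      if w: "psh_on U w" for c w
    proof -
      have [measurable]: "(\<lambda>\<theta>. if p + cis \<theta> *s a \<in> U then w (p + cis \<theta> *s a) else - \<infinity>)
          \<in> borel_measurable borel"
        using measurable_compose[OF circle_measurable psh_measurable[OF w]] .
      have [measurable]: "(\<lambda>\<theta>. w (p + cis \<theta> *s a)) \<in> borel_measurable borel"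
        using \<open>(\<lambda>\<theta>. if p + cis \<theta> *s a \<in> U then w (p + cis \<theta> *s a) else - \<infinity>)
          \<in> borel_measurable borel\<close> disc by (simp add: norm_cis)
      show ?thesis by (intro measurable_restrict_space1 measurable_completion) measurable
    qed
    have "(\<integral>\<^sup>+\<theta>. e2ennreal (ereal (A + B) - (u (p + cis \<theta> *s a) + v (p + cis \<theta> *s a))) \<partial>lebesgue_on {0..2*pi})
      = (\<integral>\<^sup>+\<theta>. e2ennreal (ereal A - u (p + cis \<theta> *s a)) \<partial>lebesgue_on {0..2*pi}) +
        (\<integral>\<^sup>+\<theta>. e2ennreal (ereal B - v (p + cis \<theta> *s a)) \<partial>lebesgue_on {0..2*pi})"
      by (simp only: split[OF mem] nn_integral_add[OF meas[OF u] meas[OF v]])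
    also have "\<dots> \<le> ennreal (2*pi) * e2ennreal (ereal A - u p) + ennreal (2*pi) * e2ennreal (ereal B - v p)"
      using A B by (intro add_mono submean_circle[OF u disc] submean_circle[OF v disc]) auto
    also have "\<dots> = ennreal (2*pi) * e2ennreal (ereal (A + B) - (u p + v p))"
      by (subst split) (auto simp: distrib_left intro!: exI[of _ 0])
    finally show "u p + v p \<le> ereal_integral (lebesgue_on {0..2*pi})
        (\<lambda>\<theta>. u (p + cis \<theta> *s a) + v (p + cis \<theta> *s a)) / ereal (2*pi)"
    proof (subst circle_mean_iff[OF U usc disc, where B = "A + B"])
      fix \<zeta> :: complex assume "norm \<zeta> \<le> 1"
      then have "u (p + \<zeta> *s a) + v (p + \<zeta> *s a) \<le> ereal A + ereal B"
        using A B by (intro add_mono) auto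
      then show "u (p + \<zeta> *s a) + v (p + \<zeta> *s a) \<le> ereal (A + B)" by simp
    qed (use A B in auto)
  qed
qed

lemma psh_on_cmult:
  fixes u :: "complex^'k::finite \<Rightarrow> ereal"
  assumes u: "psh_on U u" and c: "0 \<le> c"
  shows "psh_on U (\<lambda>x. ereal c * u x)"
proof (cases "c = 0")
  case True
  then show ?thesis using psh_on_zero[OF psh_open[OF u]] by (simp add: zero_ereal_def[symmetric])
next
  case False
  with c have c: "0 < c" by simp
  note U = psh_open[OF u] and lt = psh_less_top[OF u]
  have usc: "open {x\<in>U. ereal c * u x < r}" for r
  proof -
    have "ereal c * y < r \<longleftrightarrow> y < r / ereal c" for y
      using c by (cases y; cases r) (auto simp: field_simps)
    then show ?thesis using psh_open_sublevel[OF u, of "r / ereal c"] by simp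
  qed
  show ?thesis
    unfolding psh_on_def
  proof (intro conjI allI ballI impI usc)
    fix x assume "x \<in> U"
    from lt[OF this] show "ereal c * u x < \<infinity>" using c by (cases "u x") auto
  next
    fix C assume "C \<in> components U"
    then obtain x where "x \<in> C" "u x \<noteq> - \<infinity>" using u unfolding psh_on_def by blast
    then show "\<exists>x\<in>C. ereal c * u x \<noteq> - \<infinity>" using c by (intro bexI[of _ x]) (cases "u x", auto)
  next
    fix p a :: "complex^'k"
    assume "\<forall>\<zeta>. norm \<zeta> \<le> 1 \<longrightarrow> p + \<zeta> *s a \<in> U"
    then have disc: "p + \<zeta> *s a \<in> U" if "norm \<zeta> \<le> 1" for \<zeta> using that by blast
    let ?K = "{p + \<zeta> *s a | \<zeta>. norm \<zeta> \<le> 1}"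
    have K: "compact ?K" "?K \<subseteq> U" using compact_complex_disc disc by auto
    obtain A where A: "0 \<le> A" "\<forall>x\<in>?K. u x \<le> ereal A"
      using psh_bounded_above_on_compact[OF u K] by blast
    have scale: "e2ennreal (ereal (c * A) - ereal c * y) = ennreal c * e2ennreal (ereal A - y)"
      if "y \<le> ereal A" for y
      using c that
      by (cases y) (auto simp: algebra_simps ennreal_mult_top simp flip: ennreal_mult)
    have le: "u (p + \<zeta> *s a) \<le> ereal A" if "norm \<zeta> \<le> 1" for \<zeta> using A that by auto
    have "(\<lambda>\<theta>. if p + cis \<theta> *s a \<in> U then u (p + cis \<theta> *s a) else - \<infinity>)
          \<in> borel_measurable borel"
      using measurable_compose[OF circle_measurable psh_measurable[OF u]] .
    then have [measurable]: "(\<lambda>\<theta>. u (p + cis \<theta> *s a)) \<in> borel_measurable borel"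
      using disc by (simp add: norm_cis)
    have meas: "(\<lambda>\<theta>. e2ennreal (ereal A - u (p + cis \<theta> *s a))) \<in> borel_measurable (lebesgue_on {0..2*pi})"
      by (intro measurable_restrict_space1 measurable_completion) measurable
    have "(\<integral>\<^sup>+\<theta>. e2ennreal (ereal (c * A) - ereal c * u (p + cis \<theta> *s a)) \<partial>lebesgue_on {0..2*pi})
      = ennreal c * (\<integral>\<^sup>+\<theta>. e2ennreal (ereal A - u (p + cis \<theta> *s a)) \<partial>lebesgue_on {0..2*pi})"
      using le by (simp add: scale norm_cis nn_integral_cmult[OF meas])
    also have "\<dots> \<le> ennreal c * (ennreal (2*pi) * e2ennreal (ereal A - u p))"
      using A le by (intro mult_left_mono submean_circle[OF u disc]) auto
    also have "\<dots> = ennreal (2*pi) * e2ennreal (ereal (c * A) - ereal c * u p)"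
    proof -
      have "u p \<le> ereal A" using le[of 0] by simp
      then show ?thesis by (simp only: scale mult.left_commute)
    qed
    finally show "ereal c * u p \<le> ereal_integral (lebesgue_on {0..2*pi})
        (\<lambda>\<theta>. ereal c * u (p + cis \<theta> *s a)) / ereal (2*pi)"
    proof (subst circle_mean_iff[OF U usc disc, where B = "c * A"])
      fix \<zeta> :: complex assume "norm \<zeta> \<le> 1"
      from le[OF this] show "ereal c * u (p + \<zeta> *s a) \<le> ereal (c * A)"
        using c by (cases "u (p + \<zeta> *s a)") auto
    qed (use A c in auto)
  qed
qed

section \<open>Local integrability and almost everywhere equality\<close>

lemma complete_measure_lebesgue_on:
  assumes "S \<in> sets lebesgue"
  shows "complete_measure (lebesgue_on S)"
proof
  fix A B assume "A \<subseteq> B" "B \<in> null_sets (lebesgue_on S)"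
  then have "B \<in> null_sets lebesgue" "B \<subseteq> S" using assms by (auto simp: null_sets_restrict_space)
  with \<open>A \<subseteq> B\<close> have "A \<in> sets lebesgue" by (meson completion.complete2 null_setsD2)
  with \<open>A \<subseteq> B\<close> \<open>B \<subseteq> S\<close> show "A \<in> sets (lebesgue_on S)"
    using assms by (auto simp: sets_restrict_space_iff)
qed

lemma (in complete_measure) borel_measurable_AE_cong:
  fixes f :: "'a \<Rightarrow> 'b::topological_space"
  assumes f: "f \<in> borel_measurable M" and ae: "AE x in M. f x = g x"
  shows "g \<in> borel_measurable M"
proof (rule measurableI)
  fix A :: "'b set" assume "A \<in> sets borel"
  with f have "f -` A \<inter> space M \<in> sets M" by (rule measurable_sets)
  then show "g -` A \<inter> space M \<in> sets M"
    by (rule in_sets_AE[rotated]) (use ae in \<open>auto\<close>)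
qed simp

lemma (in complete_measure) integrable_AE_cong:
  fixes f :: "'a \<Rightarrow> 'b::{banach, second_countable_topology}"
  assumes f: "integrable M f" and ae: "AE x in M. f x = g x"
  shows "integrable M g"
  using borel_measurable_AE_cong[OF borel_measurable_integrable[OF f] ae] f ae
  by (intro integrable_cong_AE_imp[of M f g]) auto

lemma AE_lebesgue_on_subset:
  assumes "AE x in lebesgue_on S. P x" "K \<subseteq> S" "K \<in> sets lebesgue" "S \<in> sets lebesgue"
  shows "AE x in lebesgue_on K. P x"
  using assms by (auto simp: AE_restrict_space_iff)

lemma compact_lebesgue_sets: "compact K \<Longrightarrow> K \<in> sets lebesgue" for K :: "'a::euclidean_space set"
  by (rule fmeasurableD[OF lmeasurable_compact])

lemma open_lebesgue_sets: "open U \<Longrightarrow> U \<in> sets lebesgue" for U :: "'a::euclidean_space set"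
  by auto

lemma integrable_square_sum:
  fixes f g :: "'a \<Rightarrow> 'b::{banach, second_countable_topology}"
  assumes [measurable]: "f \<in> borel_measurable M" "g \<in> borel_measurable M"
    and int: "integrable M (\<lambda>x. (norm (f x))\<^sup>2)" "integrable M (\<lambda>x. (norm (g x))\<^sup>2)"
  shows "integrable M (\<lambda>x. (norm (f x + g x))\<^sup>2)"
proof (rule Bochner_Integration.integrable_bound)
  show "integrable M (\<lambda>x. 2 * (norm (f x))\<^sup>2 + 2 * (norm (g x))\<^sup>2)" using int by simp
  have "(norm (f x + g x))\<^sup>2 \<le> 2 * (norm (f x))\<^sup>2 + 2 * (norm (g x))\<^sup>2" for x
  proof -
    have "(norm (f x + g x))\<^sup>2 \<le> (norm (f x) + norm (g x))\<^sup>2"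
      by (intro power_mono norm_triangle_ineq) simp
    then show ?thesis using sum_squares_bound[of "norm (f x)" "norm (g x)"] by (simp add: power2_sum)
  qed
  then show "AE x in M. norm ((norm (f x + g x))\<^sup>2) \<le> norm (2 * (norm (f x))\<^sup>2 + 2 * (norm (g x))\<^sup>2)"
    by simp
qed measurable

lemma loc_integrable_add:
  "loc_integrable S f \<Longrightarrow> loc_integrable S g \<Longrightarrow> loc_integrable S (\<lambda>x. f x + g x)"
  by (auto simp: loc_integrable_def)

lemma loc_integrable_scaleR: "loc_integrable S f \<Longrightarrow> loc_integrable S (\<lambda>x. t *\<^sub>R f x)"
  by (auto simp: loc_integrable_def)

lemma loc_integrable_mult:
  fixes f :: "'a::euclidean_space \<Rightarrow> real"
  shows "loc_integrable S f \<Longrightarrow> loc_integrable S (\<lambda>x. t * f x)"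
  using loc_integrable_scaleR[of S f t] by simp

lemma loc_integrable_AE:
  assumes "loc_integrable S f" "AE x in lebesgue_on S. f x = g x" "open S"
  shows "loc_integrable S g"
  unfolding loc_integrable_def
proof (intro allI impI, elim conjE)
  fix K assume K: "compact K" "K \<subseteq> S"
  note K' = compact_lebesgue_sets[OF K(1)]
  have "integrable (lebesgue_on K) f" using assms(1) K by (simp add: loc_integrable_def)
  moreover have "AE x in lebesgue_on K. f x = g x"
    by (rule AE_lebesgue_on_subset[OF assms(2) K(2) K' open_lebesgue_sets[OF assms(3)]])
  ultimately show "integrable (lebesgue_on K) g"
    by (rule complete_measure.integrable_AE_cong[OF complete_measure_lebesgue_on[OF K']])
qed

lemma loc_integrable_square_sum:
  fixes f g :: "'a::euclidean_space \<Rightarrow> 'b::{banach, second_countable_topology}"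
  assumes "loc_integrable S f" "loc_integrable S g"
    and "loc_integrable S (\<lambda>x. (norm (f x))\<^sup>2)" "loc_integrable S (\<lambda>x. (norm (g x))\<^sup>2)"
  shows "loc_integrable S (\<lambda>x. (norm (f x + g x))\<^sup>2)"
  unfolding loc_integrable_def
proof (intro allI impI)
  fix K assume "compact K \<and> K \<subseteq> S"
  with assms have "integrable (lebesgue_on K) f" "integrable (lebesgue_on K) g"
    "integrable (lebesgue_on K) (\<lambda>x. (norm (f x))\<^sup>2)" "integrable (lebesgue_on K) (\<lambda>x. (norm (g x))\<^sup>2)"
    unfolding loc_integrable_def by simp_all
  from integrable_square_sum[OF this(1,2)[THEN borel_measurable_integrable] this(3,4)]
  show "integrable (lebesgue_on K) (\<lambda>x. (norm (f x + g x))\<^sup>2)" .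
qed

text \<open>
  Local integrability and integrals against test functions refer to different restrictions of
  Lebesgue measure; they are related by the support.
\<close>

lemma integrable_supported:
  fixes h :: "'a::euclidean_space \<Rightarrow> 'b::{banach, second_countable_topology}"
  assumes K: "compact K" "K \<subseteq> S" and S: "open S"
    and int: "integrable (lebesgue_on K) h" and off: "\<And>x. x \<notin> K \<Longrightarrow> h x = 0"
  shows "integrable (lebesgue_on S) h"
proof -
  have "(\<lambda>x. indicat_real S x *\<^sub>R h x) = (\<lambda>x. indicat_real K x *\<^sub>R h x)"
    using K off by (fastforce simp: indicator_def)
  then show ?thesis
    using int compact_lebesgue_sets[OF K(1)] open_lebesgue_sets[OF S]
    by (simp add: integrable_restrict_space)
qed

lemma integrable_test_scaleR:
  fixes f :: "'a::euclidean_space \<Rightarrow> 'b::{banach, second_countable_topology}" and g :: "'a \<Rightarrow> real"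
  assumes f: "loc_integrable S f" and S: "open S" and K: "compact K" "K \<subseteq> S"
    and g: "continuous_on UNIV g" "\<And>x. x \<notin> K \<Longrightarrow> g x = 0"
  shows "integrable (lebesgue_on S) (\<lambda>x. g x *\<^sub>R f x)"
proof (rule integrable_supported[OF K S])
  have fK: "integrable (lebesgue_on K) f" using f K by (simp add: loc_integrable_def)
  obtain B where B: "\<And>x. x \<in> K \<Longrightarrow> \<bar>g x\<bar> \<le> B" "0 < B"
    using compact_imp_bounded[OF compact_continuous_image[OF continuous_on_subset[OF g(1)] K(1)]]
    by (auto simp: bounded_pos)
  have gm: "g \<in> borel_measurable (lebesgue_on K)"
    by (intro measurable_restrict_space1 measurable_completion)
       (simp add: borel_measurable_continuous_onI g(1))
  show "integrable (lebesgue_on K) (\<lambda>x. g x *\<^sub>R f x)"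
  proof (rule Bochner_Integration.integrable_bound)
    show "integrable (lebesgue_on K) (\<lambda>x. B *\<^sub>R f x)" using fK by simp
    show "(\<lambda>x. g x *\<^sub>R f x) \<in> borel_measurable (lebesgue_on K)"
      using gm borel_measurable_integrable[OF fK] by (rule borel_measurable_scaleR)
    show "AE x in lebesgue_on K. norm (g x *\<^sub>R f x) \<le> norm (B *\<^sub>R f x)"
      using B by (intro AE_I2) (auto intro!: mult_right_mono)
  qed
qed (use g in auto)

lemma integrable_test_scaleR':
  fixes f :: "'a::euclidean_space \<Rightarrow> real" and g :: "'a \<Rightarrow> 'b::{banach, second_countable_topology}"
  assumes f: "loc_integrable S f" and S: "open S" and K: "compact K" "K \<subseteq> S"
    and g: "continuous_on UNIV g" "\<And>x. x \<notin> K \<Longrightarrow> g x = 0"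
  shows "integrable (lebesgue_on S) (\<lambda>x. f x *\<^sub>R g x)"
proof (rule integrable_supported[OF K S])
  have fK: "integrable (lebesgue_on K) f" using f K by (simp add: loc_integrable_def)
  obtain B where B: "\<And>x. x \<in> K \<Longrightarrow> norm (g x) \<le> B" "0 < B"
    using compact_imp_bounded[OF compact_continuous_image[OF continuous_on_subset[OF g(1)] K(1)]]
    by (auto simp: bounded_pos)
  have gm: "g \<in> borel_measurable (lebesgue_on K)"
    by (intro measurable_restrict_space1 measurable_completion)
       (simp add: borel_measurable_continuous_onI g(1))
  show "integrable (lebesgue_on K) (\<lambda>x. f x *\<^sub>R g x)"
  proof (rule Bochner_Integration.integrable_bound)
    show "integrable (lebesgue_on K) (\<lambda>x. B * f x)" using fK by simp
    show "(\<lambda>x. f x *\<^sub>R g x) \<in> borel_measurable (lebesgue_on K)"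
      using borel_measurable_integrable[OF fK] gm by (rule borel_measurable_scaleR)
    show "AE x in lebesgue_on K. norm (f x *\<^sub>R g x) \<le> norm (B * f x)"
      using B by (intro AE_I2) (auto simp: abs_mult mult.commute[of B] intro!: mult_left_mono)
  qed
qed (use g in auto)

section \<open>Differentiability classes\<close>

lemma C_on_cong:
  fixes f g :: "'a::euclidean_space \<Rightarrow> 'b::real_normed_vector"
  assumes S: "open S"
  shows "(\<And>x. x \<in> S \<Longrightarrow> f x = g x) \<Longrightarrow> C_on n S f \<Longrightarrow> C_on n S g"
proof (induction n arbitrary: f g)
  case 0
  then show ?case using continuous_on_cong[of S S f g] by simp
next
  case (Suc n)
  have diff: "f differentiable at x" if "x \<in> S" for x
    using Suc.prems(2) that S by (simp add: differentiable_on_eq_differentiable_at)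
  have "g differentiable_on S"
    unfolding differentiable_on_eq_differentiable_at[OF S]
    using diff Suc.prems(1) S
    by (meson differentiable_def has_derivative_transform_within_open)
  moreover have "C_on n S (\<lambda>x. frechet_derivative g (at x) b)" if "b \<in> Basis" for b
  proof (rule Suc.IH)
    show "frechet_derivative f (at x) b = frechet_derivative g (at x) b" if "x \<in> S" for x
      using frechet_derivative_transform_within_open[OF diff[OF that] S that Suc.prems(1)] by simp
    show "C_on n S (\<lambda>x. frechet_derivative f (at x) b)" using Suc.prems(2) that by simp
  qed
  ultimately show ?case by simp
qed

lemma C_on_subset: "C_on n S f \<Longrightarrow> T \<subseteq> S \<Longrightarrow> C_on n T f"
  by (induction n arbitrary: f) (auto intro: continuous_on_subset differentiable_on_subset)

lemma C_on_add:
  fixes f g :: "'a::euclidean_space \<Rightarrow> 'b::real_normed_vector"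
  assumes S: "open S"
  shows "C_on n S f \<Longrightarrow> C_on n S g \<Longrightarrow> C_on n S (\<lambda>x. f x + g x)"
proof (induction n arbitrary: f g)
  case 0
  then show ?case by (simp add: continuous_on_add)
next
  case (Suc n)
  have "C_on n S (\<lambda>x. frechet_derivative (\<lambda>x. f x + g x) (at x) b)" if "b \<in> Basis" for b
  proof (rule C_on_cong[OF S])
    show "C_on n S (\<lambda>x. frechet_derivative f (at x) b + frechet_derivative g (at x) b)"
      using Suc that by simp
    fix x assume "x \<in> S"
    then have "f differentiable at x" "g differentiable at x"
      using Suc.prems S by (simp_all add: differentiable_on_eq_differentiable_at)
    then have "((\<lambda>x. f x + g x) has_derivative
        (\<lambda>h. frechet_derivative f (at x) h + frechet_derivative g (at x) h)) (at x)"
      by (intro has_derivative_add) (simp_all flip: frechet_derivative_works)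
    from frechet_derivative_at[OF this, symmetric]
    show "frechet_derivative f (at x) b + frechet_derivative g (at x) b =
      frechet_derivative (\<lambda>x. f x + g x) (at x) b" by simp
  qed
  then show ?case using Suc.prems by simp
qed

lemma C_on_scaleR:
  fixes f :: "'a::euclidean_space \<Rightarrow> 'b::real_normed_vector"
  assumes S: "open S"
  shows "C_on n S f \<Longrightarrow> C_on n S (\<lambda>x. c *\<^sub>R f x)"
proof (induction n arbitrary: f)
  case 0
  then show ?case by (simp add: continuous_on_scaleR)
next
  case (Suc n)
  have der: "((\<lambda>x. c *\<^sub>R f x) has_derivative (\<lambda>h. c *\<^sub>R frechet_derivative f (at x) h)) (at x)"
    if "x \<in> S" for x
    using Suc.prems S that
    by (intro has_derivative_scaleR_right)
      (simp add: differentiable_on_eq_differentiable_at flip: frechet_derivative_works)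
  have "C_on n S (\<lambda>x. frechet_derivative (\<lambda>x. c *\<^sub>R f x) (at x) b)" if "b \<in> Basis" for b
  proof (rule C_on_cong[OF S])
    show "C_on n S (\<lambda>x. c *\<^sub>R frechet_derivative f (at x) b)" using Suc that by simp
    fix x assume "x \<in> S"
    from frechet_derivative_at[OF der[OF this], symmetric]
    show "c *\<^sub>R frechet_derivative f (at x) b = frechet_derivative (\<lambda>x. c *\<^sub>R f x) (at x) b" by simp
  qed
  moreover have "(\<lambda>x. c *\<^sub>R f x) differentiable_on S"
    unfolding differentiable_on_eq_differentiable_at[OF S] using der by (blast intro: differentiableI)
  ultimately show ?case by simp
qed

lemma C_on_const: "C_on n S (\<lambda>_. c)"
  by (induction n arbitrary: c) simp_all

lemma smooth_on_add: "open S \<Longrightarrow> smooth_on S f \<Longrightarrow> smooth_on S g \<Longrightarrow> smooth_on S (\<lambda>x. f x + g x)"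
  by (simp add: smooth_on_def C_on_add)

lemma smooth_on_scaleR: "open S \<Longrightarrow> smooth_on S f \<Longrightarrow> smooth_on S (\<lambda>x. c *\<^sub>R f x)"
  by (simp add: smooth_on_def C_on_scaleR)

lemma smooth_on_const: "smooth_on S (\<lambda>_. z)"
  by (simp add: smooth_on_def C_on_const)

lemma smooth_on_subset: "smooth_on S f \<Longrightarrow> T \<subseteq> S \<Longrightarrow> smooth_on T f"
  unfolding smooth_on_def using C_on_subset by blast

lemma smooth_on_imp_continuous_on: "smooth_on S f \<Longrightarrow> continuous_on S f"
  unfolding smooth_on_def by (drule spec[of _ 0]) simp

section \<open>Test functions\<close>

lemma frechet_derivative_zero_off_support:
  assumes "closed K" "\<And>x. x \<notin> K \<Longrightarrow> f x = 0" "x \<notin> K"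
  shows "frechet_derivative f (at x) = (\<lambda>_. 0)"
proof -
  have "frechet_derivative (\<lambda>_. 0) (at x) = frechet_derivative f (at x)"
    by (rule frechet_derivative_transform_within_open[of _ _ "- K"]) (use assms in auto)
  then show ?thesis by simp
qed

lemma continuous_on_frechet_derivative:
  fixes f :: "'a::euclidean_space \<Rightarrow> 'b::real_normed_vector"
  assumes "C_on (Suc 0) UNIV f"
  shows "continuous_on UNIV (\<lambda>x. frechet_derivative f (at x) v)"
proof -
  have "frechet_derivative f (at x) v = (\<Sum>b\<in>Basis. (v \<bullet> b) *\<^sub>R frechet_derivative f (at x) b)" for x
  proof -
    have lin: "linear (frechet_derivative f (at x))"
      using assms by (intro linear_frechet_derivative) (simp add: differentiable_on_def)
    have "frechet_derivative f (at x) v = frechet_derivative f (at x) (\<Sum>b\<in>Basis. (v \<bullet> b) *\<^sub>R b)"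
      by (simp only: euclidean_representation)
    then show ?thesis by (simp only: linear_sum[OF lin] linear_scale[OF lin])
  qed
  moreover have "continuous_on UNIV (\<lambda>x. \<Sum>b\<in>Basis. (v \<bullet> b) *\<^sub>R frechet_derivative f (at x) b)"
    using assms by (intro continuous_intros) auto
  ultimately show ?thesis by simp
qed

lemma test_funE:
  assumes "test_fun S \<eta>"
  obtains K where "compact K" "K \<subseteq> S" "\<And>x. x \<notin> K \<Longrightarrow> \<eta> x = 0"
  using assms unfolding test_fun_def by blast

lemma test_fun_continuous: "test_fun S \<eta> \<Longrightarrow> continuous_on UNIV \<eta>"
  using smooth_on_imp_continuous_on by (auto simp: test_fun_def)

lemma test_fun_derivative_continuous:
  "test_fun S \<eta> \<Longrightarrow> continuous_on UNIV (\<lambda>x. frechet_derivative \<eta> (at x) v)"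
  unfolding test_fun_def smooth_on_def by (blast intro: continuous_on_frechet_derivative)

lemma integrable_test:
  fixes f :: "'a::euclidean_space \<Rightarrow> 'b::{banach, second_countable_topology}"
  assumes "loc_integrable S f" "open S" "test_fun S \<eta>"
  shows "integrable (lebesgue_on S) (\<lambda>x. \<eta> x *\<^sub>R f x)"
  by (rule test_funE[OF assms(3)])
    (rule integrable_test_scaleR[OF assms(1,2) _ _ test_fun_continuous[OF assms(3)]])

lemma integrable_test_derivative:
  fixes f :: "'a::euclidean_space \<Rightarrow> real"
  assumes "loc_integrable S f" "open S" "test_fun S \<eta>"
  shows "integrable (lebesgue_on S) (\<lambda>x. f x * frechet_derivative \<eta> (at x) v)"
proof (rule test_funE[OF assms(3)])
  fix K assume K: "compact K" "K \<subseteq> S" "\<And>x. x \<notin> K \<Longrightarrow> \<eta> x = 0"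
  have "integrable (lebesgue_on S) (\<lambda>x. f x *\<^sub>R frechet_derivative \<eta> (at x) v)"
    by (rule integrable_test_scaleR'[OF assms(1,2) K(1,2) test_fun_derivative_continuous[OF assms(3)]])
      (simp add: frechet_derivative_zero_off_support[OF compact_imp_closed[OF K(1)] K(3)])
  then show ?thesis by simp
qed

text \<open>
  In terms of the real second partial derivatives of \<open>\<eta>\<close>, the complex derivative is visibly continuous
  and supported where \<open>\<eta>\<close> is.
\<close>

lemma dz_dzbar_test:
  fixes \<eta> :: "complex^'k::finite \<Rightarrow> real"
  assumes "smooth_on UNIV \<eta>"
  shows "continuous_on UNIV (dz j (dzbar l (\<lambda>y. of_real (\<eta> y))))"
    and "closed K \<Longrightarrow> (\<And>x. x \<notin> K \<Longrightarrow> \<eta> x = 0) \<Longrightarrow> x \<notin> K \<Longrightarrow> dz j (dzbar l (\<lambda>y. of_real (\<eta> y))) x = 0"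
proof -
  define D where "D b x = frechet_derivative \<eta> (at x) b" for b x
  have C2: "C_on (Suc (Suc 0)) UNIV \<eta>" using assms by (simp only: smooth_on_def)
  have ax: "axis l (1::complex) \<in> Basis" "axis l \<i> \<in> Basis" for l :: 'k
    by (auto simp: axis_in_Basis_iff Basis_complex_def)
  have C1: "C_on (Suc 0) UNIV (D b)" if "b \<in> Basis" for b
    using C2 that unfolding D_def by simp
  have D: "(\<eta> has_derivative (\<lambda>h. D h x)) (at x)" for x
    using C2 by (simp add: D_def differentiable_on_def flip: frechet_derivative_works)
  have 1: "frechet_derivative (\<lambda>y. complex_of_real (\<eta> y)) (at x) = (\<lambda>h. of_real (D h x))" for x
    by (rule frechet_derivative_at[OF has_derivative_of_real[OF D], symmetric])
  have bar: "dzbar l (\<lambda>y. of_real (\<eta> y)) =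
      (\<lambda>x. (of_real (D (axis l 1) x) + \<i> * of_real (D (axis l \<i>) x)) / 2)"
    by (rule ext) (simp add: dzbar_def 1)
  let ?E = "\<lambda>b c x. complex_of_real (frechet_derivative (D b) (at x) c)"
  have E: "(D b has_derivative (\<lambda>h. frechet_derivative (D b) (at x) h)) (at x)" if "b \<in> Basis" for b x
    using C1[OF that] by (simp add: differentiable_on_def flip: frechet_derivative_works)
  have "((\<lambda>x. (of_real (D (axis l 1) x) + \<i> * of_real (D (axis l \<i>) x)) / 2) has_derivative
      (\<lambda>h. (?E (axis l 1) h x + \<i> * ?E (axis l \<i>) h x) / 2)) (at x)" for x
    by (auto intro!: derivative_eq_intros E ax)
  note 2 = frechet_derivative_at[OF this, symmetric]
  have eq: "dz j (dzbar l (\<lambda>y. of_real (\<eta> y))) = (\<lambda>x.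
      ((?E (axis l 1) (axis j 1) x + \<i> * ?E (axis l \<i>) (axis j 1) x) / 2
       - \<i> * ((?E (axis l 1) (axis j \<i>) x + \<i> * ?E (axis l \<i>) (axis j \<i>) x) / 2)) / 2)"
    by (rule ext) (simp add: dz_def bar 2)
  have cont: "continuous_on UNIV (?E b c)" if "b \<in> Basis" for b c
    using continuous_on_frechet_derivative[OF C1[OF that]] by (intro continuous_intros)
  show "continuous_on UNIV (dz j (dzbar l (\<lambda>y. of_real (\<eta> y))))"
    unfolding eq by (intro continuous_intros cont ax) simp_all
  assume K: "closed K" "\<And>x. x \<notin> K \<Longrightarrow> \<eta> x = 0" "x \<notin> K"
  have "D b y = 0" if "y \<notin> K" for b y
    using frechet_derivative_zero_off_support[OF K(1,2) that] by (simp add: D_def)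
  from frechet_derivative_zero_off_support[OF K(1) this K(3)]
  show "dz j (dzbar l (\<lambda>y. of_real (\<eta> y))) x = 0" by (simp add: eq)
qed


section \<open>The current of a potential and of a gradient\<close>

lemma ddc_integrand_integrable:
  fixes U :: "(complex^'k::finite) set"
  assumes "loc_integrable U u" "open U" "test_fun U \<eta>"
  shows "integrable (lebesgue_on U) (\<lambda>x. of_real (u x) * dz j (dzbar l (\<lambda>y. of_real (\<eta> y))) x)"
proof (rule test_funE[OF assms(3)])
  fix K assume K: "compact K" "K \<subseteq> U" "\<And>x. x \<notin> K \<Longrightarrow> \<eta> x = 0"
  have sm: "smooth_on UNIV \<eta>" using assms(3) by (simp add: test_fun_def)
  have "integrable (lebesgue_on U) (\<lambda>x. u x *\<^sub>R dz j (dzbar l (\<lambda>y. of_real (\<eta> y))) x)"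
    by (rule integrable_test_scaleR'[OF assms(1,2) K(1,2) dz_dzbar_test(1)[OF sm]])
       (rule dz_dzbar_test(2)[OF sm compact_imp_closed[OF K(1)] K(3)])
  then show ?thesis by (simp add: scaleR_conv_of_real)
qed

text \<open>
  Local integrability of all three functions makes the integrals additive; almost everywhere
  equality suffices because \<open>ddc\<close> only sees integrals.
\<close>

lemma ddc_lincomb:
  fixes U :: "(complex^'k::finite) set"
  assumes u: "loc_integrable U u" and v: "loc_integrable U v" and w: "loc_integrable U w"
    and eq: "AE x in lebesgue_on U. w x = a * u x + b * v x"
    and U: "open U" and \<eta>: "test_fun U \<eta>"
  shows "ddc \<kappa> U w \<eta> = a *\<^sub>R ddc \<kappa> U u \<eta> + b *\<^sub>R ddc \<kappa> U v \<eta>"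
proof -
  note int = ddc_integrand_integrable[OF u U \<eta>] ddc_integrand_integrable[OF v U \<eta>]
    ddc_integrand_integrable[OF w U \<eta>]
  have "(LINT x|lebesgue_on U. of_real (w x) * dz j (dzbar l (\<lambda>y. of_real (\<eta> y))) x) =
      a *\<^sub>R (LINT x|lebesgue_on U. of_real (u x) * dz j (dzbar l (\<lambda>y. of_real (\<eta> y))) x) +
      b *\<^sub>R (LINT x|lebesgue_on U. of_real (v x) * dz j (dzbar l (\<lambda>y. of_real (\<eta> y))) x)"
    (is "?L = a *\<^sub>R ?A + b *\<^sub>R ?B") for j l
  proof -
    let ?d = "dz j (dzbar l (\<lambda>y. complex_of_real (\<eta> y)))"
    have "?L = (LINT x|lebesgue_on U. a *\<^sub>R (of_real (u x) * ?d x) + b *\<^sub>R (of_real (v x) * ?d x))"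
    proof (rule integral_cong_AE)
      show "AE x in lebesgue_on U. of_real (w x) * ?d x =
          a *\<^sub>R (of_real (u x) * ?d x) + b *\<^sub>R (of_real (v x) * ?d x)"
        using eq by eventually_elim (simp add: scaleR_conv_of_real algebra_simps)
      show "(\<lambda>x. of_real (w x) * ?d x) \<in> borel_measurable (lebesgue_on U)"
        by (rule borel_measurable_integrable[OF int(3)])
      have "integrable (lebesgue_on U) (\<lambda>x. a *\<^sub>R (of_real (u x) * ?d x) + b *\<^sub>R (of_real (v x) * ?d x))"
        using int by simp
      then show "(\<lambda>x. a *\<^sub>R (of_real (u x) * ?d x) + b *\<^sub>R (of_real (v x) * ?d x))
          \<in> borel_measurable (lebesgue_on U)"
        by (rule borel_measurable_integrable)
    qed
    also have "\<dots> = a *\<^sub>R ?A + b *\<^sub>R ?B" using int by simp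
    finally show ?thesis .
  qed
  then show ?thesis
    by (simp add: vec_eq_iff ddc_def distrib_left)
qed

lemma hform_add: "hform (A + B) u v = hform A u v + hform B u v"
  by (simp add: hform_def sum.distrib distrib_right)

lemma hform_diff: "hform (A - B) u v = hform A u v - hform B u v"
  by (simp add: hform_def sum_subtractf left_diff_distrib)

lemma hform_scaleR: "hform (r *\<^sub>R A) u v = r *\<^sub>R hform A u v"
  by (simp add: hform_def scaleR_sum_right)

lemma Re_hform_linear: "linear (\<lambda>A. Re (hform A a a))"
  by (rule linearI) (simp_all add: hform_add hform_scaleR)

lemma Re_hform_bounded_linear: "bounded_linear (\<lambda>A. Re (hform A a a))"
  using Re_hform_linear by (simp add: linear_conv_bounded_linear)

text \<open>
  The form has rank one: it is the square of the modulus of a linear functional.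
\<close>

lemma Re_hform_grad_form:
  fixes v :: "complex^'k::finite"
  shows "Re (hform (grad_form \<kappa> v) a a) = \<kappa> / 4 * (cmod (\<Sum>j\<in>UNIV. a $ j * cnj (v $ j)))\<^sup>2"
proof -
  let ?s = "\<Sum>j\<in>UNIV. a $ j * cnj (v $ j)"
  have "hform (grad_form \<kappa> v) a a = (\<Sum>j\<in>UNIV. \<Sum>l\<in>UNIV.
      of_real (\<kappa> / 4) * ((a $ j * cnj (v $ j)) * cnj (a $ l * cnj (v $ l))))"
    by (simp add: hform_def grad_form_def ac_simps)
  also have "\<dots> = of_real (\<kappa> / 4) * (?s * cnj ?s)"
    unfolding cnj_sum sum_product by (simp only: sum_distrib_left)
  also have "\<dots> = of_real (\<kappa> / 4 * (cmod ?s)\<^sup>2)" by (simp only: complex_norm_square of_real_mult)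
  finally show ?thesis by (simp only: Re_complex_of_real)
qed

text \<open>
  The pointwise version of \<open>d(f+g) \<and> d\<^sup>c(f+g) \<le> 2 (df \<and> d\<^sup>cf + dg \<and> d\<^sup>cg)\<close>.
\<close>

lemma Re_hform_grad_form_add_le:
  fixes v w :: "complex^'k::finite"
  assumes "0 \<le> \<kappa>"
  shows "Re (hform (grad_form \<kappa> (v + w)) a a)
    \<le> 2 * Re (hform (grad_form \<kappa> v) a a) + 2 * Re (hform (grad_form \<kappa> w) a a)"
proof -
  define s where "s v = (\<Sum>j\<in>UNIV. a $ j * cnj (v $ j))" for v :: "complex^'k"
  have "s (v + w) = s v + s w" by (simp add: s_def algebra_simps sum.distrib)
  then have "(cmod (s (v + w)))\<^sup>2 \<le> (cmod (s v) + cmod (s w))\<^sup>2"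
    by (intro power_mono) (auto intro: norm_triangle_ineq)
  also have "\<dots> \<le> 2 * (cmod (s v))\<^sup>2 + 2 * (cmod (s w))\<^sup>2"
    using sum_squares_bound[of "cmod (s v)" "cmod (s w)"] by (simp add: power2_sum)
  finally have "\<kappa> / 4 * (cmod (s (v + w)))\<^sup>2 \<le> \<kappa> / 4 * (2 * (cmod (s v))\<^sup>2 + 2 * (cmod (s w))\<^sup>2)"
    using assms by (intro mult_left_mono) auto
  then show ?thesis unfolding Re_hform_grad_form s_def[symmetric] by (simp add: algebra_simps)
qed

lemma grad_form_scale: "grad_form \<kappa> (t *\<^sub>R v) = t\<^sup>2 *\<^sub>R grad_form \<kappa> v"
  by (simp add: grad_form_def vec_eq_iff power2_eq_square)

text \<open>
  Needed only to see that a square integrable gradient has an integrable form; the constant is not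
  sharp.
\<close>

lemma norm_grad_form_le:
  fixes v :: "complex^'k::finite"
  shows "norm (grad_form \<kappa> v) \<le> (real CARD('k))\<^sup>2 * \<bar>\<kappa>\<bar> * (norm v)\<^sup>2"
proof -
  have entry: "norm (grad_form \<kappa> v $ j $ l) \<le> \<bar>\<kappa>\<bar> * (norm v)\<^sup>2" for j l
  proof -
    have "norm (grad_form \<kappa> v $ j $ l) = \<bar>\<kappa>\<bar> / 4 * (norm (v $ j) * norm (v $ l))"
      by (simp add: grad_form_def norm_mult norm_divide)
    also have "\<dots> \<le> \<bar>\<kappa>\<bar> / 4 * (norm v * norm v)"
      by (intro mult_left_mono mult_mono Finite_Cartesian_Product.norm_nth_le) auto
    also have "\<dots> \<le> \<bar>\<kappa>\<bar> * (norm v)\<^sup>2" by (simp add: power2_eq_square)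
    finally show ?thesis .
  qed
  have "norm (grad_form \<kappa> v) \<le> (\<Sum>j\<in>UNIV. norm (grad_form \<kappa> v $ j))"
    unfolding norm_vec_def[of "grad_form \<kappa> v"] by (rule L2_set_le_sum) simp
  also have "\<dots> \<le> (\<Sum>j\<in>UNIV. \<Sum>l\<in>UNIV. norm (grad_form \<kappa> v $ j $ l))"
  proof (rule sum_mono)
    fix j
    show "norm (grad_form \<kappa> v $ j) \<le> (\<Sum>l\<in>UNIV. norm (grad_form \<kappa> v $ j $ l))"
      unfolding norm_vec_def[of "grad_form \<kappa> v $ j"] by (rule L2_set_le_sum) simp
  qed
  also have "\<dots> \<le> (\<Sum>j\<in>(UNIV::'k set). \<Sum>l\<in>(UNIV::'k set). \<bar>\<kappa>\<bar> * (norm v)\<^sup>2)"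
    by (intro sum_mono entry)
  also have "\<dots> = (real CARD('k))\<^sup>2 * \<bar>\<kappa>\<bar> * (norm v)\<^sup>2" by (simp add: power2_eq_square)
  finally show ?thesis .
qed

lemma continuous_grad_form: "continuous_on UNIV (grad_form \<kappa>)"
  unfolding grad_form_def by (intro continuous_intros) simp

lemma loc_integrable_grad_form:
  fixes G :: "complex^'k::finite \<Rightarrow> complex^'k"
  assumes "loc_integrable U G" "loc_integrable U (\<lambda>x. (norm (G x))\<^sup>2)"
  shows "loc_integrable U (\<lambda>x. grad_form \<kappa> (G x))"
  unfolding loc_integrable_def
proof (intro allI impI)
  fix K assume "compact K \<and> K \<subseteq> U"
  with assms have G: "integrable (lebesgue_on K) G" "integrable (lebesgue_on K) (\<lambda>x. (norm (G x))\<^sup>2)"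
    by (simp_all add: loc_integrable_def)
  let ?C = "(real CARD('k))\<^sup>2 * \<bar>\<kappa>\<bar>"
  show "integrable (lebesgue_on K) (\<lambda>x. grad_form \<kappa> (G x))"
  proof (rule Bochner_Integration.integrable_bound)
    show "integrable (lebesgue_on K) (\<lambda>x. ?C * (norm (G x))\<^sup>2)" using G(2) by simp
    show "(\<lambda>x. grad_form \<kappa> (G x)) \<in> borel_measurable (lebesgue_on K)"
      by (rule measurable_compose[OF borel_measurable_integrable[OF G(1)]
            borel_measurable_continuous_onI[OF continuous_grad_form]])
    show "AE x in lebesgue_on K. norm (grad_form \<kappa> (G x)) \<le> norm (?C * (norm (G x))\<^sup>2)"
      using norm_grad_form_le[of \<kappa>] by (intro AE_I2) (simp add: abs_mult)
  qed
qed

lemma Re_hform_form_current: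
  assumes "loc_integrable U A" "open U" "test_fun U \<eta>"
  shows "Re (hform (form_current U A \<eta>) a a) = (LINT x|lebesgue_on U. \<eta> x * Re (hform (A x) a a))"
    and "integrable (lebesgue_on U) (\<lambda>x. \<eta> x * Re (hform (A x) a a))"
proof -
  note int = integrable_test[OF assms]
  have eq: "Re (hform (\<eta> x *\<^sub>R A x) a a) = \<eta> x * Re (hform (A x) a a)" for x
    by (simp add: hform_scaleR)
  show "Re (hform (form_current U A \<eta>) a a) = (LINT x|lebesgue_on U. \<eta> x * Re (hform (A x) a a))"
    using integral_bounded_linear[OF Re_hform_bounded_linear[of a] int]
    by (simp add: form_current_def eq)
  show "integrable (lebesgue_on U) (\<lambda>x. \<eta> x * Re (hform (A x) a a))"
    using integrable_bounded_linear[OF Re_hform_bounded_linear[of a] int] by (simp add: eq)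
qed

section \<open>Weak gradients\<close>

lemma weak_gradient_add:
  fixes U :: "'a::euclidean_space set"
  assumes U: "open U" and f: "weak_gradient U f F" and g: "weak_gradient U g G"
  shows "weak_gradient U (\<lambda>x. f x + g x) (\<lambda>x. F x + G x)"
  unfolding weak_gradient_def
proof (intro conjI allI impI)
  note fi = f[unfolded weak_gradient_def] and gi = g[unfolded weak_gradient_def]
  show "loc_integrable U (\<lambda>x. f x + g x)" "loc_integrable U (\<lambda>x. F x + G x)"
    using fi gi by (auto intro: loc_integrable_add)
  fix \<eta> :: "'a \<Rightarrow> real" and v :: 'a assume \<eta>: "test_fun U \<eta>"
  have dot: "integrable (lebesgue_on U) (\<lambda>x. \<eta> x * (H x \<bullet> v))" if "loc_integrable U H" for H
    using integrable_inner_left[of v, OF integrable_test[OF that U \<eta>]] by simp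
  show "(LINT x|lebesgue_on U. (f x + g x) * frechet_derivative \<eta> (at x) v) =
      - (LINT x|lebesgue_on U. \<eta> x * ((F x + G x) \<bullet> v))"
    using fi gi \<eta> integrable_test_derivative[OF _ U \<eta>, of f v]
      integrable_test_derivative[OF _ U \<eta>, of g v] dot[of F] dot[of G]
    by (simp add: distrib_right distrib_left inner_add_left)
qed

lemma weak_gradient_scale:
  fixes U :: "'a::euclidean_space set"
  assumes f: "weak_gradient U f F"
  shows "weak_gradient U (\<lambda>x. t * f x) (\<lambda>x. t *\<^sub>R F x)"
  unfolding weak_gradient_def
proof (intro conjI allI impI)
  note fi = f[unfolded weak_gradient_def]
  show "loc_integrable U (\<lambda>x. t * f x)" using fi by (auto intro: loc_integrable_mult)
  show "loc_integrable U (\<lambda>x. t *\<^sub>R F x)" using fi by (auto intro: loc_integrable_scaleR)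
  fix \<eta> v assume "test_fun U \<eta>"
  then have "(LINT x|lebesgue_on U. f x * frechet_derivative \<eta> (at x) v) =
      - (LINT x|lebesgue_on U. \<eta> x * (F x \<bullet> v))" using fi by blast
  then have "t * (LINT x|lebesgue_on U. f x * frechet_derivative \<eta> (at x) v) =
      - (t * (LINT x|lebesgue_on U. \<eta> x * (F x \<bullet> v)))" by simp
  then show "(LINT x|lebesgue_on U. (t * f x) * frechet_derivative \<eta> (at x) v) =
      - (LINT x|lebesgue_on U. \<eta> x * ((t *\<^sub>R F x) \<bullet> v))"
    by (simp add: mult.assoc mult.left_commute flip: integral_mult_right_zero)
qed

lemma weak_gradient_AE:
  fixes U :: "'a::euclidean_space set"
  assumes U: "open U" and f: "weak_gradient U f F" and eq: "AE x in lebesgue_on U. f x = g x"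
  shows "weak_gradient U g F"
  unfolding weak_gradient_def
proof (intro conjI allI impI)
  note fi = f[unfolded weak_gradient_def]
  show g: "loc_integrable U g" using loc_integrable_AE[OF _ eq U] fi by blast
  show "loc_integrable U F" using fi by blast
  fix \<eta> v assume \<eta>: "test_fun U \<eta>"
  have "(LINT x|lebesgue_on U. f x * frechet_derivative \<eta> (at x) v) =
      (LINT x|lebesgue_on U. g x * frechet_derivative \<eta> (at x) v)"
  proof (rule integral_cong_AE)
    show "(\<lambda>x. f x * frechet_derivative \<eta> (at x) v) \<in> borel_measurable (lebesgue_on U)"
      using fi by (intro borel_measurable_integrable integrable_test_derivative[OF _ U \<eta>]) blast
    show "(\<lambda>x. g x * frechet_derivative \<eta> (at x) v) \<in> borel_measurable (lebesgue_on U)"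
      by (intro borel_measurable_integrable integrable_test_derivative[OF g U \<eta>])
    show "AE x in lebesgue_on U. f x * frechet_derivative \<eta> (at x) v = g x * frechet_derivative \<eta> (at x) v"
      using eq by eventually_elim simp
  qed
  then show "(LINT x|lebesgue_on U. g x * frechet_derivative \<eta> (at x) v) =
      - (LINT x|lebesgue_on U. \<eta> x * (F x \<bullet> v))" using fi \<eta> by simp
qed

lemma weak_gradient_zero: "weak_gradient U (\<lambda>x. 0) (\<lambda>x. 0)"
  by (simp add: weak_gradient_def loc_integrable_def)

section \<open>Sums and multiples in the energy inequality\<close>

text \<open>
  The current \<open>R\<close> has to agree with \<open>2 S + 2 T\<close> on test functions only: on other arguments the
  integrals that define currents need not converge.
\<close>

lemma d_wedge_dc_le_add:
  fixes U :: "(complex^'k::finite) set"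
  assumes U: "open U" and \<kappa>: "0 \<le> \<kappa>"
    and f: "d_wedge_dc_le \<kappa> U f S" and g: "d_wedge_dc_le \<kappa> U g T"
    and R: "\<And>\<eta>. test_fun U \<eta> \<Longrightarrow> R \<eta> = 2 *\<^sub>R S \<eta> + 2 *\<^sub>R T \<eta>"
  shows "d_wedge_dc_le \<kappa> U (\<lambda>x. f x + g x) R"
proof -
  obtain F where F: "weak_gradient U f F" "loc_integrable U (\<lambda>x. (norm (F x))\<^sup>2)"
    "current_le U (form_current U (\<lambda>x. grad_form \<kappa> (F x))) S"
    using f unfolding d_wedge_dc_le_def by blast
  obtain G where G: "weak_gradient U g G" "loc_integrable U (\<lambda>x. (norm (G x))\<^sup>2)"
    "current_le U (form_current U (\<lambda>x. grad_form \<kappa> (G x))) T"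
    using g unfolding d_wedge_dc_le_def by blast
  have li: "loc_integrable U F" "loc_integrable U G" using F G by (auto simp: weak_gradient_def)
  have sq: "loc_integrable U (\<lambda>x. (norm (F x + G x))\<^sup>2)"
    by (rule loc_integrable_square_sum[OF li F(2) G(2)])
  note gf = loc_integrable_grad_form[OF li(1) F(2), of \<kappa>] loc_integrable_grad_form[OF li(2) G(2), of \<kappa>]
    loc_integrable_grad_form[OF loc_integrable_add[OF li] sq, of \<kappa>]
  have "current_le U (form_current U (\<lambda>x. grad_form \<kappa> (F x + G x))) R"
    unfolding current_le_def
  proof (intro allI impI, elim conjE)
    fix \<eta> :: "complex^'k \<Rightarrow> real" and a :: "complex^'k" assume \<eta>: "test_fun U \<eta>" and nn: "\<forall>x. 0 \<le> \<eta> x"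
    let ?h = "\<lambda>A. Re (hform A a a)"
    let ?I = "\<lambda>H. LINT x|lebesgue_on U. \<eta> x * ?h (grad_form \<kappa> (H x))"
    note hf = Re_hform_form_current[OF gf(1) U \<eta>] Re_hform_form_current[OF gf(2) U \<eta>]
      Re_hform_form_current[OF gf(3) U \<eta>]
    have "?I (\<lambda>x. F x + G x) \<le> (LINT x|lebesgue_on U.
        2 * (\<eta> x * ?h (grad_form \<kappa> (F x))) + 2 * (\<eta> x * ?h (grad_form \<kappa> (G x))))"
    proof (rule integral_mono)
      fix x
      show "\<eta> x * ?h (grad_form \<kappa> (F x + G x)) \<le>
          2 * (\<eta> x * ?h (grad_form \<kappa> (F x))) + 2 * (\<eta> x * ?h (grad_form \<kappa> (G x)))"
        using mult_left_mono[OF Re_hform_grad_form_add_le[OF \<kappa>, of "F x" "G x" a], of "\<eta> x"] nn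
        by (simp add: algebra_simps)
    qed (use hf in auto)
    also have "\<dots> = 2 * ?I F + 2 * ?I G" using hf by simp
    finally have le: "?I (\<lambda>x. F x + G x) \<le> 2 * ?I F + 2 * ?I G" .
    have lin: "?h (A - B) = ?h A - ?h B" "?h (A + B) = ?h A + ?h B" "?h (t *\<^sub>R A) = t * ?h A" for A B t
      by (simp_all add: hform_diff hform_add hform_scaleR)
    have "0 \<le> ?h (S \<eta> - form_current U (\<lambda>x. grad_form \<kappa> (F x)) \<eta>)"
      "0 \<le> ?h (T \<eta> - form_current U (\<lambda>x. grad_form \<kappa> (G x)) \<eta>)"
      using F(3) G(3) \<eta> nn unfolding current_le_def by blast+
    then have "?I F \<le> ?h (S \<eta>)" "?I G \<le> ?h (T \<eta>)" by (simp_all add: lin hf)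
    with le show "0 \<le> ?h (R \<eta> - form_current U (\<lambda>x. grad_form \<kappa> (F x + G x)) \<eta>)"
      by (simp add: lin hf R[OF \<eta>])
  qed
  then show ?thesis
    unfolding d_wedge_dc_le_def using weak_gradient_add[OF U F(1) G(1)] sq by blast
qed

lemma d_wedge_dc_le_scale:
  fixes U :: "(complex^'k::finite) set"
  assumes f: "d_wedge_dc_le \<kappa> U f S"
    and R: "\<And>\<eta>. test_fun U \<eta> \<Longrightarrow> R \<eta> = t\<^sup>2 *\<^sub>R S \<eta>"
  shows "d_wedge_dc_le \<kappa> U (\<lambda>x. t * f x) R"
proof -
  obtain F where F: "weak_gradient U f F" "loc_integrable U (\<lambda>x. (norm (F x))\<^sup>2)"
    "current_le U (form_current U (\<lambda>x. grad_form \<kappa> (F x))) S"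
    using f unfolding d_wedge_dc_le_def by blast
  have eq: "form_current U (\<lambda>x. grad_form \<kappa> (t *\<^sub>R F x)) \<eta> = t\<^sup>2 *\<^sub>R form_current U (\<lambda>x. grad_form \<kappa> (F x)) \<eta>" for \<eta>
    unfolding form_current_def grad_form_scale by (subst scaleR_left_commute) (rule integral_scaleR_right)
  have "current_le U (form_current U (\<lambda>x. grad_form \<kappa> (t *\<^sub>R F x))) R"
    unfolding current_le_def
  proof (intro allI impI, elim conjE)
    fix \<eta> :: "complex^'k \<Rightarrow> real" and a :: "complex^'k" assume \<eta>: "test_fun U \<eta>" and nn: "\<forall>x. 0 \<le> \<eta> x"
    have "R \<eta> - form_current U (\<lambda>x. grad_form \<kappa> (t *\<^sub>R F x)) \<eta> =
        t\<^sup>2 *\<^sub>R (S \<eta> - form_current U (\<lambda>x. grad_form \<kappa> (F x)) \<eta>)"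
      by (simp add: R[OF \<eta>] eq scaleR_right_diff_distrib)
    then show "0 \<le> Re (hform (R \<eta> - form_current U (\<lambda>x. grad_form \<kappa> (t *\<^sub>R F x)) \<eta>) a a)"
      using F(3) \<eta> nn by (simp add: current_le_def hform_scaleR)
  qed
  moreover have "loc_integrable U (\<lambda>x. (norm (t *\<^sub>R F x))\<^sup>2)"
    using loc_integrable_mult[OF F(2), of "t\<^sup>2"] by (simp add: power_mult_distrib)
  ultimately show ?thesis
    unfolding d_wedge_dc_le_def using weak_gradient_scale[OF F(1)] by blast
qed

lemma d_wedge_dc_le_AE:
  "open U \<Longrightarrow> d_wedge_dc_le \<kappa> U f T \<Longrightarrow> AE x in lebesgue_on U. f x = g x \<Longrightarrow> d_wedge_dc_le \<kappa> U g T"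
  unfolding d_wedge_dc_le_def by (blast intro: weak_gradient_AE)

lemma d_wedge_dc_le_zero:
  fixes U :: "(complex^'k::finite) set"
  assumes "\<And>\<eta>. T \<eta> = 0"
  shows "d_wedge_dc_le \<kappa> U (\<lambda>x. 0) T"
proof -
  have "grad_form \<kappa> (0 :: complex^'k) = 0" by (simp add: grad_form_def vec_eq_iff)
  then have "current_le U (form_current U (\<lambda>x. grad_form \<kappa> 0)) T"
    by (simp add: current_le_def form_current_def assms hform_def)
  then show ?thesis
    unfolding d_wedge_dc_le_def
    by (intro exI[of _ "\<lambda>x. 0"] conjI weak_gradient_zero) (simp_all add: loc_integrable_def)
qed

section \<open>The Sobolev space of an open set\<close>

text \<open>
  An open set is a countable union of compact sets.
\<close>

lemma loc_integrable_imp_measurable: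
  fixes f :: "'a::euclidean_space \<Rightarrow> 'b::{banach, second_countable_topology}"
  assumes "loc_integrable S f" "open S"
  shows "f \<in> borel_measurable (lebesgue_on S)"
proof -
  obtain C :: "nat \<Rightarrow> 'a set" where C: "\<And>n. compact (C n)" "\<And>n. C n \<subseteq> S" "\<Union>(range C) = S"
    using open_Union_compact_subsets[OF assms(2)] by metis
  note S = open_lebesgue_sets[OF assms(2)] and CK = compact_lebesgue_sets[OF C(1)]
  show ?thesis
  proof (rule measurable_piecewise_restrict[of "range C"])
    fix K assume "K \<in> range C"
    then obtain n where n: "K = C n" by blast
    show "K \<inter> space (lebesgue_on S) \<in> sets (lebesgue_on S)"
      using S CK[of n] C(2)[of n] by (auto simp: n sets_restrict_space_iff)
    have "restrict_space (lebesgue_on S) K = lebesgue_on K"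
      using S CK[of n] C(2)[of n] by (simp add: n restrict_restrict_space Int_absorb1)
    moreover have "integrable (lebesgue_on K) f"
      using assms(1) C by (simp add: loc_integrable_def n)
    ultimately show "f \<in> borel_measurable (restrict_space (lebesgue_on S) K)"
      by (simp add: borel_measurable_integrable)
  qed (use C(3) in auto)
qed

lemma W12_zero: "(\<lambda>x. 0) \<in> W12 S"
  using weak_gradient_zero[of S] by (auto simp: W12_def intro!: exI[of _ "\<lambda>x. 0"])

lemma W12_add:
  assumes S: "open S" and f: "f \<in> W12 S" and g: "g \<in> W12 S"
  shows "(\<lambda>x. f x + g x) \<in> W12 S"
proof -
  obtain F G where F: "weak_gradient S f F" "integrable (lebesgue_on S) (\<lambda>x. (norm (F x))\<^sup>2)"
    and G: "weak_gradient S g G" "integrable (lebesgue_on S) (\<lambda>x. (norm (G x))\<^sup>2)"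
    using f g by (auto simp: W12_def)
  have "F \<in> borel_measurable (lebesgue_on S)" "G \<in> borel_measurable (lebesgue_on S)"
    using F(1) G(1) S by (auto simp: weak_gradient_def intro: loc_integrable_imp_measurable)
  then have "integrable (lebesgue_on S) (\<lambda>x. (norm (F x + G x))\<^sup>2)"
    using F(2) G(2) by (rule integrable_square_sum)
  moreover have "integrable (lebesgue_on S) (\<lambda>x. (norm (f x + g x))\<^sup>2)"
    using f g by (intro integrable_square_sum) (auto simp: W12_def)
  ultimately show ?thesis
    using f g weak_gradient_add[OF S F(1) G(1)] by (auto simp: W12_def)
qed

lemma W12_scale: "f \<in> W12 S \<Longrightarrow> (\<lambda>x. t * f x) \<in> W12 S"
proof -
  assume f: "f \<in> W12 S"
  then obtain F where F: "weak_gradient S f F" "integrable (lebesgue_on S) (\<lambda>x. (norm (F x))\<^sup>2)"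
    by (auto simp: W12_def)
  have "integrable (lebesgue_on S) (\<lambda>x. (norm (t *\<^sub>R F x))\<^sup>2)"
    using F(2) by (simp add: power_mult_distrib)
  with f weak_gradient_scale[OF F(1), of t] show ?thesis
    by (auto simp: W12_def power_mult_distrib)
qed

lemma W12_AE:
  assumes S: "open S" and f: "f \<in> W12 S" and eq: "AE x in lebesgue_on S. f x = g x"
  shows "g \<in> W12 S"
proof -
  interpret complete_measure "lebesgue_on S"
    by (rule complete_measure_lebesgue_on[OF open_lebesgue_sets[OF S]])
  obtain F where F: "weak_gradient S f F" "integrable (lebesgue_on S) (\<lambda>x. (norm (F x))\<^sup>2)"
    using f by (auto simp: W12_def)
  have f': "f \<in> borel_measurable (lebesgue_on S)" "integrable (lebesgue_on S) (\<lambda>x. (f x)\<^sup>2)"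
    using f by (simp_all add: W12_def)
  have "AE x in lebesgue_on S. (f x)\<^sup>2 = (g x)\<^sup>2" using eq by eventually_elim simp
  note g = integrable_AE_cong[OF f'(2) this] borel_measurable_AE_cong[OF f'(1) eq]
  show ?thesis using weak_gradient_AE[OF S F(1) eq] F(2) g unfolding W12_def by blast
qed

section \<open>The mass of a potential\<close>

lemma test_fun_zero: "test_fun S (\<lambda>_. 0)"
  by (auto simp: test_fun_def smooth_on_const intro: exI[of _ "{}"])

lemma ddc_test_zero:
  fixes U :: "(complex^'k::finite) set"
  shows "ddc \<kappa> U u (\<lambda>_. 0) = 0"
proof -
  have "dzbar l (\<lambda>y. complex_of_real 0) = (\<lambda>_. 0)" for l :: 'k by (rule ext) (simp add: dzbar_def)
  then show ?thesis by (simp add: ddc_def vec_eq_iff dz_def)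
qed

lemma ddc_zero: "ddc \<kappa> U (\<lambda>x. 0) \<eta> = 0"
  by (simp add: ddc_def vec_eq_iff)

lemma ddc_mass_nonneg: "0 \<le> ddc_mass \<kappa> \<Omega> u"
  unfolding ddc_mass_def
  by (rule SUP_upper2[of "\<lambda>_. 0"]) (simp_all add: test_fun_zero ddc_test_zero trace_def)

lemma ddc_mass_upper:
  fixes \<Omega> :: "(complex^'k::finite) set"
  assumes "ddc_mass \<kappa> \<Omega> u < \<infinity>" "test_fun \<Omega> \<eta>" "\<forall>x. 0 \<le> \<eta> x \<and> \<eta> x \<le> 1"
  shows "\<kappa> ^ (CARD('k) - 1) * fact (CARD('k) - 1) * 2 ^ CARD('k) * Re (trace (ddc \<kappa> \<Omega> u \<eta>))
    \<le> real_of_ereal (ddc_mass \<kappa> \<Omega> u)"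
proof -
  obtain m where m: "ddc_mass \<kappa> \<Omega> u = ereal m"
    using assms(1) ddc_mass_nonneg[of \<kappa> \<Omega> u] by (cases "ddc_mass \<kappa> \<Omega> u") auto
  have "ereal (\<kappa> ^ (CARD('k) - 1) * fact (CARD('k) - 1) * 2 ^ CARD('k) * Re (trace (ddc \<kappa> \<Omega> u \<eta>)))
      \<le> ddc_mass \<kappa> \<Omega> u"
    unfolding ddc_mass_def by (rule SUP_upper) (use assms in simp)
  then show ?thesis by (simp add: m)
qed

text \<open>
  A supremum of sums is at most the sum of the suprema.
\<close>

lemma ddc_mass_lincomb_le:
  fixes \<Omega> :: "(complex^'k::finite) set"
  assumes eq: "\<And>\<eta>. test_fun \<Omega> \<eta> \<Longrightarrow> ddc \<kappa> \<Omega> w \<eta> = a *\<^sub>R ddc \<kappa> \<Omega> u \<eta> + b *\<^sub>R ddc \<kappa> \<Omega> v \<eta>"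
    and ab: "0 \<le> a" "0 \<le> b" and fin: "ddc_mass \<kappa> \<Omega> u < \<infinity>" "ddc_mass \<kappa> \<Omega> v < \<infinity>"
  shows "ddc_mass \<kappa> \<Omega> w < \<infinity>"
    and "real_of_ereal (ddc_mass \<kappa> \<Omega> w) \<le>
      a * real_of_ereal (ddc_mass \<kappa> \<Omega> u) + b * real_of_ereal (ddc_mass \<kappa> \<Omega> v)"
proof -
  let ?C = "\<kappa> ^ (CARD('k) - 1) * fact (CARD('k) - 1) * 2 ^ CARD('k)"
  let ?B = "a * real_of_ereal (ddc_mass \<kappa> \<Omega> u) + b * real_of_ereal (ddc_mass \<kappa> \<Omega> v)"
  have "ddc_mass \<kappa> \<Omega> w \<le> ereal ?B"
    unfolding ddc_mass_def[of _ _ w]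
  proof (rule SUP_least)
    fix \<eta> :: "complex^'k \<Rightarrow> real"
    assume "\<eta> \<in> {\<eta>. test_fun \<Omega> \<eta> \<and> (\<forall>x. 0 \<le> \<eta> x \<and> \<eta> x \<le> 1)}"
    then have \<eta>: "test_fun \<Omega> \<eta>" "\<forall>x. 0 \<le> \<eta> x \<and> \<eta> x \<le> 1" by auto
    have "?C * Re (trace (ddc \<kappa> \<Omega> w \<eta>)) =
        a * (?C * Re (trace (ddc \<kappa> \<Omega> u \<eta>))) + b * (?C * Re (trace (ddc \<kappa> \<Omega> v \<eta>)))"
      by (simp add: eq[OF \<eta>(1)] trace_def sum.distrib sum_distrib_left algebra_simps)
    also have "\<dots> \<le> ?B"
      using ab \<eta> fin by (intro add_mono mult_left_mono ddc_mass_upper)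
    finally show "ereal (?C * Re (trace (ddc \<kappa> \<Omega> w \<eta>))) \<le> ereal ?B" by simp
  qed
  then show "ddc_mass \<kappa> \<Omega> w < \<infinity>" "real_of_ereal (ddc_mass \<kappa> \<Omega> w) \<le> ?B"
    using ddc_mass_nonneg[of \<kappa> \<Omega> w] by (cases "ddc_mass \<kappa> \<Omega> w"; auto)+
qed

section \<open>The local setting\<close>

definition local_relation ::
  "real \<Rightarrow> (complex^'k::finite) set \<Rightarrow> (complex^'k \<Rightarrow> real) \<Rightarrow> real \<Rightarrow> (complex^'k \<Rightarrow> real) \<Rightarrow> bool" where
  "local_relation \<kappa> \<Omega> f c h \<longleftrightarrow> (\<exists>\<psi>. psh_on \<Omega> \<psi> \<and> h = real_of_ereal \<circ> \<psi> \<and>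
     ddc_mass \<kappa> \<Omega> h < \<infinity> \<and> c = real_of_ereal (ddc_mass \<kappa> \<Omega> h) \<and>
     d_wedge_dc_le \<kappa> \<Omega> f (ddc \<kappa> \<Omega> h))"

lemma psh_on_lincomb:
  fixes u v :: "complex^'k::finite \<Rightarrow> ereal"
  assumes "psh_on U u" "psh_on U v" "0 \<le> a" "0 \<le> b"
  shows "psh_on U (\<lambda>x. ereal a * u x + ereal b * v x)"
  using assms by (intro psh_on_add psh_on_cmult)

lemma psh_lincomb_AE:
  fixes u v :: "complex^'k::finite \<Rightarrow> ereal"
  assumes "psh_on U u" "psh_on U v"
  shows "AE x in lebesgue_on U. real_of_ereal (ereal a * u x + ereal b * v x) =
    a * real_of_ereal (u x) + b * real_of_ereal (v x)"
  using psh_AE_finite[OF assms(1)] psh_AE_finite[OF assms(2)]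
proof eventually_elim
  fix x assume "\<bar>u x\<bar> \<noteq> \<infinity>" "\<bar>v x\<bar> \<noteq> \<infinity>"
  then show "real_of_ereal (ereal a * u x + ereal b * v x) = a * real_of_ereal (u x) + b * real_of_ereal (v x)"
    by (cases "u x"; cases "v x") auto
qed

text \<open>
  The common part of \<open>S_add\<close> (with \<open>a = b = 2\<close>) and \<open>S_scale\<close> (with \<open>a = t\<^sup>2\<close>, \<open>b = 0\<close>):
  the combination of the potentials is again a potential. The hypothesis \<open>le\<close> isolates the energy
  inequality for the new function, the only point where the two cases differ.
\<close>

lemma local_relation_lincomb:
  fixes \<Omega> :: "(complex^'k::finite) set"
  assumes \<Omega>: "open \<Omega>" and h: "local_relation \<kappa> \<Omega> f c h" and k: "local_relation \<kappa> \<Omega> g d k"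
    and ab: "0 \<le> a" "0 \<le> b"
    and le: "\<And>l. (\<And>\<eta>. test_fun \<Omega> \<eta> \<Longrightarrow> ddc \<kappa> \<Omega> l \<eta> = a *\<^sub>R ddc \<kappa> \<Omega> h \<eta> + b *\<^sub>R ddc \<kappa> \<Omega> k \<eta>) \<Longrightarrow>
      d_wedge_dc_le \<kappa> \<Omega> \<phi> (ddc \<kappa> \<Omega> l)"
  shows "\<exists>e l. local_relation \<kappa> \<Omega> \<phi> e l \<and> e \<le> a * c + b * d \<and>
    (AE x in lebesgue_on \<Omega>. l x = a * h x + b * k x)"
proof -
  obtain \<psi> where \<psi>: "psh_on \<Omega> \<psi>" "h = real_of_ereal \<circ> \<psi>" "ddc_mass \<kappa> \<Omega> h < \<infinity>"
    "c = real_of_ereal (ddc_mass \<kappa> \<Omega> h)" using h by (auto simp: local_relation_def)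
  obtain \<rho> where \<rho>: "psh_on \<Omega> \<rho>" "k = real_of_ereal \<circ> \<rho>" "ddc_mass \<kappa> \<Omega> k < \<infinity>"
    "d = real_of_ereal (ddc_mass \<kappa> \<Omega> k)" using k by (auto simp: local_relation_def)
  define \<xi> where "\<xi> x = ereal a * \<psi> x + ereal b * \<rho> x" for x
  have \<xi>: "psh_on \<Omega> \<xi>"
    using psh_on_lincomb[OF \<psi>(1) \<rho>(1) ab] by (simp add: \<xi>_def[abs_def])
  define l where "l = real_of_ereal \<circ> \<xi>"
  have ae: "AE x in lebesgue_on \<Omega>. l x = a * h x + b * k x"
    using psh_lincomb_AE[OF \<psi>(1) \<rho>(1), of a b] by (simp add: l_def \<xi>_def \<psi>(2) \<rho>(2))
  have dd: "ddc \<kappa> \<Omega> l \<eta> = a *\<^sub>R ddc \<kappa> \<Omega> h \<eta> + b *\<^sub>R ddc \<kappa> \<Omega> k \<eta>" if "test_fun \<Omega> \<eta>" for \<eta>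
    using psh_loc_integrable[OF \<psi>(1)] psh_loc_integrable[OF \<rho>(1)] psh_loc_integrable[OF \<xi>]
    by (intro ddc_lincomb[OF _ _ _ ae \<Omega> that]) (simp_all add: \<psi>(2) \<rho>(2) l_def comp_def)
  have "local_relation \<kappa> \<Omega> \<phi> (real_of_ereal (ddc_mass \<kappa> \<Omega> l)) l"
    unfolding local_relation_def
    using \<xi> ddc_mass_lincomb_le(1)[OF dd ab \<psi>(3) \<rho>(3)] le[OF dd] by (auto simp: l_def)
  then show ?thesis
    using ae ddc_mass_lincomb_le(2)[OF dd ab \<psi>(3) \<rho>(3)] by (auto simp: \<psi>(4) \<rho>(4))
qed

lemma local_energy_relation:
  fixes \<Omega> :: "(complex^'k::finite) set"
  assumes \<Omega>: "open \<Omega>" and \<kappa>: "0 \<le> \<kappa>"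
  shows "energy_relation (lebesgue_on \<Omega>) (W12 \<Omega>) (local_relation \<kappa> \<Omega>)"
proof
  show "f \<in> borel_measurable (lebesgue_on \<Omega>)" "integrable (lebesgue_on \<Omega>) (\<lambda>x. (f x)\<^sup>2)"
    if "f \<in> W12 \<Omega>" for f using that by (auto simp: W12_def)
  show "(\<lambda>x. 0) \<in> W12 \<Omega>" by (rule W12_zero)
  show "(\<lambda>x. f x + g x) \<in> W12 \<Omega>" if "f \<in> W12 \<Omega>" "g \<in> W12 \<Omega>" for f g
    by (rule W12_add[OF \<Omega> that])
  show "(\<lambda>x. t * f x) \<in> W12 \<Omega>" if "f \<in> W12 \<Omega>" for f t by (rule W12_scale[OF that])
  show "g \<in> W12 \<Omega>" if "f \<in> W12 \<Omega>" "AE x in lebesgue_on \<Omega>. f x = g x" for f g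
    by (rule W12_AE[OF \<Omega> that])
  show "0 \<le> c" if "local_relation \<kappa> \<Omega> f c h" for f c h
    using that ddc_mass_nonneg[of \<kappa> \<Omega> h] by (auto simp: local_relation_def real_of_ereal_pos)
  have mass0: "ddc_mass \<kappa> \<Omega> (\<lambda>x. 0) = 0"
    using ddc_mass_lincomb_le[of \<Omega> \<kappa> "\<lambda>x. 0" 0 "\<lambda>x. 0" 0 "\<lambda>x. 0"]
    unfolding ddc_mass_def by (auto simp: ddc_zero trace_def zero_ereal_def intro!: SUP_eq_const test_fun_zero)
  show "local_relation \<kappa> \<Omega> (\<lambda>x. 0) 0 (\<lambda>x. 0)"
    unfolding local_relation_def
    using psh_on_zero[OF \<Omega>] mass0 d_wedge_dc_le_zero[of "ddc \<kappa> \<Omega> (\<lambda>x. 0)", OF ddc_zero]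
    by (intro exI[of _ "\<lambda>_. 0"]) (auto simp: comp_def)
  show "\<exists>e l. local_relation \<kappa> \<Omega> (\<lambda>x. f x + g x) e l \<and> e \<le> 2 * (c + d) \<and>
      (AE x in lebesgue_on \<Omega>. l x = 2 * (h x + k x))"
    if "local_relation \<kappa> \<Omega> f c h" "local_relation \<kappa> \<Omega> g d k" for f c h g d k
  proof -
    have "d_wedge_dc_le \<kappa> \<Omega> f (ddc \<kappa> \<Omega> h)" "d_wedge_dc_le \<kappa> \<Omega> g (ddc \<kappa> \<Omega> k)"
      using that by (auto simp: local_relation_def)
    from local_relation_lincomb[OF \<Omega> that _ _ d_wedge_dc_le_add[OF \<Omega> \<kappa> this], of 2 2]
    show ?thesis by (simp add: distrib_left)
  qed
  show "\<exists>e l. local_relation \<kappa> \<Omega> (\<lambda>x. t * f x) e l \<and> e \<le> t\<^sup>2 * c \<and>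
      (AE x in lebesgue_on \<Omega>. l x = t\<^sup>2 * h x)"
    if "local_relation \<kappa> \<Omega> f c h" for f c h t
  proof -
    have "d_wedge_dc_le \<kappa> \<Omega> f (ddc \<kappa> \<Omega> h)" using that by (auto simp: local_relation_def)
    from local_relation_lincomb[OF \<Omega> that that _ _ d_wedge_dc_le_scale[OF this], of "t\<^sup>2" 0]
    show ?thesis by simp
  qed
  show "local_relation \<kappa> \<Omega> g c h" if "local_relation \<kappa> \<Omega> f c h" "AE x in lebesgue_on \<Omega>. f x = g x" for f g c h
    using that d_wedge_dc_le_AE[OF \<Omega> _ that(2)] unfolding local_relation_def by blast
qed

text \<open>
  A chain carries real potentials. A defining sequence is recovered from it by choosing
  plurisubharmonic functions which they represent.
\<close>

lemma local_quasinorm: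
  fixes \<Omega> :: "(complex^'k::finite) set"
  assumes \<Omega>: "open \<Omega>" and \<kappa>: "0 \<le> \<kappa>" and q: "1 \<le> q"
  shows "quasinorm_mod_ae (lebesgue_on \<Omega>) (Wstar_loc \<kappa> \<Omega> q) (Wstar_norm_loc \<kappa> \<Omega> q)"
proof -
  interpret energy_relation "lebesgue_on \<Omega>" "W12 \<Omega>" "local_relation \<kappa> \<Omega>"
    by (rule local_energy_relation[OF \<Omega> \<kappa>])
  have W: "Wstar_loc \<kappa> \<Omega> n = W n" for n
  proof (induction n)
    case (Suc n)
    show ?case unfolding Wstar_loc.simps W.simps Suc unfolding local_relation_def by blast
  qed simp
  have costs: "{\<Sum>j=1..q. real_of_ereal (ddc_mass \<kappa> \<Omega> (real_of_ereal \<circ> \<Phi> j)) powr (1 / 2 ^ j)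
      | \<Phi>. defining_seq_loc \<kappa> \<Omega> q f \<Phi>} = costs q f" for f
  proof (intro equalityI subsetI)
    fix s assume "s \<in> {\<Sum>j=1..q. real_of_ereal (ddc_mass \<kappa> \<Omega> (real_of_ereal \<circ> \<Phi> j)) powr (1 / 2 ^ j)
      | \<Phi>. defining_seq_loc \<kappa> \<Omega> q f \<Phi>}"
    then obtain \<Phi> where s: "s = (\<Sum>j=1..q. real_of_ereal (ddc_mass \<kappa> \<Omega> (real_of_ereal \<circ> \<Phi> j)) powr (1 / 2 ^ j))"
      and \<Phi>: "defining_seq_loc \<kappa> \<Omega> q f \<Phi>" by blast
    define h where "h j = (if j = 0 then f else real_of_ereal \<circ> \<Phi> j)" for j :: nat
    define c where "c j = real_of_ereal (ddc_mass \<kappa> \<Omega> (h j))" for j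
    have "local_relation \<kappa> \<Omega> (h j) (c (Suc j)) (h (Suc j))" if "j < q" for j
      using \<Phi>[unfolded defining_seq_loc_def, rule_format, of "Suc j"] that
      by (auto simp: local_relation_def h_def c_def)
    then have "chain q f c h" by (simp add: chain_def h_def)
    moreover have "s = cost q c" by (simp add: s cost_def c_def h_def)
    ultimately show "s \<in> costs q f" by (auto simp: costs_def)
  next
    fix s assume "s \<in> costs q f"
    then obtain c h where ch: "s = cost q c" "chain q f c h" by (auto simp: costs_def)
    have "\<forall>j\<in>{1..q}. \<exists>\<psi>. psh_on \<Omega> \<psi> \<and> h j = real_of_ereal \<circ> \<psi> \<and> ddc_mass \<kappa> \<Omega> (h j) < \<infinity> \<and>
        c j = real_of_ereal (ddc_mass \<kappa> \<Omega> (h j)) \<and> d_wedge_dc_le \<kappa> \<Omega> (h (j - 1)) (ddc \<kappa> \<Omega> (h j))"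
    proof
      fix j assume "j \<in> {1..q}"
      then have "local_relation \<kappa> \<Omega> (h (j - 1)) (c j) (h j)"
        using ch(2) by (cases j) (auto simp: chain_def)
      then show "\<exists>\<psi>. psh_on \<Omega> \<psi> \<and> h j = real_of_ereal \<circ> \<psi> \<and> ddc_mass \<kappa> \<Omega> (h j) < \<infinity> \<and>
        c j = real_of_ereal (ddc_mass \<kappa> \<Omega> (h j)) \<and> d_wedge_dc_le \<kappa> \<Omega> (h (j - 1)) (ddc \<kappa> \<Omega> (h j))"
        unfolding local_relation_def by blast
    qed
    then obtain \<Phi> where \<Phi>: "\<forall>j\<in>{1..q}. psh_on \<Omega> (\<Phi> j) \<and> h j = real_of_ereal \<circ> \<Phi> j \<and>
        ddc_mass \<kappa> \<Omega> (h j) < \<infinity> \<and> c j = real_of_ereal (ddc_mass \<kappa> \<Omega> (h j)) \<and>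
        d_wedge_dc_le \<kappa> \<Omega> (h (j - 1)) (ddc \<kappa> \<Omega> (h j))" by (rule bchoice[THEN exE])
    have "defining_seq_loc \<kappa> \<Omega> q f \<Phi>"
      unfolding defining_seq_loc_def
    proof
      fix j assume j: "j \<in> {1..q}"
      have hj: "h j = real_of_ereal \<circ> \<Phi> j" using \<Phi> j by blast
      have prev: "(if j = 1 then f else real_of_ereal \<circ> \<Phi> (j - 1)) = h (j - 1)"
      proof (cases "j = 1")
        case False
        with j have "j - 1 \<in> {1..q}" by auto
        with \<Phi> False show ?thesis by auto
      qed (use ch(2) in \<open>simp add: chain_def\<close>)
      show "psh_on \<Omega> (\<Phi> j) \<and> ddc_mass \<kappa> \<Omega> (real_of_ereal \<circ> \<Phi> j) < \<infinity> \<and>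
        d_wedge_dc_le \<kappa> \<Omega> (if j = 1 then f else real_of_ereal \<circ> \<Phi> (j - 1)) (ddc \<kappa> \<Omega> (real_of_ereal \<circ> \<Phi> j))"
        unfolding prev hj[symmetric] using \<Phi> j by blast
    qed
    moreover have "s = (\<Sum>j=1..q. real_of_ereal (ddc_mass \<kappa> \<Omega> (real_of_ereal \<circ> \<Phi> j)) powr (1 / 2 ^ j))"
      unfolding ch(1) cost_def by (intro sum.cong) (use \<Phi> in auto)
    ultimately show "s \<in> {\<Sum>j=1..q. real_of_ereal (ddc_mass \<kappa> \<Omega> (real_of_ereal \<circ> \<Phi> j)) powr (1 / 2 ^ j)
      | \<Phi>. defining_seq_loc \<kappa> \<Omega> q f \<Phi>}" by blast
  qed
  have "Wstar_norm_loc \<kappa> \<Omega> q = N q"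
    by (rule ext) (simp only: Wstar_norm_loc_def N_def costs)
  with quasinorm[OF q] show ?thesis by (simp add: W)
qed

section \<open>Determinants of positive definite Hermitian matrices\<close>

text \<open>
  A vector in the kernel of the transpose is isotropic for the form.
\<close>

lemma det_nonzero_if_definite:
  fixes A :: "complex^'k::finite^'k"
  assumes "\<And>a. a \<noteq> 0 \<Longrightarrow> hform A a a \<noteq> 0"
  shows "det A \<noteq> 0"
proof
  assume "det A = 0"
  then have "\<not> invertible (transpose A)" by (simp add: invertible_det_nz)
  then obtain x where x: "transpose A *v x = 0" "x \<noteq> 0"
    by (auto simp: invertible_left_inverse matrix_left_invertible_ker)
  have col: "(\<Sum>j\<in>UNIV. A $ j $ l * x $ j) = 0" for l
    using arg_cong[OF x(1), of "\<lambda>v. v $ l"] by (simp add: matrix_vector_mult_def transpose_def)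
  have "hform A x x = (\<Sum>l\<in>UNIV. (\<Sum>j\<in>UNIV. A $ j $ l * x $ j) * cnj (x $ l))"
    unfolding hform_def sum_distrib_right by (rule sum.swap)
  also have "\<dots> = 0" by (simp add: col)
  finally show False using assms[OF x(2)] by simp
qed

text \<open>
  Conjugating a Hermitian matrix amounts to transposing it.
\<close>

lemma Im_det_hermitian:
  fixes A :: "complex^'k::finite^'k"
  assumes "\<And>j l. A $ l $ j = cnj (A $ j $ l)"
  shows "Im (det A) = 0"
proof -
  have "cnj (det A) = det (transpose A)"
    unfolding det_def by (simp add: transpose_def assms[symmetric])
  then show ?thesis by (simp add: complex_eq_iff)
qed

lemma continuous_on_det:
  fixes g :: "'a::topological_space \<Rightarrow> complex^'k::finite^'k"
  assumes "continuous_on S g"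
  shows "continuous_on S (\<lambda>p. det (g p))"
  unfolding det_def by (intro continuous_intros assms)

text \<open>
  On the segment from the identity matrix to \<open>A\<close> all matrices are Hermitian and positive definite, so the
  determinant is real and nonzero there. It equals 1 at the identity, and by the intermediate value
  theorem it stays positive.
\<close>

lemma Re_det_pos:
  fixes A :: "complex^'k::finite^'k"
  assumes herm: "\<And>j l. A $ l $ j = cnj (A $ j $ l)"
    and pos: "\<And>a. a \<noteq> 0 \<Longrightarrow> 0 < Re (hform A a a)"
  shows "0 < Re (det A)"
proof -
  define B where "B t = (1 - t) *\<^sub>R mat 1 + t *\<^sub>R A" for t :: real
  have id: "Re (hform (mat 1) a a) = (\<Sum>j\<in>UNIV. (cmod (a $ j))\<^sup>2)" for a :: "complex^'k"
  proof -
    have "hform (mat 1) a a = (\<Sum>j\<in>UNIV. a $ j * cnj (a $ j))"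
      by (simp add: hform_def mat_def if_distrib[of "\<lambda>x. x * _"] cong: if_cong)
    then show ?thesis by (simp add: complex_mult_cnj cmod_power2)
  qed
  have nz: "Re (det (B t)) \<noteq> 0" if t: "0 \<le> t" "t \<le> 1" for t
  proof -
    have "det (B t) \<noteq> 0"
    proof (rule det_nonzero_if_definite)
      fix a :: "complex^'k" assume a: "a \<noteq> 0"
      then obtain j where "a $ j \<noteq> 0" by (auto simp: vec_eq_iff)
      then have "0 < Re (hform (mat 1) a a)"
        unfolding id by (intro sum_pos2[of _ j]) auto
      then have "0 < (1 - t) * Re (hform (mat 1) a a) + t * Re (hform A a a)"
        using t pos[OF a] by (cases "t = 0") (auto intro!: add_nonneg_pos)
      then have "0 < Re (hform (B t) a a)" by (simp add: B_def hform_add hform_scaleR)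
      then show "hform (B t) a a \<noteq> 0" by auto
    qed
    moreover have "Im (det (B t)) = 0"
    proof (rule Im_det_hermitian)
      fix j l
      show "B t $ l $ j = cnj (B t $ j $ l)"
        using herm[of l j] by (simp add: B_def mat_def)
    qed
    ultimately show ?thesis by (simp add: complex_eq_iff)
  qed
  have "continuous_on {0..1} (\<lambda>t. Re (det (B t)))"
    unfolding B_def by (intro continuous_intros continuous_on_det)
  then have "0 < Re (det (B 1))"
    using IVT2'[of "\<lambda>t. Re (det (B t))" 1 0 0] nz by (force simp: B_def)
  then show ?thesis by (simp add: B_def)
qed

section \<open>Charts and the volume measure\<close>

lemma chart_facts:
  assumes "complex_atlas A" "(U, z) \<in> A"
  shows "open U" "open (z ` U)" "continuous_on U z" "continuous_on (z ` U) (inv_into U z)"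
    "\<And>x. x \<in> U \<Longrightarrow> inv_into U z (z x) = x"
  using assms unfolding complex_atlas_def homeomorphism_def by blast+

lemma chart_cover:
  assumes "complex_atlas A"
  obtains U z where "(U, z) \<in> A" "x \<in> U"
  using assms unfolding complex_atlas_def by blast

definition chart_density ::
  "(('x, 'k::finite) chart \<Rightarrow> complex^'k \<Rightarrow> complex^'k^'k) \<Rightarrow> 'x set \<Rightarrow> ('x \<Rightarrow> complex^'k) \<Rightarrow> complex^'k \<Rightarrow> ennreal"
  where "chart_density \<omega> U z p = ennreal (fact CARD('k) * 2 ^ CARD('k) * Re (det (\<omega> (U, z) p)))"

lemma chart_density_pos:
  assumes "kaehler_form A \<omega>" "(U, z) \<in> A" "p \<in> z ` U"
  shows "0 < chart_density \<omega> U z p"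
proof -
  have "0 < Re (det (\<omega> (U, z) p))"
  proof (rule Re_det_pos)
    show "\<omega> (U, z) p $ l $ j = cnj (\<omega> (U, z) p $ j $ l)" for j l
      using assms unfolding kaehler_form_def Let_def by blast
    show "0 < Re (hform (\<omega> (U, z) p) a a)" if "a \<noteq> 0" for a
      using assms that unfolding kaehler_form_def Let_def by blast
  qed
  then show ?thesis by (simp add: chart_density_def)
qed

lemma kaehler_form_continuous:
  assumes "kaehler_form A \<omega>" "(U, z) \<in> A"
  shows "continuous_on (z ` U) (\<omega> (U, z))"
proof (rule smooth_on_imp_continuous_on)
  show "smooth_on (z ` U) (\<omega> (U, z))" using assms unfolding kaehler_form_def Let_def by blast
qed

lemma borel_measurable_restrict_lborel:
  assumes "continuous_on S f"
  shows "f \<in> borel_measurable (restrict_space lborel S)"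
proof -
  have "sets (restrict_space lborel S) = sets (restrict_space borel S)"
    by (rule sets_restrict_space_cong) simp
  then have "borel_measurable (restrict_space lborel S) = borel_measurable (restrict_space borel S)"
    by (rule measurable_cong_sets) simp
  then show ?thesis using borel_measurable_continuous_on_restrict[OF assms] by simp
qed

lemma chart_density_measurable:
  fixes \<omega> :: "('x::t2_space, 'k::finite) chart \<Rightarrow> complex^'k \<Rightarrow> complex^'k^'k"
  assumes "kaehler_form A \<omega>" "(U, z) \<in> A"
  shows "chart_density \<omega> U z \<in> borel_measurable (restrict_space lborel (z ` U))"
proof -
  have "(\<lambda>p. fact CARD('k) * 2 ^ CARD('k) * Re (det (\<omega> (U, z) p))) \<in>
      borel_measurable (restrict_space lborel (z ` U))"
    by (intro borel_measurable_restrict_lborel continuous_intros continuous_on_det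
        kaehler_form_continuous[OF assms])
  then show ?thesis unfolding chart_density_def[abs_def] by measurable
qed

lemma AE_lebesgue_on_iff_restrict_lborel:
  assumes "open S"
  shows "(AE p in lebesgue_on S. P p) \<longleftrightarrow> (AE p in restrict_space lborel S. P p)"
  using assms open_lebesgue_sets[OF assms]
  by (simp add: AE_restrict_space_iff AE_completion_iff)

lemma sets_chart_vol: "sets (chart_vol \<omega> C) = sets borel"
  by (cases C) (simp add: chart_vol_def)

text \<open>
  Positivity of the density makes the null sets of the chart measure exactly the Lebesgue null sets in the
  coordinates.
\<close>

lemma chart_vol_AE_iff:
  fixes \<omega> :: "('x::t2_space, 'k::finite) chart \<Rightarrow> complex^'k \<Rightarrow> complex^'k^'k"
  assumes A: "complex_atlas A" and \<omega>: "kaehler_form A \<omega>" and C: "(U, z) \<in> A" and N: "N \<in> sets borel"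
  shows "(AE x in chart_vol \<omega> (U, z). x \<notin> N) \<longleftrightarrow> (AE p in lebesgue_on (z ` U). inv_into U z p \<notin> N)"
proof -
  let ?R = "restrict_space lborel (z ` U)"
  note ch = chart_facts[OF A C]
  have vol: "chart_vol \<omega> (U, z) = distr (density ?R (chart_density \<omega> U z)) borel (inv_into U z)"
    by (simp add: chart_vol_def chart_density_def[abs_def])
  have inv: "inv_into U z \<in> measurable (density ?R (chart_density \<omega> U z)) borel"
    using borel_measurable_restrict_lborel[OF ch(4)] by simp
  have "(AE x in chart_vol \<omega> (U, z). x \<notin> N) \<longleftrightarrow>
      (AE p in density ?R (chart_density \<omega> U z). inv_into U z p \<notin> N)"
    unfolding vol by (rule AE_distr_iff[OF inv]) (use N in auto)
  also have "\<dots> \<longleftrightarrow> (AE p in ?R. 0 < chart_density \<omega> U z p \<longrightarrow> inv_into U z p \<notin> N)"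
    by (rule AE_density[OF chart_density_measurable[OF \<omega> C]])
  also have "\<dots> \<longleftrightarrow> (AE p in ?R. inv_into U z p \<notin> N)"
    using chart_density_pos[OF \<omega> C] by (intro AE_cong) (simp add: space_restrict_space)
  also have "\<dots> \<longleftrightarrow> (AE p in lebesgue_on (z ` U). inv_into U z p \<notin> N)"
    by (rule AE_lebesgue_on_iff_restrict_lborel[OF ch(2), symmetric])
  finally show ?thesis .
qed

text \<open>
  The supremum with \<open>N\<close> removed is still an upper bound of the family, because \<open>N\<close> is null for each
  member. Being the least upper bound, the supremum is dominated by it and gives \<open>N\<close> no mass. The index
  set may be uncountable, as an atlas may.
\<close>

lemma emeasure_SUP_eq_0:
  fixes m :: "'i \<Rightarrow> 'a measure"
  assumes I: "I \<noteq> {}" and sets: "\<And>i. i \<in> I \<Longrightarrow> sets (m i) = sets M" and N: "N \<in> sets M"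
    and zero: "\<And>i. i \<in> I \<Longrightarrow> emeasure (m i) N = 0"
  shows "emeasure (SUP i\<in>I. m i) N = 0"
proof -
  define S where "S = (SUP i\<in>I. m i)"
  have setsS[measurable_cong]: "sets S = sets M" unfolding S_def by (rule sets_SUP[OF sets I])
  have [measurable]: "N \<in> sets S" using N setsS by simp
  define R where "R = density S (indicator (space M - N))"
  have spaceS: "space S = space M" by (rule sets_eq_imp_space_eq[OF setsS])
  have emR: "emeasure R X = emeasure S (X - N)" if X: "X \<in> sets M" for X
  proof -
    have "X \<subseteq> space M" using X by (rule sets.sets_into_space)
    then have "indicator (space M - N) x * indicator X x = (indicator (X - N) x :: ennreal)" for x
      by (auto simp: indicator_def)
    moreover have "X \<in> sets S" using X setsS by simp
    moreover have "indicator (space M - N) \<in> borel_measurable S"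
      using N setsS by (intro borel_measurable_indicator) (auto simp flip: spaceS)
    ultimately show ?thesis by (simp add: R_def emeasure_density)
  qed
  have "S \<le> R"
    unfolding S_def
  proof (rule SUP_least)
    fix i assume i: "i \<in> I"
    have "emeasure (m i) X \<le> emeasure R X" if X: "X \<in> sets M" for X
    proof -
      have "emeasure (m i) X = emeasure (m i) (X - N)"
        using X N sets[OF i] zero[OF i] by (intro emeasure_Diff_null_set[symmetric]) (auto simp: null_sets_def)
      also have "\<dots> \<le> emeasure S (X - N)"
        using sets[OF i] setsS i by (intro le_measureD3) (auto simp: S_def intro: SUP_upper)
      also have "\<dots> = emeasure R X" by (rule emR[OF X, symmetric])
      finally show ?thesis .
    qed
    then show "m i \<le> R" using sets[OF i] setsS by (subst le_measure) (auto simp: R_def)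
  qed
  then have "emeasure S N \<le> emeasure R N" by (rule le_measureD3) (simp add: R_def)
  also have "\<dots> = 0" using emR[OF N] by simp
  finally show ?thesis by (simp add: S_def)
qed

context
  fixes A :: "('x::t2_space, 'k::finite) chart set" and \<omega> :: "('x, 'k) chart \<Rightarrow> complex^'k \<Rightarrow> complex^'k^'k"
  assumes atlas: "complex_atlas A" and form: "kaehler_form A \<omega>"
begin

lemma atlas_nonempty: "A \<noteq> {}"
  by (rule chart_cover[OF atlas]) auto

lemma AE_kaehler_vol_imp_chart:
  assumes "AE x in kaehler_vol A \<omega>. P x" "(U, z) \<in> A"
  shows "AE p in lebesgue_on (z ` U). P (inv_into U z p)"
proof -
  let ?S = "SUP C\<in>A. chart_vol \<omega> C"
  have sets: "sets ?S = sets borel" by (rule sets_SUP[OF sets_chart_vol atlas_nonempty])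
  have "AE x in ?S. P x" using assms(1) unfolding kaehler_vol_def AE_completion_iff .
  then obtain N where N: "\<And>x. x \<in> space ?S - N \<Longrightarrow> P x" "N \<in> null_sets ?S"
    using AE_E3 by blast
  then have Nb: "N \<in> sets borel" "emeasure ?S N = 0" by (auto simp: null_sets_def sets)
  have "emeasure (chart_vol \<omega> (U, z)) N \<le> emeasure ?S N"
    using assms(2) by (intro le_measureD3 SUP_upper) (simp_all add: sets sets_chart_vol)
  then have "N \<in> null_sets (chart_vol \<omega> (U, z))"
    using Nb by (simp add: null_sets_def sets_chart_vol)
  then have "AE x in chart_vol \<omega> (U, z). x \<notin> N" by (rule AE_not_in)
  then have "AE p in lebesgue_on (z ` U). inv_into U z p \<notin> N"
    using chart_vol_AE_iff[OF atlas form assms(2) Nb(1)] by simp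
  moreover have "space ?S = UNIV" using sets_eq_imp_space_eq[OF sets] by simp
  ultimately show ?thesis using N(1) by auto
qed

lemma AE_kaehler_volI:
  assumes N: "N \<in> sets borel"
    and ae: "\<And>U z. (U, z) \<in> A \<Longrightarrow> AE p in lebesgue_on (z ` U). inv_into U z p \<notin> N"
  shows "AE x in kaehler_vol A \<omega>. x \<notin> N"
proof -
  have "emeasure (chart_vol \<omega> C) N = 0" if "C \<in> A" for C
  proof -
    obtain U z where C: "C = (U, z)" by (cases C)
    have UA: "(U, z) \<in> A" using that unfolding C .
    have "AE x in chart_vol \<omega> C. x \<notin> N"
      unfolding C by (rule iffD2[OF chart_vol_AE_iff[OF atlas form UA N] ae[OF UA]])
    then show ?thesis
      using N by (subst (asm) AE_iff_measurable[of N]) (auto simp: sets_chart_vol sets_eq_imp_space_eq[OF sets_chart_vol])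
  qed
  then have "emeasure (SUP C\<in>A. chart_vol \<omega> C) N = 0"
    by (intro emeasure_SUP_eq_0[OF atlas_nonempty sets_chart_vol N])
  moreover have "sets (SUP C\<in>A. chart_vol \<omega> C) = sets borel"
    by (rule sets_SUP[OF sets_chart_vol atlas_nonempty])
  ultimately have "N \<in> null_sets (SUP C\<in>A. chart_vol \<omega> C)"
    using N by (simp add: null_sets_def)
  then show ?thesis unfolding kaehler_vol_def by (intro AE_completion AE_not_in)
qed

section \<open>Quasi-plurisubharmonic functions\<close>

lemma quasi_pshD:
  assumes "quasi_psh A u" "(U, z) \<in> A" "p \<in> z ` U"
  shows "\<exists>V v h. open V \<and> p \<in> V \<and> V \<subseteq> z ` U \<and> psh_on V v \<and> smooth_on V (h :: complex^'k \<Rightarrow> real) \<and>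
    (\<forall>y\<in>V. u (inv_into U z y) = v y + ereal (h y))"
  using bspec[OF assms(1)[unfolded quasi_psh_def] assms(2)] assms(3) unfolding prod.case by (rule bspec)

lemma quasi_psh_chart_AE_finite:
  assumes u: "quasi_psh A u" and C: "(U, z) \<in> A"
  shows "AE p in lebesgue_on (z ` U). \<bar>u (inv_into U z p)\<bar> \<noteq> \<infinity>"
proof (rule AE_lebesgue_on_if_negligible)
  let ?E = "{p\<in>z ` U. \<not> \<bar>u (inv_into U z p)\<bar> \<noteq> \<infinity>}"
  show "negligible ?E"
  proof (rule negligible_if_locally)
    fix p assume "p \<in> z ` U"
    from quasi_pshD[OF u C this] obtain V v h where V: "open V" "p \<in> V" "psh_on V v"
      "\<forall>y\<in>V. u (inv_into U z y) = v y + ereal (h y)" by (elim exE conjE)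
    have "V \<inter> ?E \<subseteq> {y\<in>V. v y = - \<infinity>}"
    proof
      fix y assume "y \<in> V \<inter> ?E"
      then have "y \<in> V" "\<bar>v y + ereal (h y)\<bar> = \<infinity>" using V(4) by auto
      then show "y \<in> {y\<in>V. v y = - \<infinity>}" using psh_less_top[OF V(3), of y] by (cases "v y") auto
    qed
    then have "negligible (V \<inter> ?E)" by (rule negligible_subset[OF psh_polar_negligible[OF V(3)]])
    with V show "\<exists>T. open T \<and> p \<in> T \<and> negligible (T \<inter> ?E)" by blast
  qed auto
qed (use chart_facts(2)[OF atlas C] in auto)

lemma loc_integrable_continuous:
  fixes h :: "'a::euclidean_space \<Rightarrow> real"
  assumes "continuous_on V h"
  shows "loc_integrable V h"
  unfolding loc_integrable_def
proof (intro allI impI, elim conjE)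
  fix K assume K: "compact K" "K \<subseteq> V"
  have i: "integrable lborel (\<lambda>x. indicator K x *\<^sub>R h x)"
    by (rule borel_integrable_compact[OF K(1) continuous_on_subset[OF assms K(2)]])
  then have "integrable lebesgue (\<lambda>x. indicator K x *\<^sub>R h x)"
    using borel_measurable_integrable[OF i] by (subst integrable_completion) auto
  then show "integrable (lebesgue_on K) h"
    using compact_lebesgue_sets[OF K(1)] by (simp add: integrable_restrict_space)
qed

text \<open>
  In a chart, the function is locally the sum of a plurisubharmonic and a continuous function. For the
  real representatives this holds off the poles, hence almost everywhere.
\<close>

lemma quasi_psh_chart_loc_integrable:
  assumes u: "quasi_psh A u" and C: "(U, z) \<in> A"
  shows "loc_integrable (z ` U) ((real_of_ereal \<circ> u) \<circ> inv_into U z)"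
proof (rule loc_integrable_if_locally)
  let ?w = "(real_of_ereal \<circ> u) \<circ> inv_into U z"
  fix p assume "p \<in> z ` U"
  from quasi_pshD[OF u C this] obtain V v h where V: "open V" "p \<in> V" "psh_on V v" "smooth_on V h"
    "\<forall>y\<in>V. u (inv_into U z y) = v y + ereal (h y)" by (elim exE conjE)
  have "AE y in lebesgue_on V. (real_of_ereal \<circ> v) y + h y = ?w y"
  proof -
    have "AE y in lebesgue_on V. y \<in> V"
      using open_lebesgue_sets[OF V(1)] by (simp add: AE_restrict_space_iff)
    with psh_AE_finite[OF V(3)] show ?thesis
    proof eventually_elim
      fix y assume "\<bar>v y\<bar> \<noteq> \<infinity>" "y \<in> V"
      then show "(real_of_ereal \<circ> v) y + h y = ?w y" using V(5) by (cases "v y") auto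
    qed
  qed
  then have w: "loc_integrable V ?w"
    by (rule loc_integrable_AE[OF loc_integrable_add[OF psh_loc_integrable[OF V(3)]
            loc_integrable_continuous[OF smooth_on_imp_continuous_on[OF V(4)]]] _ V(1)])
  obtain r where r: "0 < r" "cball p r \<subseteq> V" using V(1,2) open_contains_cball by blast
  then have "integrable (lebesgue_on (cball p r)) ?w" using w by (simp add: loc_integrable_def)
  then have "set_integrable lebesgue (cball p r) ?w" by (simp add: lebesgue_on_eq_set_integrable)
  then have "set_integrable lebesgue (ball p r) ?w"
    by (rule set_integrable_subset) auto
  then show "\<exists>T. open T \<and> p \<in> T \<and> integrable (lebesgue_on T) ?w"
    using r by (intro exI[of _ "ball p r"]) (simp add: lebesgue_on_eq_set_integrable)
qed

lemma quasi_psh_open_sublevel: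
  assumes u: "quasi_psh A u"
  shows "open {x. u x < r}"
proof (subst open_subopen, intro ballI)
  fix x assume x: "x \<in> {x. u x < r}"
  obtain U z where C: "(U, z) \<in> A" "x \<in> U" by (rule chart_cover[OF atlas])
  note ch = chart_facts[OF atlas C(1)]
  from C(2) have "z x \<in> z ` U" by simp
  from quasi_pshD[OF u C(1) this] obtain V v h where V: "open V" "z x \<in> V" "V \<subseteq> z ` U" "psh_on V v"
    "smooth_on V h" "\<forall>y\<in>V. u (inv_into U z y) = v y + ereal (h y)" by (elim exE conjE)
  define G where "G = {y\<in>V. ereal (h y) + v y < r}"
  have "G = (\<Union>s::real. (V \<inter> h -` {..<s}) \<inter> {y\<in>V. v y < r - ereal s})"
    using ereal_add_less_iff[OF _ psh_less_top[OF V(4)], of "ereal (h _)" _ r] by (auto simp: G_def)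
  moreover have "open (V \<inter> h -` {..<s})" for s
    by (rule continuous_open_preimage[OF smooth_on_imp_continuous_on[OF V(5)] V(1)]) simp
  ultimately have "open G" using psh_open_sublevel[OF V(4)] by auto
  then have "open (U \<inter> z -` G)" by (rule continuous_open_preimage[OF ch(3,1)])
  moreover have u_eq: "u y = ereal (h (z y)) + v (z y)" if "y \<in> U" "z y \<in> V" for y
    using bspec[OF V(6) that(2)] ch(5)[OF that(1)] by (simp add: add.commute)
  then have "x \<in> U \<inter> z -` G" using x C(2) V(2) by (auto simp: G_def)
  moreover have "U \<inter> z -` G \<subseteq> {x. u x < r}" using u_eq by (auto simp: G_def)
  ultimately show "\<exists>T. open T \<and> x \<in> T \<and> T \<subseteq> {x. u x < r}" by blast
qed

text \<open>
  The poles form a Borel set by semicontinuity, and this set is null in every chart.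
\<close>

lemma quasi_psh_AE_finite:
  assumes u: "quasi_psh A u"
  shows "AE x in kaehler_vol A \<omega>. \<bar>u x\<bar> \<noteq> \<infinity>"
proof -
  have "u \<in> borel_measurable borel"
    by (rule borel_measurableI_less) (use quasi_psh_open_sublevel[OF u] in auto)
  then have "u -` {\<infinity>, - \<infinity>} \<inter> space borel \<in> sets borel" by (rule measurable_sets) simp
  then have N: "u -` {\<infinity>, - \<infinity>} \<in> sets borel" by simp
  have "AE x in kaehler_vol A \<omega>. x \<notin> u -` {\<infinity>, - \<infinity>}"
  proof (rule AE_kaehler_volI[OF N])
    fix U z assume "(U, z) \<in> A"
    from quasi_psh_chart_AE_finite[OF u this]
    show "AE p in lebesgue_on (z ` U). inv_into U z p \<notin> u -` {\<infinity>, - \<infinity>}"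
      by eventually_elim auto
  qed
  then show ?thesis by eventually_elim (auto elim: abs_eq_infinity_cases)
qed

text \<open>
  The local decompositions of the two functions live on different neighbourhoods, so they are restricted
  to the intersection.
\<close>

lemma quasi_psh_lincomb:
  assumes u: "quasi_psh A u" and v: "quasi_psh A v" and ab: "0 \<le> a" "0 \<le> b"
  shows "quasi_psh A (\<lambda>x. ereal a * u x + ereal b * v x)"
  unfolding quasi_psh_def
proof (clarify del: exE)
  fix U z x assume C: "(U, z) \<in> A" and "x \<in> U"
  then have p: "z x \<in> z ` U" by blast
  from quasi_pshD[OF u C p] obtain V1 v1 h1 where 1: "open V1" "z x \<in> V1" "V1 \<subseteq> z ` U" "psh_on V1 v1"
    "smooth_on V1 h1" "\<forall>y\<in>V1. u (inv_into U z y) = v1 y + ereal (h1 y)" by (elim exE conjE)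
  from quasi_pshD[OF v C p] obtain V2 v2 h2 where 2: "open V2" "z x \<in> V2" "V2 \<subseteq> z ` U" "psh_on V2 v2"
    "smooth_on V2 h2" "\<forall>y\<in>V2. v (inv_into U z y) = v2 y + ereal (h2 y)" by (elim exE conjE)
  let ?V = "V1 \<inter> V2"
  have V: "open ?V" using 1 2 by blast
  have "psh_on ?V (\<lambda>y. ereal a * v1 y + ereal b * v2 y)"
    using psh_on_subset[OF 1(4) V] psh_on_subset[OF 2(4) V] ab by (intro psh_on_lincomb) auto
  moreover have "smooth_on ?V (\<lambda>y. a *\<^sub>R h1 y + b *\<^sub>R h2 y)"
    by (intro smooth_on_add smooth_on_scaleR V smooth_on_subset[OF 1(5)] smooth_on_subset[OF 2(5)]) auto
  moreover have "ereal a * u (inv_into U z y) + ereal b * v (inv_into U z y) =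
      (ereal a * v1 y + ereal b * v2 y) + ereal (a *\<^sub>R h1 y + b *\<^sub>R h2 y)" if "y \<in> ?V" for y
  proof -
    have "v1 y < \<infinity>" "v2 y < \<infinity>" using psh_less_top[OF 1(4)] psh_less_top[OF 2(4)] that by auto
    then show ?thesis
      using bspec[OF 1(6), of y] bspec[OF 2(6), of y] that ab
      by (cases "v1 y"; cases "v2 y"; cases "a = 0"; cases "b = 0") (auto simp: algebra_simps)
  qed
  ultimately show "\<exists>V v' h. open V \<and> z x \<in> V \<and> V \<subseteq> z ` U \<and> psh_on V v' \<and> smooth_on V (h :: complex^'k \<Rightarrow> real) \<and>
      (\<forall>y\<in>V. ereal a * u (inv_into U z y) + ereal b * v (inv_into U z y) = v' y + ereal (h y))"
    using V 1 2 by (intro exI[of _ ?V] exI) (auto intro: 1(2) 2(2))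
qed

lemma quasi_psh_zero: "quasi_psh A (\<lambda>_. 0)"
  unfolding quasi_psh_def
proof (clarify del: exE)
  fix U z x assume C: "(U, z) \<in> A" and "x \<in> U"
  note ch = chart_facts[OF atlas C]
  show "\<exists>V v' h. open V \<and> z x \<in> V \<and> V \<subseteq> z ` U \<and> psh_on V v' \<and> smooth_on V (h :: complex^'k \<Rightarrow> real) \<and>
      (\<forall>y\<in>V. 0 = v' y + ereal (h y))"
    using ch(2) \<open>x \<in> U\<close> psh_on_zero[OF ch(2)] smooth_on_const[of "z ` U" 0]
    by (intro exI[of _ "z ` U"] exI[of _ "\<lambda>_. 0"]) (auto simp: zero_ereal_def)
qed

end

section \<open>The global setting\<close>

lemma W12_loc_zero: "(\<lambda>x. 0) \<in> W12_loc S"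
  using weak_gradient_zero[of S] by (auto simp: W12_loc_def loc_integrable_def intro!: exI[of _ "\<lambda>x. 0"])

lemma W12_loc_add:
  assumes S: "open S" and f: "f \<in> W12_loc S" and g: "g \<in> W12_loc S"
  shows "(\<lambda>x. f x + g x) \<in> W12_loc S"
proof -
  obtain F where F: "weak_gradient S f F" "loc_integrable S (\<lambda>x. (norm (F x))\<^sup>2)"
    using f by (auto simp: W12_loc_def)
  obtain G where G: "weak_gradient S g G" "loc_integrable S (\<lambda>x. (norm (G x))\<^sup>2)"
    using g by (auto simp: W12_loc_def)
  have li: "loc_integrable S f" "loc_integrable S F" "loc_integrable S g" "loc_integrable S G"
    using F(1) G(1) by (auto simp: weak_gradient_def)
  have "loc_integrable S (\<lambda>x. (norm (f x + g x))\<^sup>2)"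
    using f g by (intro loc_integrable_square_sum[OF li(1,3)]) (auto simp: W12_loc_def)
  then show ?thesis
    using weak_gradient_add[OF S F(1) G(1)] loc_integrable_square_sum[OF li(2,4) F(2) G(2)]
    by (auto simp: W12_loc_def)
qed

lemma W12_loc_scale:
  assumes f: "f \<in> W12_loc S"
  shows "(\<lambda>x. t * f x) \<in> W12_loc S"
proof -
  obtain F where F: "weak_gradient S f F" "loc_integrable S (\<lambda>x. (norm (F x))\<^sup>2)"
    using f by (auto simp: W12_loc_def)
  have "loc_integrable S (\<lambda>x. (norm (t *\<^sub>R F x))\<^sup>2)" "loc_integrable S (\<lambda>x. (t * f x)\<^sup>2)"
    using loc_integrable_mult[OF F(2), of "t\<^sup>2"] f loc_integrable_mult[of S "\<lambda>x. (f x)\<^sup>2" "t\<^sup>2"]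
    by (simp_all add: W12_loc_def power_mult_distrib)
  with weak_gradient_scale[OF F(1), of t] show ?thesis by (auto simp: W12_loc_def)
qed

lemma W12_loc_AE:
  assumes S: "open S" and f: "f \<in> W12_loc S" and eq: "AE x in lebesgue_on S. f x = g x"
  shows "g \<in> W12_loc S"
proof -
  obtain F where F: "weak_gradient S f F" "loc_integrable S (\<lambda>x. (norm (F x))\<^sup>2)"
    using f by (auto simp: W12_loc_def)
  have "AE x in lebesgue_on S. (f x)\<^sup>2 = (g x)\<^sup>2" using eq by eventually_elim simp
  moreover have "loc_integrable S (\<lambda>x. (f x)\<^sup>2)" using f by (simp add: W12_loc_def)
  ultimately have "loc_integrable S (\<lambda>x. (g x)\<^sup>2)" by (rule loc_integrable_AE[OF _ _ S, rotated])
  then show ?thesis using weak_gradient_AE[OF S F(1) eq] F(2) unfolding W12_loc_def by blast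
qed

text \<open>
  The expression of the current \<open>c \<omega> + dd\<^sup>cu\<close> in a chart.
\<close>

definition chart_current ::
  "real \<Rightarrow> (('x::t2_space, 'k::finite) chart \<Rightarrow> complex^'k \<Rightarrow> complex^'k^'k) \<Rightarrow>
   'x set \<Rightarrow> ('x \<Rightarrow> complex^'k) \<Rightarrow> real \<Rightarrow> ('x \<Rightarrow> real) \<Rightarrow> 'k current" where
  "chart_current \<kappa> \<omega> U z c u \<eta> =
     form_current (z ` U) (\<lambda>p. c *\<^sub>R \<omega> (U, z) p) \<eta> + ddc \<kappa> (z ` U) (u \<circ> inv_into U z) \<eta>"

lemma d_wedge_dc_le_mfd_iff:
  "d_wedge_dc_le_mfd \<kappa> A \<omega> \<phi> c u \<longleftrightarrow> (\<forall>U z. (U, z) \<in> A \<longrightarrow>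
     d_wedge_dc_le \<kappa> (z ` U) (\<phi> \<circ> inv_into U z) (chart_current \<kappa> \<omega> U z c u))"
  unfolding d_wedge_dc_le_mfd_def chart_current_def[abs_def] by auto

lemma form_current_scale: "form_current U (\<lambda>p. c *\<^sub>R g p) \<eta> = c *\<^sub>R form_current U g \<eta>"
  unfolding form_current_def by (subst scaleR_left_commute) (rule integral_scaleR_right)

definition global_relation ::
  "real \<Rightarrow> ('x::t2_space, 'k::finite) chart set \<Rightarrow> (('x, 'k) chart \<Rightarrow> complex^'k \<Rightarrow> complex^'k^'k) \<Rightarrow>
   ('x \<Rightarrow> real) \<Rightarrow> real \<Rightarrow> ('x \<Rightarrow> real) \<Rightarrow> bool" where
  "global_relation \<kappa> A \<omega> f c h \<longleftrightarrow> (\<exists>\<psi>. quasi_psh A \<psi> \<and> h = real_of_ereal \<circ> \<psi> \<and>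
     0 \<le> c \<and> d_wedge_dc_le_mfd \<kappa> A \<omega> f c h)"

context
  fixes A :: "('x::t2_space, 'k::finite) chart set" and \<omega> :: "('x, 'k) chart \<Rightarrow> complex^'k \<Rightarrow> complex^'k^'k"
  assumes atlas: "complex_atlas A" and form: "kaehler_form A \<omega>"
begin

text \<open>
  The global counterpart of \<open>local_relation_lincomb\<close>. The cost is now attached to the step itself,
  so it is combined exactly like the potentials.
\<close>

lemma global_relation_lincomb:
  assumes h: "global_relation \<kappa> A \<omega> f c h" and k: "global_relation \<kappa> A \<omega> g d k"
    and ab: "0 \<le> a" "0 \<le> b"
    and le: "\<And>e l U z. (U, z) \<in> A \<Longrightarrow>
      (\<And>\<eta>. test_fun (z ` U) \<eta> \<Longrightarrow> chart_current \<kappa> \<omega> U z e l \<eta> =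
        a *\<^sub>R chart_current \<kappa> \<omega> U z c h \<eta> + b *\<^sub>R chart_current \<kappa> \<omega> U z d k \<eta>) \<Longrightarrow>
      d_wedge_dc_le \<kappa> (z ` U) (\<phi> \<circ> inv_into U z) (chart_current \<kappa> \<omega> U z e l)"
  shows "\<exists>e l. global_relation \<kappa> A \<omega> \<phi> e l \<and> e \<le> a * c + b * d \<and>
    (AE x in kaehler_vol A \<omega>. l x = a * h x + b * k x)"
proof -
  obtain \<psi> where \<psi>: "quasi_psh A \<psi>" "h = real_of_ereal \<circ> \<psi>" "0 \<le> c"
    using h by (auto simp: global_relation_def)
  obtain \<rho> where \<rho>: "quasi_psh A \<rho>" "k = real_of_ereal \<circ> \<rho>" "0 \<le> d"
    using k by (auto simp: global_relation_def)
  define \<xi> where "\<xi> x = ereal a * \<psi> x + ereal b * \<rho> x" for x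
  have \<xi>: "quasi_psh A \<xi>"
    using quasi_psh_lincomb[OF atlas form \<psi>(1) \<rho>(1) ab] by (simp add: \<xi>_def[abs_def])
  define l where "l = real_of_ereal \<circ> \<xi>"
  have l: "l x = a * h x + b * k x" if "\<bar>\<psi> x\<bar> \<noteq> \<infinity>" "\<bar>\<rho> x\<bar> \<noteq> \<infinity>" for x
    using that by (cases "\<psi> x"; cases "\<rho> x") (auto simp: l_def \<xi>_def \<psi>(2) \<rho>(2))
  have ae: "AE x in kaehler_vol A \<omega>. l x = a * h x + b * k x"
    using quasi_psh_AE_finite[OF atlas form \<psi>(1)] quasi_psh_AE_finite[OF atlas form \<rho>(1)]
    by eventually_elim (rule l)
  have dd: "chart_current \<kappa> \<omega> U z (a * c + b * d) l \<eta> =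
      a *\<^sub>R chart_current \<kappa> \<omega> U z c h \<eta> + b *\<^sub>R chart_current \<kappa> \<omega> U z d k \<eta>"
    if C: "(U, z) \<in> A" and \<eta>: "test_fun (z ` U) \<eta>" for U z \<eta>
  proof -
    have aeC: "AE p in lebesgue_on (z ` U). (l \<circ> inv_into U z) p =
        a * (h \<circ> inv_into U z) p + b * (k \<circ> inv_into U z) p"
      using quasi_psh_chart_AE_finite[OF atlas form \<psi>(1) C] quasi_psh_chart_AE_finite[OF atlas form \<rho>(1) C]
      by eventually_elim (simp add: l)
    have "ddc \<kappa> (z ` U) (l \<circ> inv_into U z) \<eta> =
        a *\<^sub>R ddc \<kappa> (z ` U) (h \<circ> inv_into U z) \<eta> + b *\<^sub>R ddc \<kappa> (z ` U) (k \<circ> inv_into U z) \<eta>"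
    proof (rule ddc_lincomb[OF _ _ _ aeC chart_facts(2)[OF atlas C] \<eta>])
      show "loc_integrable (z ` U) (h \<circ> inv_into U z)"
        using quasi_psh_chart_loc_integrable[OF atlas form \<psi>(1) C] by (simp only: \<psi>(2))
      show "loc_integrable (z ` U) (k \<circ> inv_into U z)"
        using quasi_psh_chart_loc_integrable[OF atlas form \<rho>(1) C] by (simp only: \<rho>(2))
      show "loc_integrable (z ` U) (l \<circ> inv_into U z)"
        using quasi_psh_chart_loc_integrable[OF atlas form \<xi> C] by (simp only: l_def)
    qed
    then show ?thesis
      unfolding chart_current_def form_current_scale by (simp add: algebra_simps)
  qed
  have "global_relation \<kappa> A \<omega> \<phi> (a * c + b * d) l"
    unfolding global_relation_def d_wedge_dc_le_mfd_iff
    using \<xi> ab \<psi>(3) \<rho>(3) le[OF _ dd] by (auto simp: l_def)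
  with ae show ?thesis by blast
qed

lemma global_energy_relation:
  assumes \<kappa>: "0 \<le> \<kappa>"
  shows "energy_relation (kaehler_vol A \<omega>) (W12_mfd A \<omega>) (global_relation \<kappa> A \<omega>)"
proof
  note chart_open = chart_facts(2)[OF atlas]
  note chart_AE = AE_kaehler_vol_imp_chart[OF atlas form]
  show "f \<in> borel_measurable (kaehler_vol A \<omega>)" "integrable (kaehler_vol A \<omega>) (\<lambda>x. (f x)\<^sup>2)"
    if "f \<in> W12_mfd A \<omega>" for f using that by (auto simp: W12_mfd_def)
  show "(\<lambda>x. 0) \<in> W12_mfd A \<omega>"
    using W12_loc_zero by (auto simp: W12_mfd_def comp_def)
  show "(\<lambda>x. f x + g x) \<in> W12_mfd A \<omega>" if f: "f \<in> W12_mfd A \<omega>" and g: "g \<in> W12_mfd A \<omega>" for f g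
  proof -
    have "integrable (kaehler_vol A \<omega>) (\<lambda>x. (norm (f x + g x))\<^sup>2)"
      using f g by (intro integrable_square_sum) (auto simp: W12_mfd_def)
    moreover have "(\<lambda>x. f x + g x) \<circ> inv_into U z \<in> W12_loc (z ` U)" if C: "(U, z) \<in> A" for U z
      using W12_loc_add[OF chart_open[OF C], of "f \<circ> inv_into U z" "g \<circ> inv_into U z"] f g C
      by (auto simp: W12_mfd_def comp_def)
    ultimately show ?thesis using f g by (auto simp: W12_mfd_def)
  qed
  show "(\<lambda>x. t * f x) \<in> W12_mfd A \<omega>" if f: "f \<in> W12_mfd A \<omega>" for f t
    using f W12_loc_scale[of "f \<circ> inv_into _ _" _ t]
    by (fastforce simp: W12_mfd_def comp_def power_mult_distrib)
  show "g \<in> W12_mfd A \<omega>" if f: "f \<in> W12_mfd A \<omega>" and eq: "AE x in kaehler_vol A \<omega>. f x = g x" for f g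
  proof -
    have f': "f \<in> borel_measurable (kaehler_vol A \<omega>)" "integrable (kaehler_vol A \<omega>) (\<lambda>x. (f x)\<^sup>2)"
      using f by (auto simp: W12_mfd_def)
    have "AE x in kaehler_vol A \<omega>. (f x)\<^sup>2 = (g x)\<^sup>2" using eq by eventually_elim simp
    then have "integrable (kaehler_vol A \<omega>) (\<lambda>x. (g x)\<^sup>2)" "g \<in> borel_measurable (kaehler_vol A \<omega>)"
      using f' eq unfolding kaehler_vol_def
      by (blast intro: completion.integrable_AE_cong completion.borel_measurable_AE_cong)+
    moreover have "g \<circ> inv_into U z \<in> W12_loc (z ` U)" if C: "(U, z) \<in> A" for U z
    proof (rule W12_loc_AE[OF chart_open[OF C]])
      show "f \<circ> inv_into U z \<in> W12_loc (z ` U)" using f C by (auto simp: W12_mfd_def)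
      show "AE p in lebesgue_on (z ` U). (f \<circ> inv_into U z) p = (g \<circ> inv_into U z) p"
        using chart_AE[OF eq C] by (simp add: comp_def)
    qed
    ultimately show ?thesis by (auto simp: W12_mfd_def)
  qed
  show "0 \<le> c" if "global_relation \<kappa> A \<omega> f c h" for f c h
    using that by (auto simp: global_relation_def)
  have zero: "d_wedge_dc_le_mfd \<kappa> A \<omega> (\<lambda>x. 0) 0 (\<lambda>x. 0)"
    unfolding d_wedge_dc_le_mfd_iff comp_def
    by (intro allI impI d_wedge_dc_le_zero) (simp add: chart_current_def form_current_def comp_def ddc_zero)
  show "global_relation \<kappa> A \<omega> (\<lambda>x. 0) 0 (\<lambda>x. 0)"
    unfolding global_relation_def using quasi_psh_zero[OF atlas form] zero
    by (intro exI[of _ "\<lambda>_. 0"]) (simp add: comp_def)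
  have le: "d_wedge_dc_le \<kappa> (z ` U) (f \<circ> inv_into U z) (chart_current \<kappa> \<omega> U z c h)"
    if "global_relation \<kappa> A \<omega> f c h" "(U, z) \<in> A" for f c h U z
    using that by (auto simp: global_relation_def d_wedge_dc_le_mfd_iff)
  show "\<exists>e l. global_relation \<kappa> A \<omega> (\<lambda>x. f x + g x) e l \<and> e \<le> 2 * (c + d) \<and>
      (AE x in kaehler_vol A \<omega>. l x = 2 * (h x + k x))"
    if h: "global_relation \<kappa> A \<omega> f c h" and k: "global_relation \<kappa> A \<omega> g d k" for f c h g d k
  proof -
    have "\<exists>e l. global_relation \<kappa> A \<omega> (\<lambda>x. f x + g x) e l \<and> e \<le> 2 * c + 2 * d \<and>
        (AE x in kaehler_vol A \<omega>. l x = 2 * h x + 2 * k x)"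
    proof (rule global_relation_lincomb[OF h k])
      fix e l U z assume C: "(U, z) \<in> A"
        and R: "\<And>\<eta>. test_fun (z ` U) \<eta> \<Longrightarrow> chart_current \<kappa> \<omega> U z e l \<eta> =
          2 *\<^sub>R chart_current \<kappa> \<omega> U z c h \<eta> + 2 *\<^sub>R chart_current \<kappa> \<omega> U z d k \<eta>"
      show "d_wedge_dc_le \<kappa> (z ` U) ((\<lambda>x. f x + g x) \<circ> inv_into U z) (chart_current \<kappa> \<omega> U z e l)"
        using d_wedge_dc_le_add[OF chart_open[OF C] \<kappa> le[OF h C] le[OF k C] R] by (simp add: comp_def)
    qed simp_all
    then show ?thesis by (simp add: distrib_left)
  qed
  show "\<exists>e l. global_relation \<kappa> A \<omega> (\<lambda>x. t * f x) e l \<and> e \<le> t\<^sup>2 * c \<and>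
      (AE x in kaehler_vol A \<omega>. l x = t\<^sup>2 * h x)"
    if h: "global_relation \<kappa> A \<omega> f c h" for f c h t
  proof -
    have "\<exists>e l. global_relation \<kappa> A \<omega> (\<lambda>x. t * f x) e l \<and> e \<le> t\<^sup>2 * c + 0 * c \<and>
        (AE x in kaehler_vol A \<omega>. l x = t\<^sup>2 * h x + 0 * h x)"
    proof (rule global_relation_lincomb[OF h h])
      fix e l U z assume C: "(U, z) \<in> A"
        and R: "\<And>\<eta>. test_fun (z ` U) \<eta> \<Longrightarrow> chart_current \<kappa> \<omega> U z e l \<eta> =
          t\<^sup>2 *\<^sub>R chart_current \<kappa> \<omega> U z c h \<eta> + 0 *\<^sub>R chart_current \<kappa> \<omega> U z c h \<eta>"
      show "d_wedge_dc_le \<kappa> (z ` U) ((\<lambda>x. t * f x) \<circ> inv_into U z) (chart_current \<kappa> \<omega> U z e l)"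
        using d_wedge_dc_le_scale[OF le[OF h C], of "chart_current \<kappa> \<omega> U z e l" t] R by (simp add: comp_def)
    qed simp_all
    then show ?thesis by simp
  qed
  show "global_relation \<kappa> A \<omega> g c h"
    if h: "global_relation \<kappa> A \<omega> f c h" and eq: "AE x in kaehler_vol A \<omega>. f x = g x" for f g c h
  proof -
    have "d_wedge_dc_le \<kappa> (z ` U) (g \<circ> inv_into U z) (chart_current \<kappa> \<omega> U z c h)" if C: "(U, z) \<in> A" for U z
      using d_wedge_dc_le_AE[OF chart_open[OF C] le[OF h C], of "g \<circ> inv_into U z"] chart_AE[OF eq C]
      by (simp add: comp_def)
    with h show ?thesis by (auto simp: global_relation_def d_wedge_dc_le_mfd_iff)
  qed
qed

text \<open>
  A chain carries real potentials. A defining sequence is recovered from it by choosing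
  quasi-plurisubharmonic functions which they represent.
\<close>

lemma global_quasinorm:
  assumes \<kappa>: "0 \<le> \<kappa>" and q: "1 \<le> q"
  shows "quasinorm_mod_ae (kaehler_vol A \<omega>) (Wstar_glob \<kappa> A \<omega> q) (Wstar_norm_glob \<kappa> A \<omega> q)"
proof -
  interpret energy_relation "kaehler_vol A \<omega>" "W12_mfd A \<omega>" "global_relation \<kappa> A \<omega>"
    by (rule global_energy_relation[OF \<kappa>])
  have W: "Wstar_glob \<kappa> A \<omega> n = W n" for n
  proof (induction n)
    case (Suc n)
    show ?case unfolding Wstar_glob.simps W.simps Suc unfolding global_relation_def by blast
  qed simp
  have costs: "{\<Sum>j=1..q. c j powr (1 / 2 ^ j) | c \<Phi>. defining_seq_glob \<kappa> A \<omega> q f c \<Phi>} = costs q f" for f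
  proof (intro equalityI subsetI)
    fix s assume "s \<in> {\<Sum>j=1..q. c j powr (1 / 2 ^ j) | c \<Phi>. defining_seq_glob \<kappa> A \<omega> q f c \<Phi>}"
    then obtain c \<Phi> where s: "s = cost q c" and \<Phi>: "defining_seq_glob \<kappa> A \<omega> q f c \<Phi>"
      unfolding cost_def by blast
    define h where "h j = (if j = 0 then f else real_of_ereal \<circ> \<Phi> j)" for j :: nat
    have "global_relation \<kappa> A \<omega> (h j) (c (Suc j)) (h (Suc j))" if "j < q" for j
      using \<Phi>[unfolded defining_seq_glob_def, rule_format, of "Suc j"] that
      by (auto simp: global_relation_def h_def)
    then have "chain q f c h" by (simp add: chain_def h_def)
    then show "s \<in> costs q f" by (auto simp: costs_def s)
  next
    fix s assume "s \<in> costs q f"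
    then obtain c h where ch: "s = cost q c" "chain q f c h" by (auto simp: costs_def)
    have "\<forall>j\<in>{1..q}. \<exists>\<psi>. quasi_psh A \<psi> \<and> h j = real_of_ereal \<circ> \<psi> \<and> 0 \<le> c j \<and>
        d_wedge_dc_le_mfd \<kappa> A \<omega> (h (j - 1)) (c j) (h j)"
    proof
      fix j assume "j \<in> {1..q}"
      then have "global_relation \<kappa> A \<omega> (h (j - 1)) (c j) (h j)"
        using ch(2) by (cases j) (auto simp: chain_def)
      then show "\<exists>\<psi>. quasi_psh A \<psi> \<and> h j = real_of_ereal \<circ> \<psi> \<and> 0 \<le> c j \<and>
        d_wedge_dc_le_mfd \<kappa> A \<omega> (h (j - 1)) (c j) (h j)"
        unfolding global_relation_def by blast
    qed
    then obtain \<Phi> where \<Phi>: "\<forall>j\<in>{1..q}. quasi_psh A (\<Phi> j) \<and> h j = real_of_ereal \<circ> \<Phi> j \<and> 0 \<le> c j \<and>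
        d_wedge_dc_le_mfd \<kappa> A \<omega> (h (j - 1)) (c j) (h j)" by (rule bchoice[THEN exE])
    have "defining_seq_glob \<kappa> A \<omega> q f c \<Phi>"
      unfolding defining_seq_glob_def
    proof
      fix j assume j: "j \<in> {1..q}"
      have hj: "h j = real_of_ereal \<circ> \<Phi> j" using \<Phi> j by blast
      have prev: "(if j = 1 then f else real_of_ereal \<circ> \<Phi> (j - 1)) = h (j - 1)"
      proof (cases "j = 1")
        case False
        with j have "j - 1 \<in> {1..q}" by auto
        with \<Phi> False show ?thesis by auto
      qed (use ch(2) in \<open>simp add: chain_def\<close>)
      show "0 \<le> c j \<and> quasi_psh A (\<Phi> j) \<and>
        d_wedge_dc_le_mfd \<kappa> A \<omega> (if j = 1 then f else real_of_ereal \<circ> \<Phi> (j - 1)) (c j) (real_of_ereal \<circ> \<Phi> j)"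
        unfolding prev hj[symmetric] using \<Phi> j by blast
    qed
    then show "s \<in> {\<Sum>j=1..q. c j powr (1 / 2 ^ j) | c \<Phi>. defining_seq_glob \<kappa> A \<omega> q f c \<Phi>}"
      unfolding ch(1) cost_def by blast
  qed
  have "Wstar_norm_glob \<kappa> A \<omega> q = N q"
    by (rule ext) (simp only: Wstar_norm_glob_def N_def costs)
  with quasinorm[OF q] show ?thesis by (simp add: W)
qed

end

theorem proposition2p1:
  fixes q :: nat and \<kappa> :: real
  assumes "q \<ge> 1" and "\<kappa> > 0"
  shows
    "(\<forall>\<Omega> :: (complex^'k::finite) set.
        open \<Omega> \<and> connected \<Omega> \<and> \<Omega> \<noteq> {} \<and> bounded \<Omega> \<longrightarrow>
        quasinorm_mod_ae (lebesgue_on \<Omega>) (Wstar_loc \<kappa> \<Omega> q) (Wstar_norm_loc \<kappa> \<Omega> q)) \<and>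
     (\<forall>(A :: ('x::t2_space, 'k) chart set) \<omega>.
        compact_kaehler A \<omega> \<longrightarrow>
        quasinorm_mod_ae (kaehler_vol A \<omega>) (Wstar_glob \<kappa> A \<omega> q) (Wstar_norm_glob \<kappa> A \<omega> q))"
proof (intro conjI allI impI)
  fix \<Omega> :: "(complex^'k) set"
  assume "open \<Omega> \<and> connected \<Omega> \<and> \<Omega> \<noteq> {} \<and> bounded \<Omega>"
  then show "quasinorm_mod_ae (lebesgue_on \<Omega>) (Wstar_loc \<kappa> \<Omega> q) (Wstar_norm_loc \<kappa> \<Omega> q)"
    using assms by (intro local_quasinorm) auto
next
  fix A :: "('x, 'k) chart set" and \<omega>
  assume "compact_kaehler A \<omega>"
  then have "complex_atlas A" "kaehler_form A \<omega>" by (simp_all add: compact_kaehler_def)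
  then show "quasinorm_mod_ae (kaehler_vol A \<omega>) (Wstar_glob \<kappa> A \<omega> q) (Wstar_norm_glob \<kappa> A \<omega> q)"
    using assms by (intro global_quasinorm) auto
qed

end
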